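(* Let $\mu,\lambda$ be constants with $\mu>0$ and $\nu:=2\mu+\lambda>0$, and let $\gamma>1$. Consider the one-dimensional isentropic compressible Navier–Stokes equations $$\rho_t+(\rho u)_x=0,\qquad (\rho u)_t+(\rho u^2+\rho^\gamma)_x=\nu u_{xx},\qquad (x,t)\in\mathbb{R}\times(0,T],$$ with initial data $(\rho,u)(x,0)=(\rho_0,u_0)(x)$, where $\rho_0,u_0$ are continuous, $\operatorname{supp}\rho_0=[0,1]$ and $\rho_0(x)>0$ for $x\in I:=(0,1)$. Suppose that the initial data satisfy one of the following two conditions: there exist positive numbers $\lambda_1,\lambda_2,\lambda_3,\lambda_4$ with $0<\lambda_3,\lambda_4<1$ such that either $$\frac{(\rho_0)_x}{\rho_0}\ge\lambda_1 \text{ in }(0,\lambda_3),\qquad u_0(\lambda_3)<0,\qquad u_0\le 0\text{ in }(0,\lambda_3),$$ or $$\frac{(\rho_0)_x}{\rho_0}\le-\lambda_2 \text{ in }(\lambda_4,1),\qquad u_0(\lambda_4)>0,\qquad u_0\ge 0\text{ in }(\lambda_4,1).$$ Then for every $T>0$ and every $m>2$, this Cauchy problem has no solution $(\rho,u)$ in $C^1([0,T];H^m(\mathbb{R}))$.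
   Context: $H^m(\mathbb{R})$ denotes the standard (inhomogeneous) $L^2$-based Sobolev space. The pressure law is $p=\rho^\gamma$. *)

theory Defs
  imports "HOL-Analysis.Analysis"
begin

definition test_fn :: "(real \<Rightarrow> real) \<Rightarrow> bool" where
  "test_fn \<phi> \<longleftrightarrow> (\<forall>k x. (deriv ^^ k) \<phi> differentiable (at x))
      \<and> (\<exists>R. \<forall>x. R < \<bar>x\<bar> \<longrightarrow> \<phi> x = 0)"

definition fourier :: "(real \<Rightarrow> real) \<Rightarrow> real \<Rightarrow> complex" where
  "fourier \<phi> \<xi> = (LINT x|lborel. complex_of_real (\<phi> x) * exp (- (complex_of_real (2 * pi * \<xi> * x)) * \<i>))"

definition is_ft :: "(real \<Rightarrow> real) \<Rightarrow> (real \<Rightarrow> complex) \<Rightarrow> bool" where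
  "is_ft f g \<longleftrightarrow> g \<in> borel_measurable lborel
      \<and> integrable lborel (\<lambda>\<xi>. (cmod (g \<xi>))\<^sup>2)
      \<and> (\<forall>\<phi>. test_fn \<phi> \<longrightarrow>
            (LINT \<xi>|lborel. g \<xi> * complex_of_real (\<phi> \<xi>))
          = (LINT x|lborel. complex_of_real (f x) * fourier \<phi> x))"

definition sobolev :: "real \<Rightarrow> (real \<Rightarrow> real) \<Rightarrow> bool" where
  "sobolev m f \<longleftrightarrow> f \<in> borel_measurable lborel
      \<and> integrable lborel (\<lambda>x. (f x)\<^sup>2)
      \<and> (\<exists>g. is_ft f g \<and> integrable lborel (\<lambda>\<xi>. (1 + \<xi>\<^sup>2) powr m * (cmod (g \<xi>))\<^sup>2))"

definition hnorm :: "real \<Rightarrow> (real \<Rightarrow> real) \<Rightarrow> real" where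
  "hnorm m f = sqrt (LINT \<xi>|lborel. (1 + \<xi>\<^sup>2) powr m * (cmod ((SOME g. is_ft f g) \<xi>))\<^sup>2)"

definition C1_Hm :: "real \<Rightarrow> real \<Rightarrow> (real \<Rightarrow> real \<Rightarrow> real) \<Rightarrow> (real \<Rightarrow> real \<Rightarrow> real) \<Rightarrow> bool" where
  "C1_Hm m T U V \<longleftrightarrow>
     (\<forall>t\<in>{0..T}. sobolev m (U t) \<and> sobolev m (V t))
   \<and> (\<forall>t\<in>{0..T}. ((\<lambda>s. hnorm m (\<lambda>x. (U s x - U t x) / (s - t) - V t x)) \<longlongrightarrow> 0)
                    (at t within {0..T}))
   \<and> (\<forall>t\<in>{0..T}. ((\<lambda>s. hnorm m (\<lambda>x. V s x - V t x)) \<longlongrightarrow> 0) (at t within {0..T}))"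

text \<open>(rho,u) in C^1([0,T];H^m) solves the 1D isentropic compressible Navier-Stokes
  Cauchy problem with viscosity nu and pressure rho^gamma; the equations hold
  for each t in (0,T] in the sense of distributions in x (time derivatives are
  the H^m-valued derivatives rho', u').\<close>
definition NS_solution ::
  "real \<Rightarrow> real \<Rightarrow> real \<Rightarrow> real \<Rightarrow> (real \<Rightarrow> real) \<Rightarrow> (real \<Rightarrow> real)
   \<Rightarrow> (real \<Rightarrow> real \<Rightarrow> real) \<Rightarrow> (real \<Rightarrow> real \<Rightarrow> real) \<Rightarrow> bool" where
  "NS_solution \<nu> \<gamma> m T \<rho>0 u0 \<rho> u \<longleftrightarrow>
    (\<exists>\<rho>' u'. C1_Hm m T \<rho> \<rho>' \<and> C1_Hm m T u u'
      \<and> (AE x in lborel. \<rho> 0 x = \<rho>0 x) \<and> (AE x in lborel. u 0 x = u0 x)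
      \<and> (\<forall>t\<in>{0<..T}. \<forall>\<phi>. test_fn \<phi> \<longrightarrow>
           (LINT x|lborel. \<rho>' t x * \<phi> x - \<rho> t x * u t x * deriv \<phi> x) = 0
         \<and> (LINT x|lborel. (\<rho>' t x * u t x + \<rho> t x * u' t x) * \<phi> x
               - (\<rho> t x * (u t x)\<^sup>2 + \<rho> t x powr \<gamma>) * deriv \<phi> x)
           = \<nu> * (LINT x|lborel. u t x * deriv (deriv \<phi>) x)))"

end

(*
A solution is continuous in time with values in C^1, so the mass equation holds pointwise, and the
momentum equation exhibits u_xx as a continuous function.  In the vacuum u_xx = 0, so u is affine
and square integrable on a half line, hence zero there; as the boundary of the vacuum is moved by
u, it stays at 0 and 1, where u = u_x = 0 for t > 0.

Near x = 0 the condition rho_x >= l1 rho persists for a short time with a smaller constant (minimum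
principle for Y = rho_x - k(t) rho), so the pressure is increasing and U = -u satisfies
rho U_t + rho u U_x - nu U_xx >= 0.  The barrier eps (exp (K (x - b(t))) - 1), where b decreases
linearly from a to 0 on [0, tau], is a strict subsolution lying below U on the parabolic boundary of
[0, a] x [0, tau].  Comparison gives -u_x(tau, 0) >= eps K > 0, contradicting u_x(tau, 0) = 0.
The other alternative follows by the reflection x -> 1 - x.
*)
theory Submission
  imports Defs "HOL-Probability.Probability"
begin

section \<open>Transport and propagation of vacuum\<close>

text \<open>The Sobolev embedding supplies one continuous derivative in x, and the equations hold as
  distributions for t > 0. This shapes the whole proof. The derivative u_xx is obtained from the
  momentum equation, while rho_xx is never available: the minimum principle for Y therefore
  differentiates the product u Y, which the mass equation expresses through differentiable
  quantities. No flow map is used. Regions have straight sides, and at an extremum one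
  differentiates along the line whose velocity is frozen there. The vacuum boundary is caught by a
  front -eps (1 + t): the fluid is at rest at its tip, so a front receding at speed eps is not
  overtaken, and eps is arbitrary. Since rho vanishes at the boundary, the momentum equation
  degenerates there, but rho multiplies only the material derivative, so the comparison argument
  uses an upper bound of rho; this is the origin of K. Elements of H^m are functions up to null
  sets, so every pointwise statement concerns the representative given by Fourier inversion, and
  inversion has to be proved for transforms defined by duality with test functions.\<close>

lemma deriv_nonpos_at_left_min:
  fixes g :: "real \<Rightarrow> real"
  assumes "(g has_real_derivative d) (at \<tau> within {0..T})" "0 < \<tau>" "\<tau> \<le> T"
    and "eventually (\<lambda>s. g s \<ge> g \<tau>) (at_left \<tau>)"
  shows "d \<le> 0"
proof (rule ccontr)
  assume "\<not> d \<le> 0"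
  then obtain e where e: "e > 0" "\<forall>h>0. \<tau> - h \<in> {0..T} \<longrightarrow> h < e \<longrightarrow> g (\<tau> - h) < g \<tau>"
    using has_real_derivative_pos_inc_left[OF assms(1)] by auto
  obtain b where b: "b < \<tau>" "\<And>y. y > b \<Longrightarrow> y < \<tau> \<Longrightarrow> g y \<ge> g \<tau>"
    using assms(4) unfolding eventually_at_left_field by blast
  \<comment> \<open>The three bounds place \<open>\<tau> - h\<close> where the function is strictly
    smaller, inside \<open>{0..T}\<close>, and where the minimality assumption holds.\<close>
  define h where "h = min (e/2) (min (\<tau>/2) ((\<tau> - b)/2))"
  have "h > 0" "h < e" "h < \<tau>" "h < \<tau> - b" using e(1) b(1) assms(2) by (auto simp: h_def min_def)
  then have "g (\<tau> - h) < g \<tau>" "g (\<tau> - h) \<ge> g \<tau>" using e b assms by auto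
  then show False by simp
qed

text \<open>Strictly above the line, continuity suffices. On the line, \<open>v \<le> b\<close>
  means that the path with velocity \<open>v\<close> lies above it at earlier times. This keeps a
  backward step inside the region of the minimum principle.\<close>

lemma eventually_above_line_backwards:
  fixes a b \<xi> v \<tau> t0 :: real
  assumes "a + b * (\<tau> - t0) \<le> \<xi>" "\<xi> = a + b * (\<tau> - t0) \<Longrightarrow> v \<le> b"
  shows "eventually (\<lambda>s. a + b * (s - t0) \<le> \<xi> + v * (s - \<tau>)) (at_left \<tau>)"
proof (cases "\<xi> = a + b * (\<tau> - t0)")
  case True
  have "a + b * (s - t0) \<le> \<xi> + v * (s - \<tau>)" if "s < \<tau>" for s
  proof -
    have "b * (s - \<tau>) \<le> v * (s - \<tau>)" using that assms(2)[OF True] by (intro mult_right_mono_neg) auto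
    then show ?thesis using True by (simp add: algebra_simps)
  qed
  then show ?thesis unfolding eventually_at_left_field by (intro exI[of _ "\<tau> - 1"]) auto
next
  case False
  have "((\<lambda>s. \<xi> + v * (s - \<tau>) - (a + b * (s - t0))) \<longlongrightarrow> \<xi> + v * (\<tau> - \<tau>) - (a + b * (\<tau> - t0))) (at_left \<tau>)"
    by (intro tendsto_intros)
  moreover have "\<xi> + v * (\<tau> - \<tau>) - (a + b * (\<tau> - t0)) > 0" using False assms(1) by simp
  ultimately have "eventually (\<lambda>s. \<xi> + v * (s - \<tau>) - (a + b * (s - t0)) > 0) (at_left \<tau>)"
    by (rule order_tendstoD)
  then show ?thesis by eventually_elim simp
qed

lemma zero_by_left_continuity:
  fixes f :: "real \<Rightarrow> real"
  assumes "isCont f a" "\<And>x. x < a \<Longrightarrow> f x = 0"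
  shows "f a = 0"
proof -
  have "(f \<longlongrightarrow> f a) (at_left a)" using assms(1) by (auto simp: isCont_def intro: tendsto_within_subset)
  moreover have "(f \<longlongrightarrow> 0) (at_left a)"
    by (rule tendsto_eventually, rule eventually_at_leftI[of "a - 1"]) (auto simp: assms(2))
  ultimately show ?thesis by (rule tendsto_unique[rotated 1]) simp
qed

text \<open>A time derivative at the single point \<open>(t, x)\<close> and a jointly continuous
  space derivative already give joint differentiability at that point, hence a chain rule along
  straight lines.\<close>

lemma curve_derivative:
  fixes f fx ft :: "real \<Rightarrow> real \<Rightarrow> real"
  assumes dx: "\<And>s y. s \<in> S \<Longrightarrow> (f s has_real_derivative fx s y) (at y)"
    and dt: "((\<lambda>s. f s x) has_real_derivative d) (at t within S)"
    and cont: "continuous_on (S \<times> UNIV) (\<lambda>(s, y). fx s y)"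
    and t: "t \<in> S"
  shows "((\<lambda>s. f s (x + c * (s - t))) has_real_derivative d + c * fx t x) (at t within S)"
proof -
  have 1: "((\<lambda>(s, y). f s y) has_derivative (\<lambda>(ts, ty). d * ts + blinfun_scaleR_right (fx t x) ty)) (at (t, x) within S \<times> UNIV)"
  proof (rule has_derivative_partialsI)
    show "((\<lambda>s. f s x) has_derivative (\<lambda>ts. d * ts)) (at t within S)"
      using dt by (simp add: has_field_derivative_def)
    show "((\<lambda>y. f s y) has_derivative blinfun_apply (blinfun_scaleR_right (fx s y))) (at y within UNIV)"
      if "s \<in> S" "y \<in> UNIV" for s y
      using dx[OF that(1), of y] by (simp add: has_field_derivative_def real_scaleR_def[abs_def])
    have "continuous (at (t, x) within S \<times> UNIV) (\<lambda>(s, y). fx s y)"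
      using cont t by (auto simp: continuous_on_eq_continuous_within)
    then have "continuous (at (t, x) within S \<times> UNIV) (\<lambda>p. blinfun_scaleR_right (case p of (s, y) \<Rightarrow> fx s y) :: real \<Rightarrow>\<^sub>L real)"
      by (rule bounded_linear.continuous[OF bounded_linear_blinfun_scaleR_right])
    then show "continuous (at (t, x) within S \<times> UNIV) (\<lambda>(s, y). blinfun_scaleR_right (fx s y) :: real \<Rightarrow>\<^sub>L real)"
      by (simp add: case_prod_unfold)
  qed auto
  have 2: "((\<lambda>s. (s, x + c * (s - t))) has_derivative (\<lambda>h. (h, c * h))) (at t within S)"
    by (auto intro!: derivative_eq_intros)
  have "((\<lambda>s. (case (s, x + c * (s - t)) of (s, y) \<Rightarrow> f s y)) has_derivative
     (\<lambda>h. case (h, c * h) of (ts, ty) \<Rightarrow> d * ts + blinfun_scaleR_right (fx t x) ty)) (at t within S)"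
    by (rule has_derivative_in_compose[OF 2]) (use has_derivative_subset[OF 1, of "(\<lambda>s. (s, x + c * (s - t))) ` S"] in auto)
  moreover have "(\<lambda>h. case (h, c * h) of (ts, ty) \<Rightarrow> d * ts + blinfun_scaleR_right (fx t x) ty) = (*) (d + c * fx t x)"
    by (auto simp: algebra_simps fun_eq_iff)
  ultimately show ?thesis
    unfolding has_field_derivative_def by simp
qed

section \<open>Minimum principle for the mass equation\<close>

locale transport =
  fixes T :: real and \<rho> \<rho>x \<rho>t u ux :: "real \<Rightarrow> real \<Rightarrow> real"
  assumes cont_\<rho>: "continuous_on ({0..T} \<times> UNIV) (\<lambda>(t, x). \<rho> t x)"
    and cont_\<rho>x: "continuous_on ({0..T} \<times> UNIV) (\<lambda>(t, x). \<rho>x t x)"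
    and cont_u: "continuous_on ({0..T} \<times> UNIV) (\<lambda>(t, x). u t x)"
    and cont_ux: "continuous_on ({0..T} \<times> UNIV) (\<lambda>(t, x). ux t x)"
    and deriv_\<rho>x: "\<And>t x. t \<in> {0..T} \<Longrightarrow> (\<rho> t has_real_derivative \<rho>x t x) (at x)"
    and deriv_\<rho>t: "\<And>t x. t \<in> {0..T} \<Longrightarrow> ((\<lambda>s. \<rho> s x) has_real_derivative \<rho>t t x) (at t within {0..T})"
    and mass: "\<And>t x. t \<in> {0<..T} \<Longrightarrow> \<rho>t t x + u t x * \<rho>x t x + ux t x * \<rho> t x = 0"
begin

text \<open>The left side moves at least as fast as the fluid on it and the right side at most as
  fast, so fluid may leave the region but not enter it. Going backwards in time from a point of the
  region one stays inside, which excludes a negative minimum of the weighted density.\<close>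

lemma nonneg_in_trapezoid:
  assumes t01: "0 \<le> t0" "t1 \<le> T"
    and left: "\<And>t. t \<in> {t0<..t1} \<Longrightarrow> u t (a + b * (t - t0)) \<le> b"
    and right: "\<And>t. t \<in> {t0<..t1} \<Longrightarrow> u t (c + d * (t - t0)) \<ge> d"
    and init: "\<And>x. a \<le> x \<Longrightarrow> x \<le> c \<Longrightarrow> \<rho> t0 x \<ge> 0"
    and t: "t \<in> {t0..t1}" and x: "a + b * (t - t0) \<le> x" "x \<le> c + d * (t - t0)"
  shows "\<rho> t x \<ge> 0"
proof (rule ccontr)
  assume neg: "\<not> \<rho> t x \<ge> 0"
  \<comment> \<open>A box that contains the region at all times; it makes the region
    compact.\<close>
  define lo where "lo = a - \<bar>b\<bar> * (t1 - t0)"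
  define hi where "hi = c + \<bar>d\<bar> * (t1 - t0)"
  define B where "B = {t0..t1} \<times> {lo..hi}"
  define R where "R = B \<inter> {p. a + b * (fst p - t0) \<le> snd p} \<inter> {p. snd p \<le> c + d * (fst p - t0)}"
  have bd: "- (\<bar>b\<bar> * (t1 - t0)) \<le> b * (s - t0)" "d * (s - t0) \<le> \<bar>d\<bar> * (t1 - t0)" if "s \<in> {t0..t1}" for s
  proof -
    have "\<bar>b * (s - t0)\<bar> \<le> \<bar>b\<bar> * (t1 - t0)" "\<bar>d * (s - t0)\<bar> \<le> \<bar>d\<bar> * (t1 - t0)"
      using that by (auto simp: abs_mult intro!: mult_left_mono)
    then show "- (\<bar>b\<bar> * (t1 - t0)) \<le> b * (s - t0)" "d * (s - t0) \<le> \<bar>d\<bar> * (t1 - t0)" by linarith+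
  qed
  have R_iff: "(s, y) \<in> R \<longleftrightarrow> s \<in> {t0..t1} \<and> a + b * (s - t0) \<le> y \<and> y \<le> c + d * (s - t0)" for s y
    using bd[of s] by (auto simp: R_def B_def lo_def hi_def)
  have B: "compact B" "B \<subseteq> {0..T} \<times> UNIV" using t01 by (auto simp: B_def compact_Times)
  have R: "compact R"
    unfolding R_def
    by (intro compact_Int_closed B closed_Collect_le continuous_intros)
  have RS: "R \<subseteq> {0..T} \<times> UNIV" using B by (auto simp: R_def)
  obtain L where L: "\<And>s y. (s, y) \<in> R \<Longrightarrow> \<bar>ux s y\<bar> \<le> L"
    using compact_imp_bounded[OF compact_continuous_image[OF continuous_on_subset[OF cont_ux RS] R]]
    by (fastforce simp: bounded_iff)
  \<comment> \<open>Along the fluid \<open>\<rho>\<close> has growth rate \<open>- ux\<close>. With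
    \<open>K > \<bar>ux\<bar>\<close> a negative weighted density strictly increases in time, which
    cannot happen where its minimum is reached from the past.\<close>
  define K where "K = L + 1"
  define Z where "Z = (\<lambda>s y. exp (- K * s) * \<rho> s y)"
  have cZ: "continuous_on R (\<lambda>(s, y). Z s y)"
    using continuous_on_subset[OF cont_\<rho> RS] unfolding Z_def case_prod_unfold
    by (intro continuous_intros)
  have tx: "(t, x) \<in> R" using t x by (simp add: R_iff)
  then obtain p where "p \<in> R" "\<forall>y\<in>R. (case p of (s, y) \<Rightarrow> Z s y) \<le> (case y of (s, y) \<Rightarrow> Z s y)"
    using continuous_attains_inf[OF R _ cZ] by blast
  then obtain \<tau> \<xi> where m: "(\<tau>, \<xi>) \<in> R" and min: "\<And>s y. (s, y) \<in> R \<Longrightarrow> Z \<tau> \<xi> \<le> Z s y"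
    by (cases p) fastforce
  have "Z t x < 0" using neg by (auto simp: Z_def mult_less_0_iff)
  then have Zneg: "Z \<tau> \<xi> < 0" using min[OF tx] by simp
  then have \<rho>neg: "\<rho> \<tau> \<xi> < 0" by (auto simp: Z_def mult_less_0_iff)
  have \<tau>: "t0 < \<tau>" "\<tau> \<le> t1" "a + b * (\<tau> - t0) \<le> \<xi>" "\<xi> \<le> c + d * (\<tau> - t0)"
  proof -
    show "\<tau> \<le> t1" "a + b * (\<tau> - t0) \<le> \<xi>" "\<xi> \<le> c + d * (\<tau> - t0)" using m by (auto simp: R_iff)
    have "\<tau> = t0 \<Longrightarrow> False" using init[of \<xi>] m \<rho>neg by (auto simp: R_iff)
    moreover have "t0 \<le> \<tau>" using m by (auto simp: R_iff)
    ultimately show "t0 < \<tau>" by fastforce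
  qed
  \<comment> \<open>The velocity is frozen at the minimum. The straight line with this velocity is
    tangent to the particle path, so differentiating along it yields the material
    derivative.\<close>
  define v where "v = u \<tau> \<xi>"
  have evl: "eventually (\<lambda>s. a + b * (s - t0) \<le> \<xi> + v * (s - \<tau>)) (at_left \<tau>)"
    by (rule eventually_above_line_backwards) (use left[of \<tau>] \<tau> in \<open>auto simp: v_def\<close>)
  \<comment> \<open>The right side is the same statement with the signs of all positions and
    velocities reversed.\<close>
  have "eventually (\<lambda>s. - c + - d * (s - t0) \<le> - \<xi> + - v * (s - \<tau>)) (at_left \<tau>)"
  proof (rule eventually_above_line_backwards)
    show "- c + - d * (\<tau> - t0) \<le> - \<xi>" using \<tau> by simp
    assume "- \<xi> = - c + - d * (\<tau> - t0)"
    then have "\<xi> = c + d * (\<tau> - t0)" by simp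
    then show "- v \<le> - d" using right[of \<tau>] \<tau> by (simp add: v_def)
  qed
  then have evr: "eventually (\<lambda>s. c + d * (s - t0) \<ge> \<xi> + v * (s - \<tau>)) (at_left \<tau>)"
    by eventually_elim simp
  have "eventually (\<lambda>s. s \<in> {t0<..<\<tau>}) (at_left \<tau>)"
    using \<tau> by (intro eventually_at_leftI) auto
  then have ev: "eventually (\<lambda>s. Z s (\<xi> + v * (s - \<tau>)) \<ge> Z \<tau> (\<xi> + v * (\<tau> - \<tau>))) (at_left \<tau>)"
    using evl evr
  proof eventually_elim
    case (elim s)
    then have "(s, \<xi> + v * (s - \<tau>)) \<in> R" using \<tau> by (auto simp: R_iff)
    from min[OF this] show ?case by simp
  qed
  have \<tau>T: "\<tau> \<in> {0..T}" "\<tau> \<in> {0<..T}" using \<tau> t01 by auto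
  have D: "((\<lambda>s. Z s (\<xi> + v * (s - \<tau>))) has_real_derivative
      exp (- K * \<tau>) * (\<rho>t \<tau> \<xi> + v * \<rho>x \<tau> \<xi> - K * \<rho> \<tau> \<xi>)) (at \<tau> within {0..T})"
    unfolding Z_def
    by (rule derivative_eq_intros curve_derivative[OF deriv_\<rho>x deriv_\<rho>t cont_\<rho>x] \<tau>T | assumption | simp)+
      (simp add: algebra_simps)
  have "exp (- K * \<tau>) * (\<rho>t \<tau> \<xi> + v * \<rho>x \<tau> \<xi> - K * \<rho> \<tau> \<xi>) \<le> 0"
    using deriv_nonpos_at_left_min[OF D _ _ ev] \<tau>T by auto
  then have "\<rho>t \<tau> \<xi> + v * \<rho>x \<tau> \<xi> - K * \<rho> \<tau> \<xi> \<le> 0" by (simp add: mult_le_0_iff)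
  then have "(- ux \<tau> \<xi> - K) * \<rho> \<tau> \<xi> \<le> 0"
    using mass[OF \<tau>T(2), of \<xi>] by (simp add: v_def algebra_simps)
  moreover have "- ux \<tau> \<xi> - K < 0" using L[OF m] by (auto simp: K_def)
  ultimately show False using \<rho>neg by (auto simp: mult_le_0_iff)
qed

text \<open>The mass equation is linear in \<open>\<rho>\<close>, so the minimum principle for
  \<open>- \<rho>\<close> bounds \<open>\<rho>\<close> from above and vacuum propagates as
  well.\<close>

lemma transport_uminus: "transport T (\<lambda>t x. - \<rho> t x) (\<lambda>t x. - \<rho>x t x) (\<lambda>t x. - \<rho>t t x) u ux"
proof
  show "- \<rho>t t x + u t x * - \<rho>x t x + ux t x * - \<rho> t x = 0" if "t \<in> {0<..T}" for t x
    using mass[OF that, of x] by simp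
qed (use cont_\<rho> cont_\<rho>x cont_u cont_ux in \<open>auto simp: case_prod_unfold intro!: continuous_intros derivative_eq_intros deriv_\<rho>x deriv_\<rho>t\<close>)

lemma zero_in_trapezoid:
  assumes "0 \<le> t0" "t1 \<le> T"
    and "\<And>t. t \<in> {t0<..t1} \<Longrightarrow> u t (a + b * (t - t0)) \<le> b"
    and "\<And>t. t \<in> {t0<..t1} \<Longrightarrow> u t (c + d * (t - t0)) \<ge> d"
    and "\<And>x. a \<le> x \<Longrightarrow> x \<le> c \<Longrightarrow> \<rho> t0 x = 0"
    and "t \<in> {t0..t1}" and "a + b * (t - t0) \<le> x" "x \<le> c + d * (t - t0)"
  shows "\<rho> t x = 0"
  using nonneg_in_trapezoid[OF assms(1-4) _ assms(6-8)] assms(5)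
    transport.nonneg_in_trapezoid[OF transport_uminus assms(1-4) _ assms(6-8)]
  by fastforce

text \<open>The region is the backward cone of \<open>(t, x)\<close>: its sides move with speeds
  \<open>M\<close> and \<open>- M\<close>, so no fluid crosses them inwards, and they meet at the
  given point.\<close>

lemma nonneg_if_bounded_velocity:
  assumes u: "\<And>t x. t \<in> {0..T} \<Longrightarrow> \<bar>u t x\<bar> \<le> M" and init: "\<And>x. \<rho> 0 x \<ge> 0" and t: "t \<in> {0..T}"
  shows "\<rho> t x \<ge> 0"
proof (rule nonneg_in_trapezoid[where ?t0.0 = 0 and ?t1.0 = T and a = "x - M * t" and b = M and c = "x + M * t" and d = "- M"])
  fix s assume s: "s \<in> {0<..T}"
  show "u s (x - M * t + M * (s - 0)) \<le> M"
    using u[of s] s by (auto simp: abs_le_iff)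
  show "- M \<le> u s (x + M * t + - M * (s - 0))"
    using u[of s] s by (auto simp: abs_le_iff minus_le_iff)
qed (use init t in auto)

end

text \<open>The pointwise form into which weak solutions are brought. \<open>uxx\<close> is
  continuous up to t = 0 but is the derivative of \<open>ux\<close> for t > 0, where the momentum
  equation holds. One function \<open>\<rho>xt\<close> serves as both mixed derivatives. The vacuum
  is recorded on the left; the right end is reached by reflection.\<close>

locale compressible_flow = transport T \<rho> \<rho>x \<rho>t u ux
  for T :: real and \<rho> \<rho>x \<rho>t u ux :: "real \<Rightarrow> real \<Rightarrow> real" +
  fixes \<nu> \<gamma> M :: real and \<rho>xt ut uxx :: "real \<Rightarrow> real \<Rightarrow> real"
  assumes T: "T > 0" and \<nu>: "\<nu> > 0" and \<gamma>: "\<gamma> > 1"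
    and u_bounded: "\<And>t x. t \<in> {0..T} \<Longrightarrow> \<bar>u t x\<bar> \<le> M"
    and u_square_integrable: "\<And>t. t \<in> {0..T} \<Longrightarrow> integrable lborel (\<lambda>x. (u t x)\<^sup>2)"
    and cont_uxx: "continuous_on ({0..T} \<times> UNIV) (\<lambda>(t, x). uxx t x)"
    and deriv_ux: "\<And>t x. t \<in> {0..T} \<Longrightarrow> (u t has_real_derivative ux t x) (at x)"
    and deriv_ut: "\<And>t x. t \<in> {0..T} \<Longrightarrow> ((\<lambda>s. u s x) has_real_derivative ut t x) (at t within {0..T})"
    and deriv_uxx: "\<And>t x. t \<in> {0<..T} \<Longrightarrow> (ux t has_real_derivative uxx t x) (at x)"
    and deriv_\<rho>xt: "\<And>t x. t \<in> {0..T} \<Longrightarrow> ((\<lambda>s. \<rho>x s x) has_real_derivative \<rho>xt t x) (at t within {0..T})"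
    and deriv_\<rho>tx: "\<And>t x. t \<in> {0..T} \<Longrightarrow> (\<rho>t t has_real_derivative \<rho>xt t x) (at x)"
    and momentum: "\<And>t x. t \<in> {0<..T} \<Longrightarrow> \<nu> * uxx t x =
        \<rho> t x * (ut t x + u t x * ux t x) + \<gamma> * \<rho> t x powr (\<gamma> - 1) * \<rho>x t x"
    and init_nonneg: "\<And>x. \<rho> 0 x \<ge> 0"
    and init_vacuum: "\<And>x. x \<le> 0 \<Longrightarrow> \<rho> 0 x = 0"
begin

section \<open>Persistence of the vacuum and of its boundary\<close>

lemma M_nonneg: "M \<ge> 0"
  using u_bounded[of 0 0] T by simp

lemma density_nonneg: "t \<in> {0..T} \<Longrightarrow> \<rho> t x \<ge> 0"
  by (rule nonneg_if_bounded_velocity[OF u_bounded init_nonneg])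

text \<open>A crude front that recedes with the maximal speed \<open>M\<close>. It keeps each x < 0
  in the vacuum for a short time, which is what the initial velocity requires.\<close>

lemma finite_speed:
  assumes t: "t \<in> {0..T}" and x: "x \<le> - M * t"
  shows "\<rho> t x = 0"
proof (rule zero_in_trapezoid[where ?t0.0 = 0 and ?t1.0 = T and a = "x - M * t" and b = M and c = 0 and d = "- M"])
  fix s assume s: "s \<in> {0<..T}"
  show "u s (x - M * t + M * (s - 0)) \<le> M"
    using u_bounded[of s] s by (auto simp: abs_le_iff)
  show "- M \<le> u s (0 + - M * (s - 0))"
    using u_bounded[of s] s by (auto simp: abs_le_iff minus_le_iff)
qed (use t x in \<open>auto simp: init_vacuum\<close>)

text \<open>The momentum equation reduces to \<open>\<nu> * uxx = 0\<close>, so u is affine on the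
  half line. The bound \<open>M\<close> excludes a non-zero slope, and square integrability then
  excludes a non-zero constant.\<close>

lemma velocity_zero_in_vacuum:
  assumes t: "t \<in> {0<..T}" and vac: "\<And>y. y \<le> c \<Longrightarrow> \<rho> t y = 0" and x: "x \<le> c"
  shows "u t x = 0" "ux t x = 0"
proof -
  have t': "t \<in> {0..T}" using t by auto
  \<comment> \<open>The pressure term vanishes too, both through
    \<open>0 powr (\<gamma> - 1) = 0\<close> and through its convention-free reading as a positive
    power of zero.\<close>
  have uxx0: "uxx t y = 0" if "y \<le> c" for y
    using momentum[OF t, of y] vac[OF that] \<nu> by simp
  have ux_const: "ux t y = ux t c" if "y \<le> c" for y
  proof (cases "y = c")
    case False
    then have "y < c" using that by simp
    from MVT2[OF this, of "ux t" "uxx t"] obtain z where "z < c" "ux t c - ux t y = (c - y) * uxx t z"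
      using deriv_uxx[OF t] by auto
    then show ?thesis using uxx0[of z] by simp
  qed simp
  have aff: "u t c - u t y = (c - y) * ux t c" if "y \<le> c" for y
  proof (cases "y = c")
    case False
    then have "y < c" using that by simp
    from MVT2[OF this, of "u t" "ux t"] obtain z where "z < c" "u t c - u t y = (c - y) * ux t z"
      using deriv_ux[OF t'] by auto
    then show ?thesis using ux_const[of z] by simp
  qed simp
  have ux0: "ux t c = 0"
  proof (rule ccontr)
    assume k: "ux t c \<noteq> 0"
    \<comment> \<open>Over this length an affine function of slope \<open>ux t c\<close> changes by
      \<open>2 * M + 1\<close>, more than two values bounded by \<open>M\<close> can differ.\<close>
    define d where "d = (2 * M + 1) / \<bar>ux t c\<bar>"
    have d: "d > 0" using k M_nonneg by (simp add: d_def)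
    have "\<bar>u t c - u t (c - d)\<bar> = d * \<bar>ux t c\<bar>" using aff[of "c - d"] d by (simp add: abs_mult)
    also have "\<dots> = 2 * M + 1" using k by (simp add: d_def)
    finally show False using u_bounded[OF t', of c] u_bounded[OF t', of "c - d"] by linarith
  qed
  have uc: "u t y = u t c" if "y \<le> c" for y using aff[OF that] ux0 by simp
  have "u t c = 0"
  proof (rule ccontr)
    assume k: "u t c \<noteq> 0"
    define I where "I = (LINT x|lborel. (u t x)\<^sup>2)"
    have le: "d * (u t c)\<^sup>2 \<le> I" if "d > 0" for d
    proof -
      have "(LINT x|lborel. indicator {c - d..c} x * (u t c)\<^sup>2) \<le> I"
        unfolding I_def
      proof (rule integral_mono)
        show "integrable lborel (\<lambda>x. indicator {c - d..c} x * (u t c)\<^sup>2)"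
          by (intro integrable_mult_left) (simp add: emeasure_lborel_Icc_eq)
        show "indicator {c - d..c} x * (u t c)\<^sup>2 \<le> (u t x)\<^sup>2" for x
          using uc[of x] by (auto simp: indicator_def)
      qed (use u_square_integrable[OF t'] in auto)
      then show ?thesis using that by simp
    qed
    have I: "I \<ge> 0" unfolding I_def by simp
    \<comment> \<open>An interval of this length would contribute \<open>I + 1\<close> to an
      integral whose total is \<open>I\<close>.\<close>
    have "(I + 1) / (u t c)\<^sup>2 > 0" using I k by simp
    from le[OF this] show False using k by simp
  qed
  then show "u t x = 0" "ux t x = 0" using uc[OF x] ux_const[OF x] ux0 by auto
qed

text \<open>The momentum equation is not given at t = 0, so the value is obtained as a limit from
  positive times, at which x is still in the vacuum.\<close>

lemma initial_velocity_zero_in_vacuum: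
  assumes x: "x < 0"
  shows "u 0 x = 0"
proof -
  \<comment> \<open>Up to this time \<open>x \<le> - M * s\<close>, so the crude front has not
    passed x. The summand 1 avoids a division by zero when \<open>M = 0\<close>.\<close>
  define b where "b = min T (- x / (M + 1))"
  have "- x / (M + 1) > 0" using x M_nonneg by (intro divide_pos_pos) auto
  then have b: "b > 0" "b \<le> T" using T by (auto simp: b_def)
  have z: "u s x = 0" if "s \<in> {0<..b}" for s
  proof (rule velocity_zero_in_vacuum[of s x])
    show s: "s \<in> {0<..T}" using that b by auto
    have "s \<le> - x / (M + 1)" using that by (simp add: b_def)
    then have "s * (M + 1) \<le> - x" using M_nonneg by (subst (asm) pos_le_divide_eq) auto
    then have le: "x \<le> - M * s" using that by (simp add: algebra_simps)
    show "\<rho> s y = 0" if "y \<le> x" for y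
      by (rule finite_speed) (use s order_trans[OF that le] in auto)
  qed auto
  have "((\<lambda>s. u s x) \<longlongrightarrow> u 0 x) (at 0 within {0..T})"
    using DERIV_continuous[OF deriv_ut[of 0 x]] T by (simp add: continuous_within)
  moreover have "at 0 within {0..T} = at_right (0::real)" using T by (rule at_within_Icc_at_right)
  ultimately have "((\<lambda>s. u s x) \<longlongrightarrow> u 0 x) (at_right 0)" by simp
  moreover have "((\<lambda>s. u s x) \<longlongrightarrow> 0) (at_right 0)"
    by (rule tendsto_eventually) (rule eventually_at_rightI[of 0 b], use z b in auto)
  ultimately show ?thesis by (rule tendsto_unique[rotated 1]) simp
qed

text \<open>Continuous induction over the last time up to which the region behind the front is
  empty. At that time the fluid is at rest at the tip, hence slower than \<open>\<epsilon>\<close>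
  near it, and the front can be followed further.\<close>

lemma vacuum_behind_slow_front:
  assumes \<epsilon>: "\<epsilon> > 0" and t: "t \<in> {0..T}" and x: "x \<le> - \<epsilon> * (1 + t)"
  shows "\<rho> t x = 0"
proof -
  define P where "P = (\<lambda>t. \<forall>s\<in>{0..t}. \<forall>x\<le>- \<epsilon> * (1 + s). \<rho> s x = 0)"
  define A where "A = {t \<in> {0..T}. P t}"
  have "P 0"
    unfolding P_def
  proof (intro ballI allI impI)
    fix s x assume "s \<in> {0..0::real}" "x \<le> - \<epsilon> * (1 + s)"
    then have "s = 0" "x \<le> 0" using \<epsilon> by auto
    then show "\<rho> s x = 0" using init_vacuum by simp
  qed
  then have A0: "0 \<in> A" using T unfolding A_def by simp
  have AT: "\<And>t. t \<in> A \<Longrightarrow> t \<le> T" unfolding A_def by simp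
  then have bdd: "bdd_above A" by (rule bdd_aboveI)
  define t' where "t' = Sup A"
  have t': "0 \<le> t'" "t' \<le> T"
  proof -
    show "0 \<le> t'" unfolding t'_def by (rule cSup_upper[OF A0 bdd])
    show "t' \<le> T" unfolding t'_def using AT A0 by (intro cSup_least) blast+
  qed
  have less: "\<rho> s x = 0" if sx: "0 \<le> s" "s < t'" "x \<le> - \<epsilon> * (1 + s)" for s x
  proof -
    have "A \<noteq> {}" using A0 by blast
    then obtain r where r: "r \<in> A" "s < r" using less_cSupD[of A s] sx(2) unfolding t'_def by blast
    then have "P r" unfolding A_def by blast
    moreover have "s \<in> {0..r}" using sx r by simp
    ultimately show ?thesis using sx unfolding P_def by blast
  qed
  \<comment> \<open>The set of good times is closed: the front recedes, so a point behind it at time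
    \<open>t'\<close> was behind it earlier, and continuity in time gives the limit.\<close>
  have last: "\<rho> t' x = 0" if x: "x \<le> - \<epsilon> * (1 + t')" for x
  proof (cases "t' = 0")
    case True
    then show ?thesis using x \<epsilon> init_vacuum[of x] by simp
  next
    case False
    then have "t' > 0" using t' by simp
    have "((\<lambda>s. \<rho> s x) \<longlongrightarrow> \<rho> t' x) (at t' within {0..T})"
      using DERIV_continuous[OF deriv_\<rho>t[of t' x]] t' by (simp add: continuous_within)
    then have "((\<lambda>s. \<rho> s x) \<longlongrightarrow> \<rho> t' x) (at t' within {0..t'})"
      by (rule tendsto_within_subset) (use t' in auto)
    then have "((\<lambda>s. \<rho> s x) \<longlongrightarrow> \<rho> t' x) (at_left t')"
      using at_within_Icc_at_left[OF \<open>t' > 0\<close>] by simp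
    moreover have "((\<lambda>s. \<rho> s x) \<longlongrightarrow> 0) (at_left t')"
    proof (rule tendsto_eventually, rule eventually_at_leftI[of 0])
      fix s assume s: "s \<in> {0<..<t'}"
      then have "- \<epsilon> * (1 + t') \<le> - \<epsilon> * (1 + s)" using \<epsilon> by simp
      then show "\<rho> s x = 0" using less[of s x] s x by auto
    qed fact
    ultimately show ?thesis by (rule tendsto_unique[rotated 1]) simp
  qed
  have PA: "P t'" unfolding P_def using less last by (metis atLeastAtMost_iff order_le_less)
  define c where "c = - \<epsilon> * (1 + t')"
  \<comment> \<open>The initial offset \<open>- \<epsilon>\<close> keeps the tip strictly inside the
    initial vacuum, where the velocity at t = 0 is known to vanish.\<close>
  have "c < 0" unfolding c_def using \<epsilon> t' by (simp add: mult_neg_pos)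
  have uc: "u t' c = 0"
  proof (cases "t' = 0")
    case True
    then show ?thesis using initial_velocity_zero_in_vacuum[OF \<open>c < 0\<close>] by simp
  next
    case False
    then show ?thesis using velocity_zero_in_vacuum(1)[of t' c c] last t' by (simp add: c_def)
  qed
  have "t' = T"
  proof (rule ccontr)
    assume "t' \<noteq> T"
    then have t'T: "t' < T" using t' by simp
    obtain \<delta> where \<delta>: "\<delta> > 0" "\<And>s y. s \<in> {0..T} \<Longrightarrow> dist (s, y) (t', c) < \<delta> \<Longrightarrow> dist (u s y) (u t' c) < \<epsilon>"
      using cont_u[unfolded continuous_on_iff, rule_format, of "(t', c)" \<epsilon>] t' \<epsilon> by auto
    \<comment> \<open>During time \<open>h\<close> the front moves by \<open>\<epsilon> * h\<close>,
      so \<open>(1 + \<epsilon>) * h < \<delta>\<close> keeps it in the neighbourhood of the tip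
      where the fluid is slower than \<open>\<epsilon>\<close>.\<close>
    define h where "h = min (T - t') (\<delta> / (2 * (1 + \<epsilon>)))"
    have h: "h > 0" "t' + h \<le> T" "(1 + \<epsilon>) * h < \<delta>"
    proof -
      show "h > 0" "t' + h \<le> T" using t'T \<delta> \<epsilon> by (auto simp: h_def)
      have "(1 + \<epsilon>) * h \<le> (1 + \<epsilon>) * (\<delta> / (2 * (1 + \<epsilon>)))" using \<epsilon> by (intro mult_left_mono) (auto simp: h_def)
      also have "\<dots> = \<delta> / 2" using \<epsilon> by (simp add: field_simps)
      finally show "(1 + \<epsilon>) * h < \<delta>" using \<delta> by simp
    qed
    have slow: "- \<epsilon> \<le> u s (c + - \<epsilon> * (s - t'))" if s: "s \<in> {t'<..t' + h}" for s
    proof -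
      have "dist (s, c + - \<epsilon> * (s - t')) (t', c) \<le> dist s t' + dist (c + - \<epsilon> * (s - t')) c"
        unfolding dist_Pair_Pair by (rule sqrt_sum_squares_le_sum) auto
      also have "\<dots> = (1 + \<epsilon>) * (s - t')" using s \<epsilon> by (simp add: dist_real_def abs_mult algebra_simps)
      also have "\<dots> \<le> (1 + \<epsilon>) * h" using s \<epsilon> by (intro mult_left_mono) auto
      finally have "dist (u s (c + - \<epsilon> * (s - t'))) (u t' c) < \<epsilon>" using h s t' by (intro \<delta>(2)) auto
      then show ?thesis using uc by (simp add: dist_real_def)
    qed
    \<comment> \<open>The front is the right side of the region. The left side moves with speed
      \<open>M\<close> and reaches the given point exactly at time s.\<close>
    have z: "\<rho> s x = 0" if "s \<in> {t'..t' + h}" "x \<le> - \<epsilon> * (1 + s)" for s x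
    proof (rule zero_in_trapezoid[where ?t0.0 = t' and ?t1.0 = "t' + h" and a = "x - M * (s - t')" and b = M and c = c and d = "- \<epsilon>"])
      show "u r (x - M * (s - t') + M * (r - t')) \<le> M" if "r \<in> {t'<..t' + h}" for r
        using u_bounded[of r "x - M * (s - t') + M * (r - t')"] that t' h by auto
      show "x \<le> c + - \<epsilon> * (s - t')" using that by (simp add: c_def algebra_simps)
    qed (use slow last that t' h in \<open>auto simp: c_def\<close>)
    have "P (t' + h)"
      unfolding P_def
    proof (intro ballI allI impI)
      fix s x assume s: "s \<in> {0..t' + h}" and x: "x \<le> - \<epsilon> * (1 + s)"
      show "\<rho> s x = 0"
      proof (cases "s \<le> t'")
        case True
        then have "s \<in> {0..t'}" using s by simp
        then show ?thesis using PA x unfolding P_def by blast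
      next
        case False
        then show ?thesis using s x by (intro z) auto
      qed
    qed
    then have "t' + h \<in> A" using h t' by (auto simp: A_def)
    from cSup_upper[OF this bdd] show False using h by (simp add: t'_def)
  qed
  then show ?thesis using PA t x unfolding P_def by blast
qed

text \<open>Each y < 0 lies behind a sufficiently slow front on all of \<open>[0, T]\<close>; the
  value at 0 follows by continuity.\<close>

lemma vacuum_persists:
  assumes t: "t \<in> {0..T}" and x: "x \<le> 0"
  shows "\<rho> t x = 0"
proof -
  have neg: "\<rho> t y = 0" if "y < 0" for y
  proof (rule vacuum_behind_slow_front[of "- y / (1 + T)"])
    show "0 < - y / (1 + T)" using that T by (intro divide_pos_pos) auto
    have "(1 + t) / (1 + T) \<le> 1" using t T by simp
    then have "- y * ((1 + t) / (1 + T)) \<le> - y * 1" using that by (intro mult_left_mono) auto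
    then show "y \<le> - (- y / (1 + T)) * (1 + t)" by simp
  qed (use t in auto)
  have "\<rho> t 0 = 0" by (rule zero_by_left_continuity[OF DERIV_isCont[OF deriv_\<rho>x[OF t]] neg])
  then show ?thesis using neg[of x] x by (cases "x = 0") auto
qed

lemma velocity_at_vacuum_boundary:
  assumes t: "t \<in> {0<..T}"
  shows "u t 0 = 0" "ux t 0 = 0"
  using velocity_zero_in_vacuum[OF t, of 0 0] vacuum_persists t by auto

text \<open>The nonnegative density vanishes at 0, which is therefore an interior minimum.\<close>

lemma density_gradient_at_vacuum_boundary:
  assumes t: "t \<in> {0..T}"
  shows "\<rho>x t 0 = 0"
  using DERIV_local_min[OF deriv_\<rho>x[OF t], of 1 0] density_nonneg[OF t] vacuum_persists[OF t, of 0] by auto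

end

section \<open>Monotone density and the boundary point lemma\<close>

text \<open>A substitute for the critical point rule when g is merely continuous and only the
  product is differentiable. Where f is non-zero, g is a quotient of differentiable functions; where
  f vanishes, the difference quotient of the product is that of f times g.\<close>

lemma product_derivative_at_local_min:
  fixes f g :: "real \<Rightarrow> real"
  assumes f: "(f has_real_derivative f') (at x)" and g: "isCont g x"
    and d: "d > 0" and min: "\<And>y. \<bar>x - y\<bar> < d \<Longrightarrow> g x \<le> g y"
    and fg: "((\<lambda>z. f z * g z) has_real_derivative e) (at x)"
  shows "e = f' * g x"
proof (cases "f x = 0")
  case True
  have "((\<lambda>z. (f z - f x) / (z - x) * g z) \<longlongrightarrow> f' * g x) (at x)"
    using f g unfolding has_field_derivative_iff isCont_def by (rule tendsto_mult)
  moreover have "((\<lambda>z. (f z - f x) / (z - x) * g z) \<longlongrightarrow> e) (at x)"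
    using fg True unfolding has_field_derivative_iff by simp
  ultimately show ?thesis using tendsto_unique[of "at x"] by (metis trivial_limit_at)
next
  case False
  have "eventually (\<lambda>z. f z \<noteq> 0) (nhds x)"
    using False DERIV_isCont[OF f] by (simp add: isCont_def tendsto_imp_eventually_ne eventually_nhds_conv_at)
  then have ev: "eventually (\<lambda>z. (f z * g z) / f z = g z) (nhds x)" by eventually_elim simp
  have "((\<lambda>z. (f z * g z) / f z) has_real_derivative (e * f x - (f x * g x) * f') / (f x * f x)) (at x)"
    by (rule DERIV_divide[OF fg f False])
  then have "(g has_real_derivative (e * f x - (f x * g x) * f') / (f x * f x)) (at x)"
    using DERIV_cong_ev[OF refl ev refl] by simp
  from DERIV_local_min[OF this d] min False show ?thesis by auto
qed

text \<open>A negative second derivative makes \<open>f'\<close> negative just to the right of the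
  critical point, and the mean value theorem then produces a smaller value.\<close>

lemma second_derivative_nonneg_at_local_min:
  fixes f :: "real \<Rightarrow> real"
  assumes f: "\<And>y. (f has_real_derivative f' y) (at y)" and f': "(f' has_real_derivative f'') (at x)"
    and d: "d > 0" and min: "\<And>y. \<bar>x - y\<bar> < d \<Longrightarrow> f x \<le> f y"
  shows "f'' \<ge> 0"
proof (rule ccontr)
  assume "\<not> f'' \<ge> 0"
  then obtain e where e: "e > 0" "\<And>h. h > 0 \<Longrightarrow> h < e \<Longrightarrow> f' (x + h) < f' x"
    using has_real_derivative_neg_dec_right[OF f'] by auto
  have 0: "f' x = 0" using DERIV_local_min[OF f d] min by auto
  define h where "h = min (d/2) (e/2)"
  have h: "h > 0" "h < d" "h < e" using d e by (auto simp: h_def min_def)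
  obtain z where z: "x < z" "z < x + h" "f (x + h) - f x = (x + h - x) * f' z"
    using MVT2[of x "x + h" f f'] h f by auto
  have "f' z < 0" using e(2)[of "z - x"] z h 0 by auto
  then have "f (x + h) < f x" using z mult_pos_neg[OF h(1), of "f' z"] by simp
  moreover have "f x \<le> f (x + h)" using min[of "x + h"] h by auto
  ultimately show False by simp
qed

lemma attains_min_on_box:
  fixes f :: "real \<Rightarrow> real \<Rightarrow> real"
  assumes "continuous_on ({0..\<tau>} \<times> {a..b}) (\<lambda>(t, x). f t x)" "0 \<le> \<tau>" "a \<le> b"
  obtains s y where "s \<in> {0..\<tau>}" "y \<in> {a..b}"
    "\<And>t x. t \<in> {0..\<tau>} \<Longrightarrow> x \<in> {a..b} \<Longrightarrow> f s y \<le> f t x"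
proof -
  have "compact ({0..\<tau>} \<times> {a..b})" "{0..\<tau>} \<times> {a..b} \<noteq> {}" using assms by (auto simp: compact_Times)
  from continuous_attains_inf[OF this assms(1)]
  obtain p where "p \<in> {0..\<tau>} \<times> {a..b}"
     "\<forall>q \<in> {0..\<tau>} \<times> {a..b}. (case p of (t, x) \<Rightarrow> f t x) \<le> (case q of (t, x) \<Rightarrow> f t x)" by blast
  then show ?thesis using that by (cases p) fastforce
qed

lemma positive_for_short_time:
  fixes f :: "real \<Rightarrow> real"
  assumes "(f \<longlongrightarrow> f 0) (at 0 within {0..T})" "f 0 > 0"
  obtains d where "d > 0" "\<And>t. 0 \<le> t \<Longrightarrow> t < d \<Longrightarrow> t \<le> T \<Longrightarrow> f t > 0"
proof -
  have "eventually (\<lambda>t. f t > 0) (at 0 within {0..T})" using assms by (rule order_tendstoD)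
  then obtain d where "d > 0" "\<And>t. t \<in> {0..T} \<Longrightarrow> t \<noteq> 0 \<Longrightarrow> dist t 0 < d \<Longrightarrow> f t > 0"
    unfolding eventually_at by auto
  then show ?thesis using assms(2) by (intro that[of d]) (auto simp: dist_real_def le_less)
qed

section \<open>Comparison arguments next to the vacuum\<close>

context compressible_flow
begin

lemma bounded_on_box:
  fixes f :: "real \<Rightarrow> real \<Rightarrow> real"
  assumes "continuous_on ({0..T} \<times> UNIV) (\<lambda>(t, x). f t x)"
  obtains B where "B > 0" "\<And>t x. t \<in> {0..T} \<Longrightarrow> x \<in> {a..b} \<Longrightarrow> \<bar>f t x\<bar> \<le> B"
proof -
  have "continuous_on ({0..T} \<times> {a..b}) (\<lambda>(t, x). f t x)"
    by (rule continuous_on_subset[OF assms]) auto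
  moreover have "compact ({0..T} \<times> {a..b})" by (intro compact_Times compact_Icc)
  ultimately have "bounded ((\<lambda>(t, x). f t x) ` ({0..T} \<times> {a..b}))"
    by (intro compact_imp_bounded compact_continuous_image)
  then obtain B where "B > 0" "\<forall>p \<in> {0..T} \<times> {a..b}. \<bar>case p of (t, x) \<Rightarrow> f t x\<bar> \<le> B"
    unfolding bounded_pos by auto
  then show ?thesis using that by fastforce
qed

text \<open>Formally Y_t + u Y_x = -2 u_x Y + (C - u_xx - k u_x) rho. The decay rate C of k makes
  the last term nonnegative, so a weighted minimum principle applies. On the side x = 0 both rho and
  rho_x vanish, and on the side x = a the sign is strict for a short time.\<close>

lemma density_increasing_near_boundary:
  assumes a: "a > 0" and l: "l > 0"
    and init: "\<And>x. x \<in> {0..a} \<Longrightarrow> \<rho>x 0 x \<ge> l * \<rho> 0 x" and pos: "\<rho> 0 a > 0"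
  obtains \<tau> where "\<tau> > 0" "\<tau> \<le> T" "\<And>t x. t \<in> {0..\<tau>} \<Longrightarrow> x \<in> {0..a} \<Longrightarrow> \<rho>x t x \<ge> 0"
proof -
  obtain L1 where L1: "L1 > 0" "\<And>t x. t \<in> {0..T} \<Longrightarrow> x \<in> {0..a} \<Longrightarrow> \<bar>ux t x\<bar> \<le> L1"
    using bounded_on_box[OF cont_ux] by metis
  obtain L2 where L2: "L2 > 0" "\<And>t x. t \<in> {0..T} \<Longrightarrow> x \<in> {0..a} \<Longrightarrow> \<bar>uxx t x\<bar> \<le> L2"
    using bounded_on_box[OF cont_uxx] by metis
  \<comment> \<open>Chosen so that \<open>C - uxx - k * ux \<ge> 0\<close> whenever
    \<open>0 \<le> k \<le> l / 2\<close>.\<close>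
  define C where "C = l / 2 * L1 + L2"
  have C: "C > 0" using L1 L2 l by (simp add: C_def add_pos_pos)
  \<comment> \<open>This dominates the coefficient \<open>2 * ux\<close> of Y with room to spare, so
    a negative minimum gives a strict inequality.\<close>
  define K where "K = 2 * L1 + 1"
  have T0: "0 \<in> {0..T}" using T by simp
  obtain \<tau>1 where \<tau>1: "\<tau>1 > 0" "\<And>t. 0 \<le> t \<Longrightarrow> t < \<tau>1 \<Longrightarrow> t \<le> T \<Longrightarrow> \<rho>x t a - l / 2 * \<rho> t a > 0"
  proof -
    have "((\<lambda>t. \<rho>x t a - l / 2 * \<rho> t a) \<longlongrightarrow> \<rho>x 0 a - l / 2 * \<rho> 0 a) (at 0 within {0..T})"
      using DERIV_continuous[OF deriv_\<rho>t[OF T0, of a]] DERIV_continuous[OF deriv_\<rho>xt[OF T0, of a]]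
      by (auto simp: continuous_within intro!: tendsto_intros)
    moreover have "\<rho>x 0 a - l / 2 * \<rho> 0 a > 0"
    proof -
      have "l * \<rho> 0 a > 0" "l * \<rho> 0 a \<le> \<rho>x 0 a" using init[of a] a l pos by auto
      then show ?thesis by simp
    qed
    ultimately show ?thesis by (rule positive_for_short_time[of "\<lambda>t. \<rho>x t a - l / 2 * \<rho> t a"]) (rule that)
  qed
  \<comment> \<open>The second bound keeps the sign on the side x = a, the third keeps
    \<open>k\<close> nonnegative.\<close>
  define \<tau> where "\<tau> = min T (min (\<tau>1 / 2) (l / (2 * C)))"
  have \<tau>: "\<tau> > 0" "\<tau> \<le> T" "\<tau> < \<tau>1" "\<tau> \<le> l / (2 * C)" using T \<tau>1 C l by (auto simp: \<tau>_def min_def)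
  \<comment> \<open>Starting from \<open>l / 2\<close> instead of \<open>l\<close> leaves a positive
    margin for Y at x = a; the linear decrease contributes the term \<open>C * \<rho>\<close> to the
    time derivative of Y.\<close>
  define k where "k = (\<lambda>t. l / 2 - C * t)"
  have k: "0 \<le> k t" "k t \<le> l / 2" if "t \<in> {0..\<tau>}" for t
  proof -
    have "C * t \<le> C * (l / (2 * C))" using that \<tau> C by (intro mult_left_mono) auto
    then show "0 \<le> k t" using C by (simp add: k_def)
    show "k t \<le> l / 2" using that C by (simp add: k_def)
  qed
  define Y where "Y = (\<lambda>t x. \<rho>x t x - k t * \<rho> t x)"
  define Z where "Z = (\<lambda>t x. exp (- K * t) * Y t x)"
  have sub: "{0..\<tau>} \<times> {0..a} \<subseteq> {0..T} \<times> UNIV" using \<tau> by auto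
  have "continuous_on ({0..\<tau>} \<times> {0..a}) (\<lambda>(t, x). Z t x)"
    using continuous_on_subset[OF cont_\<rho> sub] continuous_on_subset[OF cont_\<rho>x sub]
    unfolding Z_def Y_def k_def case_prod_unfold by (intro continuous_intros)
  then obtain s y where s: "s \<in> {0..\<tau>}" and y: "y \<in> {0..a}"
    and min: "\<And>t x. t \<in> {0..\<tau>} \<Longrightarrow> x \<in> {0..a} \<Longrightarrow> Z s y \<le> Z t x"
    by (rule attains_min_on_box) (use \<tau> a in auto)
  have "Y s y \<ge> 0"
  proof (rule ccontr)
    assume neg: "\<not> Y s y \<ge> 0"
    have sT: "s \<in> {0..T}" using s \<tau> by auto
    note dn = density_nonneg[OF sT]
    have s0: "s \<noteq> 0"
    proof
      assume "s = 0"
      then have "Y s y \<ge> l * \<rho> s y - l / 2 * \<rho> s y" using init[OF y] by (simp add: Y_def k_def)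
      moreover have "l * \<rho> s y \<ge> 0" using dn[of y] l by simp
      ultimately show False using neg by simp
    qed
    have y0: "y \<noteq> 0"
      using neg density_gradient_at_vacuum_boundary[OF sT] vacuum_persists[OF sT, of 0] by (auto simp: Y_def)
    have ya: "y \<noteq> a"
    proof
      assume "y = a"
      have "k s * \<rho> s a \<le> l / 2 * \<rho> s a" using k[OF s] dn by (intro mult_right_mono) auto
      then show False using \<tau>1(2)[of s] neg s \<tau> by (auto simp: Y_def \<open>y = a\<close>)
    qed
    have st: "s \<in> {0<..T}" using s0 sT by auto
    have Dt: "((\<lambda>r. Z r y) has_real_derivative
        exp (- K * s) * (\<rho>xt s y - k s * \<rho>t s y + C * \<rho> s y - K * Y s y)) (at s within {0..T})"
      unfolding Z_def Y_def k_def
      by (rule derivative_eq_intros deriv_\<rho>t[OF sT] deriv_\<rho>xt[OF sT] refl | simp add: algebra_simps)+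
    have "exp (- K * s) * (\<rho>xt s y - k s * \<rho>t s y + C * \<rho> s y - K * Y s y) \<le> 0"
    proof (rule deriv_nonpos_at_left_min[OF Dt])
      show "eventually (\<lambda>r. Z s y \<le> Z r y) (at_left s)"
        by (rule eventually_at_leftI[of 0]) (use min y s st in auto)
    qed (use st in auto)
    then have t_ineq: "\<rho>xt s y - k s * \<rho>t s y + C * \<rho> s y - K * Y s y \<le> 0" by (simp add: mult_le_0_iff)
    \<comment> \<open>Y contains \<open>\<rho>x\<close>, whose space derivative is unknown. The mass
      equation turns \<open>u * Y\<close> into an expression in \<open>\<rho>t\<close>,
      \<open>ux * \<rho>\<close> and \<open>u * \<rho>\<close>, all differentiable in x.\<close>
    have flux: "u s z * Y s z = - \<rho>t s z - ux s z * \<rho> s z - k s * (u s z * \<rho> s z)" for z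
      using mass[OF st, of z] by (simp add: Y_def algebra_simps)
    have "((\<lambda>z. - \<rho>t s z - ux s z * \<rho> s z - k s * (u s z * \<rho> s z)) has_real_derivative
      - \<rho>xt s y - (uxx s y * \<rho> s y + ux s y * \<rho>x s y) - k s * (ux s y * \<rho> s y + u s y * \<rho>x s y)) (at y)"
      by (rule derivative_eq_intros deriv_\<rho>tx[OF sT] deriv_\<rho>x[OF sT] deriv_ux[OF sT] deriv_uxx[OF st] refl | simp add: algebra_simps)+
    then have Dx: "((\<lambda>z. u s z * Y s z) has_real_derivative
      - \<rho>xt s y - (uxx s y * \<rho> s y + ux s y * \<rho>x s y) - k s * (ux s y * \<rho> s y + u s y * \<rho>x s y)) (at y)"
      by (simp add: flux)
    have "isCont (\<lambda>z. \<rho>x s z) y"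
    proof -
      have "continuous_on UNIV (\<lambda>z. (case (s, z) of (t, x) \<Rightarrow> \<rho>x t x))"
        by (rule continuous_on_compose2[OF cont_\<rho>x]) (use sT in \<open>auto intro!: continuous_intros\<close>)
      then show ?thesis by (simp add: continuous_on_eq_continuous_at)
    qed
    then have contY: "isCont (Y s) y"
      unfolding Y_def using DERIV_isCont[OF deriv_\<rho>x[OF sT, of y]] by (auto intro!: continuous_intros)
    \<comment> \<open>The distance from y to the two lateral sides: within it the space minimum over
      the interval is a local one.\<close>
    define e where "e = Min {y, a - y}"
    have "- \<rho>xt s y - (uxx s y * \<rho> s y + ux s y * \<rho>x s y) - k s * (ux s y * \<rho> s y + u s y * \<rho>x s y) = ux s y * Y s y"
    proof (rule product_derivative_at_local_min[OF deriv_ux[OF sT] contY _ _ Dx])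
      show "e > 0" using y y0 ya by (auto simp: e_def)
      fix z assume "\<bar>y - z\<bar> < e"
      then have "z \<in> {0..a}" by (auto simp: e_def abs_less_iff)
      from min[OF s this] show "Y s y \<le> Y s z" by (simp add: Z_def)
    qed
    \<comment> \<open>Combining the time and space conditions leaves the right-hand side of the
      formal equation for Y, with the weight absorbed: a product of two negative factors plus a
      nonnegative multiple of the density.\<close>
    then have "\<rho>xt s y - k s * \<rho>t s y + C * \<rho> s y - K * Y s y
       = (- 2 * ux s y - K) * Y s y + (C - uxx s y - k s * ux s y) * \<rho> s y"
      using mass[OF st, of y] unfolding Y_def by algebra
    moreover have "(- 2 * ux s y - K) * Y s y > 0"
      using L1(2)[OF sT y] neg by (intro mult_neg_neg) (auto simp: K_def)
    moreover have "(C - uxx s y - k s * ux s y) * \<rho> s y \<ge> 0"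
    proof (intro mult_nonneg_nonneg dn)
      have "k s * ux s y \<le> \<bar>k s\<bar> * \<bar>ux s y\<bar>" by (metis abs_ge_self abs_mult)
      also have "\<dots> \<le> l / 2 * L1" using k[OF s] L1(2)[OF sT y] l by (intro mult_mono) auto
      finally show "0 \<le> C - uxx s y - k s * ux s y" using L2(2)[OF sT y] by (simp add: C_def)
    qed
    ultimately show False using t_ineq by linarith
  qed
  then have Zs: "Z s y \<ge> 0" by (simp add: Z_def)
  show ?thesis
  proof (rule that[of \<tau>])
    fix t x assume t: "t \<in> {0..\<tau>}" and x: "x \<in> {0..a}"
    have "Z t x \<ge> 0" using min[OF t x] Zs by simp
    then have "Y t x \<ge> 0" by (simp add: Z_def zero_le_mult_iff)
    moreover have "k t * \<rho> t x \<ge> 0" using k[OF t] density_nonneg[of t x] t \<tau> by auto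
    ultimately show "\<rho>x t x \<ge> 0" by (simp add: Y_def)
  qed (use \<tau> in auto)
qed

text \<open>Initially the velocity is only known to be non-positive inside the interval, so a
  barrier that is positive there could not be placed below -u. Hence its zero starts at the outer
  end a and sweeps to the vacuum boundary while the strict sign of u at x = a feeds it.\<close>

theorem inward_velocity_impossible:
  assumes b: "b > 0" and l: "l > 0"
    and grad: "\<And>x. x \<in> {0<..<b} \<Longrightarrow> \<rho>x 0 x \<ge> l * \<rho> 0 x" and pos: "\<And>x. x \<in> {0<..<b} \<Longrightarrow> \<rho> 0 x > 0"
    and ub: "u 0 b < 0" and u_le: "\<And>x. x \<in> {0<..<b} \<Longrightarrow> u 0 x \<le> 0"
  shows False
proof -
  have T0: "0 \<in> {0..T}" using T by simp
  \<comment> \<open>The gradient and positivity assumptions hold on an open interval, so its end is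
    moved inwards; continuity keeps the velocity negative.\<close>
  obtain a where a: "0 < a" "a < b" "u 0 a < 0"
  proof -
    have "(u 0 \<longlongrightarrow> u 0 b) (at_left b)"
      using DERIV_isCont[OF deriv_ux[OF T0, of b]] by (auto simp: isCont_def intro: tendsto_within_subset)
    then have "eventually (\<lambda>x. u 0 x < 0) (at_left b)" using ub by (rule order_tendstoD)
    moreover have "eventually (\<lambda>x. x \<in> {0<..<b}) (at_left b)"
      using b by (intro eventually_at_leftI) auto
    ultimately have "eventually (\<lambda>x. u 0 x < 0 \<and> x \<in> {0<..<b}) (at_left b)" by eventually_elim simp
    then have "\<exists>x. u 0 x < 0 \<and> x \<in> {0<..<b}"
      by (rule eventually_happens'[rotated]) simp
    then show ?thesis using that by auto
  qed
  have u00: "u 0 0 = 0"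
    by (rule zero_by_left_continuity[OF DERIV_isCont[OF deriv_ux[OF T0]] initial_velocity_zero_in_vacuum])
  have "\<rho>x 0 x \<ge> l * \<rho> 0 x" if "x \<in> {0..a}" for x
    using that grad[of x] a density_gradient_at_vacuum_boundary[OF T0] vacuum_persists[OF T0, of 0] by (cases "x = 0") auto
  then obtain \<tau>1 where \<tau>1: "\<tau>1 > 0" "\<tau>1 \<le> T" "\<And>t x. t \<in> {0..\<tau>1} \<Longrightarrow> x \<in> {0..a} \<Longrightarrow> \<rho>x t x \<ge> 0"
    using density_increasing_near_boundary[of a l] a l pos[of a] by auto
  \<comment> \<open>Half of the initial inward speed at a: this much survives for a short
    time.\<close>
  define c where "c = - u 0 a / 2"
  have c: "c > 0" using a by (simp add: c_def)
  obtain \<tau>2 where \<tau>2: "\<tau>2 > 0" "\<And>t. 0 \<le> t \<Longrightarrow> t < \<tau>2 \<Longrightarrow> t \<le> T \<Longrightarrow> u t a < - c"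
  proof -
    have "((\<lambda>t. - c - u t a) \<longlongrightarrow> - c - u 0 a) (at 0 within {0..T})"
      using DERIV_continuous[OF deriv_ut[OF T0, of a]] by (auto simp: continuous_within intro!: tendsto_intros)
    moreover have "- c - u 0 a > 0" using a by (simp add: c_def)
    ultimately show ?thesis
      by (rule positive_for_short_time[of "\<lambda>t. - c - u t a"]) (rule that, auto)
  qed
  define \<tau> where "\<tau> = min \<tau>1 (\<tau>2 / 2)"
  have \<tau>: "\<tau> > 0" "\<tau> \<le> \<tau>1" "\<tau> < \<tau>2" "\<tau> \<le> T" using \<tau>1 \<tau>2 by (auto simp: \<tau>_def min_def)
  obtain R where R: "R > 0" "\<And>t x. t \<in> {0..T} \<Longrightarrow> x \<in> {0..a} \<Longrightarrow> \<bar>\<rho> t x\<bar> \<le> R"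
    using bounded_on_box[OF cont_\<rho>] by metis
  \<comment> \<open>Up to the factor \<open>\<epsilon> * K * exp (K * (x - \<beta> t))\<close> the
    barrier has material derivative at most \<open>a / \<tau> + M\<close> and diffusion
    \<open>\<nu> * K\<close>. The value makes diffusion dominate the density bound \<open>R\<close>
    times the former by \<open>\<nu>\<close>.\<close>
  define K where "K = R * (a / \<tau> + M) / \<nu> + 1"
  have K: "K > 0" using R a \<tau> M_nonneg \<nu> by (auto simp: K_def intro!: add_nonneg_pos)
  \<comment> \<open>Then the barrier stays below \<open>c\<close>, hence below -u, on the side x =
    a.\<close>
  define \<epsilon> where "\<epsilon> = c / exp (K * a)"
  have \<epsilon>: "\<epsilon> > 0" using c by (simp add: \<epsilon>_def)
  \<comment> \<open>From \<open>a\<close> at time 0, where the barrier is non-positive on the whole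
    interval, to 0 at time \<open>\<tau>\<close>, where it touches -u at the vacuum
    boundary.\<close>
  define \<beta> where "\<beta> = (\<lambda>t. a - a * t / \<tau>)"
  have \<beta>: "0 \<le> \<beta> t" if "t \<in> {0..\<tau>}" for t
    using that a \<tau> by (simp add: \<beta>_def field_simps)
  define D where "D = (\<lambda>t x. - u t x - \<epsilon> * (exp (K * (x - \<beta> t)) - 1))"
  have sub: "{0..\<tau>} \<times> {0..a} \<subseteq> {0..T} \<times> UNIV" using \<tau> by auto
  have "continuous_on ({0..\<tau>} \<times> {0..a}) (\<lambda>(t, x). D t x)"
    using continuous_on_subset[OF cont_u sub] \<tau>
    unfolding D_def \<beta>_def case_prod_unfold by (intro continuous_intros) auto
  then obtain s y where s: "s \<in> {0..\<tau>}" and y: "y \<in> {0..a}"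
    and min: "\<And>t x. t \<in> {0..\<tau>} \<Longrightarrow> x \<in> {0..a} \<Longrightarrow> D s y \<le> D t x"
    by (rule attains_min_on_box) (use \<tau> a in auto)
  have Ds: "D s y \<ge> 0"
  proof (rule ccontr)
    assume neg: "\<not> D s y \<ge> 0"
    have sT: "s \<in> {0..T}" using s \<tau> by auto
    have s0: "s \<noteq> 0"
    proof
      assume "s = 0"
      have "K * (y - \<beta> 0) \<le> 0" using K y by (simp add: \<beta>_def mult_le_0_iff)
      then have "\<epsilon> * (exp (K * (y - \<beta> 0)) - 1) \<le> 0" using \<epsilon> by (simp add: mult_le_0_iff)
      moreover have "u 0 y \<le> 0" using u_le[of y] u00 y a by (cases "y = 0") auto
      ultimately show False using neg by (simp add: \<open>s = 0\<close> D_def)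
    qed
    have st: "s \<in> {0<..T}" using s0 sT by auto
    have y0: "y \<noteq> 0"
    proof
      assume "y = 0"
      have "K * (0 - \<beta> s) \<le> 0" using K \<beta>[OF s] by (simp add: mult_le_0_iff)
      then have "\<epsilon> * (exp (K * (0 - \<beta> s)) - 1) \<le> 0" using \<epsilon> by (simp add: mult_le_0_iff)
      then show False using neg velocity_at_vacuum_boundary[OF st] by (simp add: \<open>y = 0\<close> D_def)
    qed
    have ya: "y \<noteq> a"
    proof
      assume "y = a"
      have "exp (K * (a - \<beta> s)) \<le> exp (K * a)" using K \<beta>[OF s] by simp
      then have "\<epsilon> * exp (K * (a - \<beta> s)) \<le> \<epsilon> * exp (K * a)" using \<epsilon> by (intro mult_left_mono) auto
      then have "\<epsilon> * exp (K * (a - \<beta> s)) \<le> c" by (simp add: \<epsilon>_def)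
      then show False using neg \<tau>2(2)[of s] s \<tau> \<epsilon> by (auto simp: \<open>y = a\<close> D_def algebra_simps)
    qed
    define E where "E = exp (K * (y - \<beta> s))"
    have E: "E > 0" by (simp add: E_def)
    have d\<beta>: "(\<beta> has_real_derivative - (a / \<tau>)) (at s within {0..T})"
      unfolding \<beta>_def using \<tau> by (auto intro!: derivative_eq_intros simp: field_simps)
    have Dt: "((\<lambda>r. D r y) has_real_derivative - ut s y - \<epsilon> * (E * (K * (a / \<tau>)))) (at s within {0..T})"
      unfolding D_def E_def
      by (rule derivative_eq_intros deriv_ut[OF sT] d\<beta> refl | simp)+
    have t_ineq: "- ut s y - \<epsilon> * (E * (K * (a / \<tau>))) \<le> 0"
    proof (rule deriv_nonpos_at_left_min[OF Dt])
      show "eventually (\<lambda>r. D s y \<le> D r y) (at_left s)"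
        by (rule eventually_at_leftI[of 0]) (use min y s st in auto)
    qed (use st in auto)
    have Dx: "(D s has_real_derivative - ux s z - \<epsilon> * K * exp (K * (z - \<beta> s))) (at z)" for z
      unfolding D_def by (rule derivative_eq_intros deriv_ux[OF sT] refl | simp)+
    have Dxx: "((\<lambda>z. - ux s z - \<epsilon> * K * exp (K * (z - \<beta> s))) has_real_derivative - uxx s y - \<epsilon> * K * (K * E)) (at y)"
      unfolding E_def by (rule derivative_eq_intros deriv_uxx[OF st] refl | simp)+
    define e where "e = Min {y, a - y}"
    have e: "e > 0" using y y0 ya by (auto simp: e_def)
    have loc: "D s y \<le> D s z" if "\<bar>y - z\<bar> < e" for z
    proof -
      from that have "z \<in> {0..a}" by (auto simp: e_def abs_less_iff)
      from min[OF s this] show ?thesis .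
    qed
    have x_eq: "- ux s y - \<epsilon> * K * E = 0"
      using DERIV_local_min[OF Dx e] loc by (auto simp: E_def)
    have xx_ineq: "- uxx s y - \<epsilon> * K * (K * E) \<ge> 0"
      by (rule second_derivative_nonneg_at_local_min[OF Dx Dxx e loc])
    have pressure: "\<gamma> * \<rho> s y powr (\<gamma> - 1) * \<rho>x s y \<ge> 0"
      using \<tau>1(3)[of s y] s y \<tau> \<gamma> by auto
    have \<rho>: "0 \<le> \<rho> s y" "\<rho> s y \<le> R" using density_nonneg[OF sT] R(2)[OF sT y] by auto
    \<comment> \<open>The second-order condition bounds \<open>uxx\<close>, the pressure gradient
      has a favourable sign, the first-order condition replaces \<open>ux\<close>, and the time
      condition bounds \<open>ut\<close>. The common factor \<open>\<epsilon> * K * E\<close>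
      cancels and leaves \<open>\<nu> * K \<le> R * (a / \<tau> + M)\<close>.\<close>
    have "\<nu> * (\<epsilon> * K * (K * E)) \<le> \<nu> * (- uxx s y)" using xx_ineq \<nu> by (intro mult_left_mono) auto
    also have "\<dots> \<le> - \<rho> s y * (ut s y + u s y * ux s y)" using momentum[OF st, of y] pressure by simp
    also have "\<dots> = \<rho> s y * (- ut s y + u s y * (\<epsilon> * K * E))"
      using x_eq by (simp add: algebra_simps) algebra
    also have "\<dots> \<le> R * (\<epsilon> * (E * (K * (a / \<tau>))) + M * (\<epsilon> * K * E))"
    proof -
      have "u s y * (\<epsilon> * K * E) \<le> M * (\<epsilon> * K * E)"
        using u_bounded[OF sT, of y] \<epsilon> K E by (intro mult_right_mono) auto
      then have "- ut s y + u s y * (\<epsilon> * K * E) \<le> \<epsilon> * (E * (K * (a / \<tau>))) + M * (\<epsilon> * K * E)"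
        using t_ineq by linarith
      then have "\<rho> s y * (- ut s y + u s y * (\<epsilon> * K * E)) \<le> \<rho> s y * (\<epsilon> * (E * (K * (a / \<tau>))) + M * (\<epsilon> * K * E))"
        using \<rho> by (intro mult_left_mono)
      also have "\<dots> \<le> R * (\<epsilon> * (E * (K * (a / \<tau>))) + M * (\<epsilon> * K * E))"
        using \<rho> \<epsilon> E K a \<tau> M_nonneg by (intro mult_right_mono) auto
      finally show ?thesis .
    qed
    finally have "(\<nu> * K) * (\<epsilon> * K * E) \<le> (R * (a / \<tau> + M)) * (\<epsilon> * K * E)" by (simp add: algebra_simps)
    then have "\<nu> * K \<le> R * (a / \<tau> + M)" using \<epsilon> K E by (simp add: mult_le_cancel_right)
    moreover have "\<nu> * (q / \<nu> + 1) = q + \<nu>" for q using \<nu> by (simp add: field_simps)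
    then have "\<nu> * K = R * (a / \<tau> + M) + \<nu>" unfolding K_def .
    ultimately show False using \<nu> by linarith
  qed
  have \<tau>T: "\<tau> \<in> {0..T}" "\<tau> \<in> {0<..T}" using \<tau> by auto
  have \<beta>\<tau>: "\<beta> \<tau> = 0" using \<tau> by (simp add: \<beta>_def)
  have "(D \<tau> has_real_derivative - ux \<tau> 0 - \<epsilon> * K * exp (K * (0 - \<beta> \<tau>))) (at 0)"
    unfolding D_def by (rule derivative_eq_intros deriv_ux[OF \<tau>T(1)] refl | simp)+
  \<comment> \<open>Since \<open>ux \<tau> 0 = 0\<close>, only the slope of the barrier remains. D
    vanishes at the boundary and would become negative just inside, against the comparison.\<close>
  then have D\<tau>: "(D \<tau> has_real_derivative - (\<epsilon> * K)) (at 0)"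
    using velocity_at_vacuum_boundary[OF \<tau>T(2)] by (simp add: \<beta>\<tau>)
  obtain d where d: "d > 0" "\<And>h. h > 0 \<Longrightarrow> h < d \<Longrightarrow> D \<tau> (0 + h) < D \<tau> 0"
    using has_real_derivative_neg_dec_right[OF D\<tau>] \<epsilon> K by auto
  define h where "h = min (d / 2) a"
  have h: "h > 0" "h < d" "h \<le> a" using d a by (auto simp: h_def min_def)
  have "D \<tau> 0 = 0" using velocity_at_vacuum_boundary[OF \<tau>T(2)] by (simp add: D_def \<beta>\<tau>)
  then have "D \<tau> h < 0" using d(2)[OF h(1,2)] by simp
  moreover have "D \<tau> h \<ge> 0" using min[of \<tau> h] Ds h \<tau> by auto
  ultimately show False by simp
qed

text \<open>The system is invariant under x -> 1 - x together with u -> -u. Hence \<open>ux\<close>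
  and \<open>\<rho>t\<close> keep their signs, while \<open>\<rho>x\<close>,
  \<open>\<rho>xt\<close>, \<open>ut\<close> and \<open>uxx\<close> change theirs.\<close>

lemma reflected_flow:
  assumes vac: "\<And>x. x \<ge> 1 \<Longrightarrow> \<rho> 0 x = 0"
  shows "compressible_flow T (\<lambda>t x. \<rho> t (1 - x)) (\<lambda>t x. - \<rho>x t (1 - x)) (\<lambda>t x. \<rho>t t (1 - x))
    (\<lambda>t x. - u t (1 - x)) (\<lambda>t x. ux t (1 - x)) \<nu> \<gamma> M (\<lambda>t x. - \<rho>xt t (1 - x)) (\<lambda>t x. - ut t (1 - x)) (\<lambda>t x. - uxx t (1 - x))"
proof -
  have cont: "continuous_on ({0..T} \<times> UNIV) (\<lambda>(t, x). f t (1 - x))"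
    if "continuous_on ({0..T} \<times> UNIV) (\<lambda>(t, x). f t x)" for f :: "real \<Rightarrow> real \<Rightarrow> real"
  proof -
    have "continuous_on ({0..T} \<times> UNIV) (\<lambda>p. (case (fst p, 1 - snd p) of (t, x) \<Rightarrow> f t x))"
      by (rule continuous_on_compose2[OF that]) (auto intro!: continuous_intros)
    then show ?thesis by (simp add: case_prod_unfold)
  qed
  have contm: "continuous_on ({0..T} \<times> UNIV) (\<lambda>(t, x). - f t (1 - x))"
    if "continuous_on ({0..T} \<times> UNIV) (\<lambda>(t, x). f t x)" for f :: "real \<Rightarrow> real \<Rightarrow> real"
    using continuous_on_minus[OF cont[OF that]] by (simp add: case_prod_unfold)
  have d: "((\<lambda>x. f (1 - x)) has_real_derivative - f') (at x)" if "(f has_real_derivative f') (at (1 - x))" for f f' x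
  proof -
    have "((\<lambda>x. 1 - x) has_real_derivative - 1) (at x)" by (auto intro!: derivative_eq_intros)
    from DERIV_chain2[OF that this] show ?thesis by simp
  qed
  have dm: "((\<lambda>x. - f (1 - x)) has_real_derivative f') (at x)" if "(f has_real_derivative f') (at (1 - x))" for f f' x
    using DERIV_minus[OF d[OF that]] by simp
  show ?thesis
  proof
    show "integrable lborel (\<lambda>x. (- u t (1 - x))\<^sup>2)" if "t \<in> {0..T}" for t
      using lborel_integrable_real_affine[OF u_square_integrable[OF that], of "-1" 1] by simp
    show "\<nu> * - uxx t (1 - x) = \<rho> t (1 - x) * (- ut t (1 - x) + - u t (1 - x) * ux t (1 - x)) +
        \<gamma> * \<rho> t (1 - x) powr (\<gamma> - 1) * - \<rho>x t (1 - x)" if "t \<in> {0<..T}" for t x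
      using momentum[OF that, of "1 - x"] by (simp add: algebra_simps)
    show "\<rho>t t (1 - x) + - u t (1 - x) * - \<rho>x t (1 - x) + ux t (1 - x) * \<rho> t (1 - x) = 0" if "t \<in> {0<..T}" for t x
      using mass[OF that, of "1 - x"] by simp
  qed (auto intro!: cont contm cont_\<rho> cont_\<rho>x cont_u cont_ux cont_uxx d dm T \<nu> \<gamma> DERIV_minus
      deriv_\<rho>x deriv_\<rho>t deriv_ux deriv_ut deriv_uxx deriv_\<rho>xt deriv_\<rho>tx init_nonneg vac simp: u_bounded)
qed

end

section \<open>Test functions and weak derivatives\<close>

definition smooth :: "(real \<Rightarrow> real) \<Rightarrow> bool" where
  "smooth f \<longleftrightarrow> (\<forall>k x. (deriv ^^ k) f differentiable (at x))"

lemma test_fn_iff_smooth: "test_fn \<phi> \<longleftrightarrow> smooth \<phi> \<and> (\<exists>R. \<forall>x. R < \<bar>x\<bar> \<longrightarrow> \<phi> x = 0)"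
  by (simp add: test_fn_def smooth_def)

lemma smooth_has_derivative:
  assumes "smooth f"
  shows "(f has_real_derivative deriv f x) (at x)"
proof -
  have "(deriv ^^ 0) f differentiable (at x)" using assms unfolding smooth_def by blast
  then show ?thesis by (simp add: DERIV_deriv_iff_real_differentiable)
qed

lemma smooth_deriv:
  assumes "smooth f"
  shows "smooth (deriv f)"
  unfolding smooth_def
proof (intro allI)
  fix k x
  have "(deriv ^^ Suc k) f differentiable (at x)" using assms unfolding smooth_def by blast
  then show "(deriv ^^ k) (deriv f) differentiable (at x)" by (simp add: funpow_swap1)
qed

text \<open>All iterated derivatives stay in a class closed under differentiation, so smoothness is
  checked by exhibiting such a class rather than by formulas for every order.\<close>

lemma smooth_coinduct:
  assumes "f \<in> C"
    and "\<And>g. g \<in> C \<Longrightarrow> \<exists>h\<in>C. \<forall>x. (g has_real_derivative h x) (at x)"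
  shows "smooth f"
proof -
  have *: "deriv g \<in> C \<and> (\<forall>x. g differentiable (at x))" if g: "g \<in> C" for g
  proof -
    obtain h where h: "h \<in> C" "\<forall>x. (g has_real_derivative h x) (at x)" using assms(2)[OF g] by blast
    then have "deriv g = h" by (auto simp: fun_eq_iff intro: DERIV_imp_deriv)
    then show ?thesis using h by (auto simp: real_differentiable_def)
  qed
  have "(deriv ^^ k) f \<in> C" for k
    by (induction k) (use assms(1) * in auto)
  then show ?thesis using * unfolding smooth_def by blast
qed

lemma smooth_antiderivative:
  assumes f: "\<And>x. (f has_real_derivative g x) (at x)" and g: "smooth g"
  shows "smooth f"
proof (rule smooth_coinduct[of f "insert f (Collect smooth)"])
  fix h assume "h \<in> insert f (Collect smooth)"
  then consider "h = f" | "smooth h" by auto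
  then show "\<exists>k\<in>insert f (Collect smooth). \<forall>x. (h has_real_derivative k x) (at x)"
  proof cases
    case 1
    then show ?thesis using f g by (intro bexI[of _ g]) auto
  next
    case 2
    then show ?thesis by (intro bexI[of _ "deriv h"]) (auto intro: smooth_has_derivative smooth_deriv)
  qed
qed simp

text \<open>The negative powers make the span of this family closed under differentiation.\<close>
definition flat :: "nat \<Rightarrow> real \<Rightarrow> real" where
  "flat n x = (if x > 0 then exp (- (1 / x)) / x ^ n else 0)"

text \<open>With y = 1 / x this is the decay of y ^ n / exp y at infinity.\<close>

lemma flat_tendsto_0: "(flat n \<longlongrightarrow> 0) (at_right 0)"
proof -
  have "((\<lambda>x. (1 / x) ^ n / exp (1 / x)) \<longlongrightarrow> (0::real)) (at_right 0)"
    by (rule filterlim_compose[OF tendsto_power_div_exp_0])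
      (use filterlim_inverse_at_top_right in \<open>simp add: inverse_eq_divide\<close>)
  moreover have "eventually (\<lambda>x. (1 / x) ^ n / exp (1 / x) = flat n x) (at_right 0)"
    by (rule eventually_at_rightI[of 0 1]) (auto simp: flat_def exp_minus field_simps)
  ultimately show ?thesis by (rule Lim_transform_eventually)
qed

lemma flat_has_derivative:
  "(flat n has_real_derivative flat (n + 2) x - real n * flat (n + 1) x) (at x)"
proof (cases x "0 :: real" rule: linorder_cases)
  case less
  have "(flat n has_real_derivative 0) (at x)"
    by (rule has_field_derivative_transform_within_open[where f = "\<lambda>x. 0" and S = "{..<0}"])
      (use less in \<open>auto simp: flat_def\<close>)
  then show ?thesis using less by (simp add: flat_def)
next
  case equal
  have "((\<lambda>y. (flat n y - flat n 0) / (y - 0)) \<longlongrightarrow> 0) (at_left 0)"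
    by (rule tendsto_eventually, rule eventually_at_leftI[of "-1"]) (auto simp: flat_def)
  \<comment> \<open>To the right of 0 the difference quotient of \<open>flat n\<close> at 0 is
    exactly \<open>flat (n + 1)\<close>.\<close>
  moreover have "((\<lambda>y. (flat n y - flat n 0) / (y - 0)) \<longlongrightarrow> 0) (at_right 0)"
  proof (rule Lim_transform_eventually[OF flat_tendsto_0[of "n + 1"]])
    show "eventually (\<lambda>y. flat (n + 1) y = (flat n y - flat n 0) / (y - 0)) (at_right 0)"
      by (rule eventually_at_rightI[of 0 1]) (auto simp: flat_def)
  qed
  ultimately have "((\<lambda>y. (flat n y - flat n 0) / (y - 0)) \<longlongrightarrow> 0) (at 0)"
    by (simp add: filterlim_split_at)
  then show ?thesis using equal by (simp add: has_field_derivative_iff flat_def)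
next
  case greater
  have "((\<lambda>y. exp (- (1 / y)) / y ^ n) has_real_derivative
      exp (- (1 / x)) / x ^ (n + 2) - real n * (exp (- (1 / x)) / x ^ (n + 1))) (at x)"
  proof -
    have "((\<lambda>y. exp (- (1 / y)) * inverse (y ^ n)) has_real_derivative
        exp (- (1 / x)) * (1 / (x * x)) * inverse (x ^ n)
        + exp (- (1 / x)) * (- (inverse (x ^ n) * (real n * x ^ (n - 1)) * inverse (x ^ n)))) (at x)"
      using greater by (auto intro!: derivative_eq_intros)
    moreover have "exp (- (1 / x)) * (1 / (x * x)) * inverse (x ^ n)
        + exp (- (1 / x)) * (- (inverse (x ^ n) * (real n * x ^ (n - 1)) * inverse (x ^ n)))
       = exp (- (1 / x)) / x ^ (n + 2) - real n * (exp (- (1 / x)) / x ^ (n + 1))"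
      using greater by (cases n) (auto simp: field_simps)
    ultimately have "((\<lambda>y. exp (- (1 / y)) * inverse (y ^ n)) has_real_derivative
        exp (- (1 / x)) / x ^ (n + 2) - real n * (exp (- (1 / x)) / x ^ (n + 1))) (at x)"
      by (simp only:)
    then show ?thesis by (simp only: divide_inverse)
  qed
  then have "(flat n has_real_derivative
      exp (- (1 / x)) / x ^ (n + 2) - real n * (exp (- (1 / x)) / x ^ (n + 1))) (at x)"
    by (rule has_field_derivative_transform_within_open[where S = "{0<..}"])
      (use greater in \<open>auto simp: flat_def\<close>)
  then show ?thesis using greater by (simp add: flat_def)
qed

text \<open>A class for the coinduction principle. Since arbitrary smooth functions enter through
  \<open>base\<close>, a single argument yields all closure properties of smoothness at
  once.\<close>

inductive_set smooth_algebra :: "(real \<Rightarrow> real) set" where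
  base: "smooth f \<Longrightarrow> f \<in> smooth_algebra"
| const: "(\<lambda>x. c) \<in> smooth_algebra"
| flat: "flat n \<in> smooth_algebra"
| sin: "sin \<in> smooth_algebra"
| cos: "cos \<in> smooth_algebra"
| add: "f \<in> smooth_algebra \<Longrightarrow> g \<in> smooth_algebra \<Longrightarrow> (\<lambda>x. f x + g x) \<in> smooth_algebra"
| mult: "f \<in> smooth_algebra \<Longrightarrow> g \<in> smooth_algebra \<Longrightarrow> (\<lambda>x. f x * g x) \<in> smooth_algebra"
| affine: "f \<in> smooth_algebra \<Longrightarrow> (\<lambda>x. f (a * x + b)) \<in> smooth_algebra"

lemma smooth_algebra_smooth:
  assumes "f \<in> smooth_algebra"
  shows "smooth f"
proof (rule smooth_coinduct[OF assms])
  fix g assume "g \<in> smooth_algebra"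
  then show "\<exists>h\<in>smooth_algebra. \<forall>x. (g has_real_derivative h x) (at x)"
  proof induction
    case (base f)
    then show ?case
      by (intro bexI[of _ "deriv f"] smooth_algebra.base smooth_deriv allI smooth_has_derivative)
  next
    case (const c)
    show ?case by (rule bexI[OF _ smooth_algebra.const[of 0]]) auto
  next
    case (flat n)
    have "(\<lambda>x. flat (n + 2) x + (- real n) * flat (n + 1) x) \<in> smooth_algebra"
      by (intro smooth_algebra.add smooth_algebra.mult smooth_algebra.flat smooth_algebra.const)
    moreover have "\<forall>x. (flat n has_real_derivative flat (n + 2) x + (- real n) * flat (n + 1) x) (at x)"
      using flat_has_derivative[of n] by simp
    ultimately show ?case
      by (intro bexI[of _ "\<lambda>x. flat (n + 2) x + (- real n) * flat (n + 1) x"])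
  next
    case sin
    show ?case by (intro bexI[OF _ smooth_algebra.cos]) (auto intro!: derivative_eq_intros)
  next
    case cos
    have "(\<lambda>x. (-1) * sin x) \<in> smooth_algebra"
      by (intro smooth_algebra.mult smooth_algebra.const smooth_algebra.sin)
    then show ?case by (rule bexI[rotated]) (auto intro!: derivative_eq_intros)
  next
    case (add f g)
    from add.IH obtain f' g' where d: "f' \<in> smooth_algebra" "\<forall>x. (f has_real_derivative f' x) (at x)"
        "g' \<in> smooth_algebra" "\<forall>x. (g has_real_derivative g' x) (at x)" by blast
    have "\<forall>x. ((\<lambda>x. f x + g x) has_real_derivative f' x + g' x) (at x)"
      using d by (intro allI DERIV_add) auto
    then show ?case by (rule bexI[OF _ smooth_algebra.add[OF d(1,3)]])
  next
    case (mult f g)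
    from mult.IH obtain f' g' where d: "f' \<in> smooth_algebra" "\<forall>x. (f has_real_derivative f' x) (at x)"
        "g' \<in> smooth_algebra" "\<forall>x. (g has_real_derivative g' x) (at x)" by blast
    have "\<forall>x. ((\<lambda>x. f x * g x) has_real_derivative f' x * g x + g' x * f x) (at x)"
      using d by (intro allI DERIV_mult) auto
    moreover have "(\<lambda>x. f' x * g x + g' x * f x) \<in> smooth_algebra"
      using d(1,3) mult.hyps by (intro smooth_algebra.add smooth_algebra.mult)
    ultimately show ?case
      by (intro bexI[of _ "\<lambda>x. f' x * g x + g' x * f x"])
  next
    case (affine f a b)
    from affine.IH obtain f' where f': "f' \<in> smooth_algebra" "\<forall>x. (f has_real_derivative f' x) (at x)" by blast
    have "((\<lambda>x. f (a * x + b)) has_real_derivative f' (a * x + b) * a) (at x)" for x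
    proof (rule DERIV_chain2[of f])
      show "(f has_real_derivative f' (a * x + b)) (at (a * x + b))" using f'(2) by blast
      show "((\<lambda>x. a * x + b) has_real_derivative a) (at x)" by (auto intro!: derivative_eq_intros)
    qed
    moreover have "(\<lambda>x. f' (a * x + b) * a) \<in> smooth_algebra"
      by (rule smooth_algebra.mult[OF smooth_algebra.affine[OF f'(1)] smooth_algebra.const])
    ultimately show ?case
      by (intro bexI[of _ "\<lambda>x. f' (a * x + b) * a"] allI)
  qed
qed

section \<open>Closure properties of smooth functions\<close>

lemma smooth_const: "smooth (\<lambda>x. c)"
  by (rule smooth_algebra_smooth[OF smooth_algebra.const])

lemma smooth_add: "smooth f \<Longrightarrow> smooth g \<Longrightarrow> smooth (\<lambda>x. f x + g x)"
  by (rule smooth_algebra_smooth[OF smooth_algebra.add[OF smooth_algebra.base smooth_algebra.base]])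

lemma smooth_mult: "smooth f \<Longrightarrow> smooth g \<Longrightarrow> smooth (\<lambda>x. f x * g x)"
  by (rule smooth_algebra_smooth[OF smooth_algebra.mult[OF smooth_algebra.base smooth_algebra.base]])

lemma smooth_affine: "smooth f \<Longrightarrow> smooth (\<lambda>x. f (a * x + b))"
  by (rule smooth_algebra_smooth[OF smooth_algebra.affine[OF smooth_algebra.base]])

lemma smooth_sin: "smooth sin" and smooth_cos: "smooth cos" and smooth_flat: "smooth (flat n)"
  by (rule smooth_algebra_smooth[OF smooth_algebra.sin] smooth_algebra_smooth[OF smooth_algebra.cos]
      smooth_algebra_smooth[OF smooth_algebra.flat])+

lemma smooth_continuous_on: "smooth f \<Longrightarrow> continuous_on A f"
  by (meson DERIV_isCont continuous_at_imp_continuous_on smooth_has_derivative)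

lemma smooth_borel_measurable: "smooth f \<Longrightarrow> f \<in> borel_measurable borel"
  by (intro borel_measurable_continuous_onI smooth_continuous_on)

section \<open>Bumps, smooth steps and mollification\<close>

lemma integrable_compact_support:
  fixes f :: "real \<Rightarrow> 'b::{banach, second_countable_topology}"
  assumes "continuous_on UNIV f" and z: "\<And>x. x \<notin> {a..b} \<Longrightarrow> f x = 0"
  shows "integrable lborel f"
proof -
  have "integrable lborel (\<lambda>x. indicator {a..b} x *\<^sub>R f x)"
    by (intro borel_integrable_compact) (auto intro: continuous_on_subset assms)
  moreover have "(\<lambda>x. indicator {a..b} x *\<^sub>R f x) = f"
    using z by (auto simp: fun_eq_iff indicator_def)
  ultimately show ?thesis by simp
qed

lemma obtain_bump:
  obtains \<psi> where "smooth \<psi>" "\<And>x. \<psi> x \<ge> 0" "\<And>x. x \<notin> {0<..<1} \<Longrightarrow> \<psi> x = 0" "(LINT x|lborel. \<psi> x) = 1"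
proof -
  \<comment> \<open>Each factor is flat at one end point, so the product is smooth and positive
    exactly on the open unit interval.\<close>
  define b where "b = (\<lambda>x. flat 0 x * flat 0 ((-1) * x + 1))"
  have b: "smooth b" unfolding b_def by (intro smooth_mult smooth_affine smooth_flat)
  have b0: "b x \<ge> 0" for x by (simp add: b_def flat_def)
  have bz: "b x = 0" if "x \<notin> {0<..<1}" for x using that by (auto simp: b_def flat_def)
  have bp: "b x > 0" if "x \<in> {0<..<1}" for x using that by (auto simp: b_def flat_def)
  have int: "integrable lborel b"
    by (rule integrable_compact_support[of _ 0 1]) (use b bz in \<open>auto intro: smooth_continuous_on\<close>)
  have pos: "(LINT x|lborel. b x) > 0"
  proof (rule ccontr)
    assume "\<not> ?thesis"
    moreover have "(LINT x|lborel. b x) \<ge> 0" using b0 by simp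
    ultimately have "(LINT x|lborel. b x) = 0" by simp
    then have "AE x in lborel. b x = 0" using integral_nonneg_eq_0_iff_AE[OF int] b0 by simp
    then have "AE x in lborel. x \<notin> {0<..<1::real}" by eventually_elim (use bp in force)
    then have "{0<..<1::real} \<in> null_sets lborel" by (subst (asm) AE_iff_null_sets[symmetric]) auto
    then show False by (auto simp: null_sets_def)
  qed
  show ?thesis
  proof (rule that[of "\<lambda>x. inverse (LINT x|lborel. b x) * b x"])
    show "smooth (\<lambda>x. inverse (LINT x|lborel. b x) * b x)" by (intro smooth_mult smooth_const b)
    show "(LINT x|lborel. inverse (LINT x|lborel. b x) * b x) = 1" using pos by simp
  qed (use b0 bz pos in auto)
qed

lemma obtain_smooth_step:
  obtains \<sigma> where "smooth \<sigma>" "\<And>x. x \<le> 0 \<Longrightarrow> \<sigma> x = 0" "\<And>x. x \<ge> 1 \<Longrightarrow> \<sigma> x = 1"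
    "\<And>x. 0 \<le> \<sigma> x" "\<And>x. \<sigma> x \<le> 1"
    "\<And>x. x \<notin> {0<..<1} \<Longrightarrow> deriv \<sigma> x = 0" "(LINT x|lborel. deriv \<sigma> x) = 1"
proof -
  obtain \<psi> where \<psi>: "smooth \<psi>" "\<And>x. \<psi> x \<ge> 0" "\<And>x. x \<notin> {0<..<1} \<Longrightarrow> \<psi> x = 0" "(LINT x|lborel. \<psi> x) = 1"
    by (rule obtain_bump) blast
  \<comment> \<open>The lower limit -1 makes 0 an interior point for the fundamental theorem;
    nothing is added, as the bump vanishes left of 0.\<close>
  define \<sigma> where "\<sigma> = (\<lambda>x. integral {- 1..x} \<psi>)"
  have cont: "continuous_on A \<psi>" for A using smooth_continuous_on[OF \<psi>(1)] .
  have z: "\<sigma> x = 0" if "x \<le> 0" for x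
  proof -
    have "\<sigma> x = integral {- 1..x} (\<lambda>_. 0)" unfolding \<sigma>_def
      by (rule integral_cong) (use that \<psi>(3) in auto)
    then show ?thesis by simp
  qed
  have D: "(\<sigma> has_real_derivative \<psi> x) (at x)" for x
  proof (cases "x > -1")
    case True
    have "(\<sigma> has_real_derivative \<psi> x) (at x within {-1..x + 1})"
      unfolding \<sigma>_def by (rule integral_has_real_derivative[OF cont]) (use True in auto)
    moreover have "at x within {-1..x + 1} = at x" using True by (intro at_within_interior) auto
    ultimately show ?thesis by simp
  next
    case False
    have "(\<sigma> has_real_derivative 0) (at x)"
      by (rule has_field_derivative_transform_within_open[where f = "\<lambda>x. 0" and S = "{..<0}"])
        (use False z in auto)
    then show ?thesis using \<psi>(3)[of x] False by simp
  qed
  have d\<sigma>: "deriv \<sigma> = \<psi>" using D by (auto simp: fun_eq_iff intro: DERIV_imp_deriv)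
  have int: "integrable lborel \<psi>"
    by (rule integrable_compact_support[of _ 0 1]) (use cont \<psi> in auto)
  have one: "\<sigma> x = 1" if "x \<ge> 1" for x
  proof -
    have "set_integrable lborel {-1..x} \<psi>"
      unfolding set_integrable_def by (intro borel_integrable_compact cont) auto
    then have "\<sigma> x = (LINT y:{-1..x}|lborel. \<psi> y)"
      unfolding \<sigma>_def by (simp add: set_borel_integral_eq_integral)
    also have "\<dots> = (LINT y|lborel. \<psi> y)" unfolding set_lebesgue_integral_def
    proof (rule Bochner_Integration.integral_cong)
      show "indicator {-1..x} y *\<^sub>R \<psi> y = \<psi> y" for y
        using \<psi>(3)[of y] that by (cases "y \<in> {0<..<1}") auto
    qed simp
    finally show ?thesis using \<psi>(4) by simp
  qed
  have mono: "\<sigma> x \<le> \<sigma> y" if "x \<le> y" for x y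
    by (rule DERIV_nonneg_imp_nondecreasing[OF that]) (use D \<psi>(2) in blast)
  show ?thesis
  proof (rule that[of \<sigma>])
    show "smooth \<sigma>" by (rule smooth_antiderivative[OF D \<psi>(1)])
    show "0 \<le> \<sigma> x" for x using mono[of "min x 0" x] z[of "min x 0"] by simp
    show "\<sigma> x \<le> 1" for x using mono[of x "max x 1"] one[of "max x 1"] by simp
  qed (use z one \<psi> in \<open>auto simp: d\<sigma>\<close>)
qed

text \<open>The substitution z = x + s / (n + 1) moves the scaling from the kernel to B, whose
  argument then tends to x inside a compact interval; dominated convergence finishes.\<close>

lemma mollification_tendsto:
  fixes B g :: "real \<Rightarrow> real"
  assumes B: "continuous_on UNIV B" and g: "continuous_on UNIV g" "\<And>x. x \<notin> {0<..<1} \<Longrightarrow> g x = 0"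
  shows "(\<lambda>n. LINT z|lborel. B z * (real (Suc n) * g (real (Suc n) * z - real (Suc n) * x)))
    \<longlonglongrightarrow> B x * (LINT z|lborel. g z)"
proof -
  have eq: "(LINT z|lborel. B z * (real (Suc n) * g (real (Suc n) * z - real (Suc n) * x)))
      = (LINT s|lborel. B (x + inverse (real (Suc n)) * s) * g s)" for n
  proof -
    have "(LINT z|lborel. B z * (real (Suc n) * g (real (Suc n) * z - real (Suc n) * x))) =
      inverse (real (Suc n)) * (LINT s|lborel. B (x + inverse (real (Suc n)) * s) * (real (Suc n) * g (real (Suc n) * (x + inverse (real (Suc n)) * s) - real (Suc n) * x)))"
      by (subst lborel_integral_real_affine[where t = x and c = "inverse (real (Suc n))"]) auto
    also have "\<dots> = (LINT s|lborel. inverse (real (Suc n)) * (B (x + inverse (real (Suc n)) * s) * (real (Suc n) * g (real (Suc n) * (x + inverse (real (Suc n)) * s) - real (Suc n) * x))))"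
      by simp
    also have "\<dots> = (LINT s|lborel. B (x + inverse (real (Suc n)) * s) * g s)"
    proof (rule Bochner_Integration.integral_cong)
      fix s
      have "real (Suc n) * (x + inverse (real (Suc n)) * s) - real (Suc n) * x = s"
        by (simp add: distrib_left del: of_nat_Suc)
      then show "inverse (real (Suc n)) * (B (x + inverse (real (Suc n)) * s) * (real (Suc n) * g (real (Suc n) * (x + inverse (real (Suc n)) * s) - real (Suc n) * x)))
          = B (x + inverse (real (Suc n)) * s) * g s"
        by (simp del: of_nat_Suc)
    qed simp
    finally show ?thesis .
  qed
  have [measurable]: "B \<in> borel_measurable borel" "g \<in> borel_measurable borel"
    using B g by (auto intro: borel_measurable_continuous_onI)
  have "bounded (B ` {x..x + 1})"
    by (intro compact_imp_bounded compact_continuous_image) (auto intro: continuous_on_subset[OF B])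
  then obtain C where "\<forall>b \<in> B ` {x..x + 1}. norm b \<le> C" unfolding bounded_iff by blast
  then have C: "\<bar>B y\<bar> \<le> C" if "y \<in> {x..x + 1}" for y using that by simp
  have gint: "integrable lborel g"
    by (rule integrable_compact_support[of _ 0 1]) (use g in auto)
  have "(\<lambda>n. LINT s|lborel. B (x + inverse (real (Suc n)) * s) * g s) \<longlonglongrightarrow> (LINT s|lborel. B x * g s)"
  proof (rule integral_dominated_convergence[where w = "\<lambda>s. C * norm (g s)"])
    show "integrable lborel (\<lambda>s. C * norm (g s))" using gint by auto
    show "AE s in lborel. (\<lambda>n. B (x + inverse (real (Suc n)) * s) * g s) \<longlonglongrightarrow> B x * g s"
    proof (intro AE_I2 tendsto_mult tendsto_const)
      fix s
      have "(\<lambda>n. x + inverse (real (Suc n)) * s) \<longlonglongrightarrow> x + 0 * s"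
        by (intro tendsto_intros LIMSEQ_inverse_real_of_nat)
      then have *: "(\<lambda>n. x + inverse (real (Suc n)) * s) \<longlonglongrightarrow> x" by simp
      have "isCont B x" using B by (simp add: continuous_on_eq_continuous_at)
      from isCont_tendsto_compose[OF this *]
      show "(\<lambda>n. B (x + inverse (real (Suc n)) * s)) \<longlonglongrightarrow> B x" .
    qed
    fix n
    show "AE s in lborel. norm (B (x + inverse (real (Suc n)) * s) * g s) \<le> C * norm (g s)"
    proof (rule AE_I2)
      fix s
      show "norm (B (x + inverse (real (Suc n)) * s) * g s) \<le> C * norm (g s)"
      proof (cases "s \<in> {0<..<1}")
        case True
        have "inverse (real (Suc n)) * s \<le> 1 * 1" using True by (intro mult_mono) (auto simp: field_simps)
        moreover have "inverse (real (Suc n)) * s \<ge> 0" using True by simp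
        ultimately have "\<bar>B (x + inverse (real (Suc n)) * s)\<bar> \<le> C" by (intro C) auto
        then show ?thesis by (auto simp: abs_mult intro!: mult_right_mono)
      qed (use g in auto)
    qed
  qed measurable
  then show ?thesis unfolding eq by simp
qed

text \<open>The lemma of du Bois-Reymond for continuous functions. Testing with smoothed indicators
  of intervals gives B x - B y as the integral of A from x to y, and the fundamental theorem of
  calculus applies.\<close>

lemma weak_derivative_is_derivative:
  fixes A B :: "real \<Rightarrow> real"
  assumes A: "continuous_on UNIV A" and B: "continuous_on UNIV B"
    and weak: "\<And>\<phi>. test_fn \<phi> \<Longrightarrow> (LINT x|lborel. A x * \<phi> x) = (LINT x|lborel. B x * deriv \<phi> x)"
  shows "(B has_real_derivative - A x) (at x)"
proof -
  obtain \<sigma> where \<sigma>: "smooth \<sigma>" "\<And>x. x \<le> 0 \<Longrightarrow> \<sigma> x = 0" "\<And>x. x \<ge> 1 \<Longrightarrow> \<sigma> x = 1"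
    "\<And>x. 0 \<le> \<sigma> x" "\<And>x. \<sigma> x \<le> 1"
    "\<And>x. x \<notin> {0<..<1} \<Longrightarrow> deriv \<sigma> x = 0" "(LINT x|lborel. deriv \<sigma> x) = 1"
    by (rule obtain_smooth_step) blast
  note \<sigma>'cont = smooth_continuous_on[OF smooth_deriv[OF \<sigma>(1)]]
  have [measurable]: "A \<in> borel_measurable borel" "\<sigma> \<in> borel_measurable borel"
    using A \<sigma>(1) by (auto intro: borel_measurable_continuous_onI smooth_borel_measurable)
  have key: "integral {x..y} A = B x - B y" if xy: "x \<le> y" for x y
  proof -
    define N where "N = (\<lambda>n. real (Suc n))"
    \<comment> \<open>A step up at x minus a step up at y, each of width 1 / N: an approximate
      indicator whose derivative is a difference of two mollifiers.\<close>
    define \<phi> where "\<phi> = (\<lambda>n z. \<sigma> (N n * z + (- N n * x)) + (-1) * \<sigma> (N n * z + (- N n * y)))"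
    have N: "N n \<ge> 1" for n by (simp add: N_def)
    have sm: "smooth (\<phi> n)" for n
      unfolding \<phi>_def by (intro smooth_add smooth_mult smooth_const smooth_affine \<sigma>(1))
    have outside: "\<phi> n z = 0" if "z \<notin> {x..y + 1}" for n z
    proof (cases "z < x")
      case True
      then have "N n * z + (- N n * x) \<le> 0" "N n * z + (- N n * y) \<le> 0"
        using N[of n] xy by (auto intro!: mult_left_mono)
      then show ?thesis by (simp add: \<phi>_def \<sigma>)
    next
      case False
      then have "z - x \<ge> 1" "z - y \<ge> 1" using that xy by auto
      then have "1 * 1 \<le> N n * (z - x)" "1 * 1 \<le> N n * (z - y)" using N[of n] by (intro mult_mono; simp)+
      then show ?thesis by (simp add: \<phi>_def \<sigma> algebra_simps)
    qed
    have test: "test_fn (\<phi> n)" for n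
      unfolding test_fn_iff_smooth
    proof (intro conjI exI[of _ "\<bar>x\<bar> + \<bar>y\<bar> + 1"] allI impI sm)
      show "\<phi> n z = 0" if "\<bar>x\<bar> + \<bar>y\<bar> + 1 < \<bar>z\<bar>" for z
        by (rule outside) (use that in auto)
    qed
    have d\<phi>: "deriv (\<phi> n) z = N n * deriv \<sigma> (N n * z - N n * x) - N n * deriv \<sigma> (N n * z - N n * y)" for n z
    proof (rule DERIV_imp_deriv)
      have s: "((\<lambda>z. \<sigma> (N n * z + - N n * c)) has_real_derivative deriv \<sigma> (N n * z + - N n * c) * N n) (at z)" for c
        by (rule DERIV_chain2[OF smooth_has_derivative[OF \<sigma>(1)]]) (auto intro!: derivative_eq_intros)
      show "(\<phi> n has_real_derivative N n * deriv \<sigma> (N n * z - N n * x) - N n * deriv \<sigma> (N n * z - N n * y)) (at z)"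
        unfolding \<phi>_def by (rule derivative_eq_intros s refl)+ (simp add: algebra_simps)
    qed
    have int: "integrable lborel (\<lambda>z. B z * (N n * deriv \<sigma> (N n * z - N n * c)))" for n c
    proof (rule integrable_compact_support[of _ c "c + 1"])
      show "continuous_on UNIV (\<lambda>z. B z * (N n * deriv \<sigma> (N n * z - N n * c)))"
        by (intro continuous_intros B continuous_on_compose2[OF \<sigma>'cont]) auto
      show "B z * (N n * deriv \<sigma> (N n * z - N n * c)) = 0" if "z \<notin> {c..c + 1}" for z
      proof (cases "z < c")
        case True
        then have "N n * z - N n * c \<le> 0" using N[of n] by simp
        then show ?thesis by (simp add: \<sigma>(6))
      next
        case False
        then have "1 * 1 \<le> N n * (z - c)" using N[of n] that by (intro mult_mono) auto
        then show ?thesis by (simp add: \<sigma>(6) algebra_simps)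
      qed
    qed
    have "(\<lambda>n. LINT z|lborel. B z * deriv (\<phi> n) z) \<longlonglongrightarrow> B x * 1 - B y * 1"
    proof -
      have "(LINT z|lborel. B z * deriv (\<phi> n) z) = (LINT z|lborel. B z * (N n * deriv \<sigma> (N n * z - N n * x)))
          - (LINT z|lborel. B z * (N n * deriv \<sigma> (N n * z - N n * y)))" for n
        unfolding d\<phi> right_diff_distrib by (intro Bochner_Integration.integral_diff int)
      then show ?thesis
        unfolding N_def using mollification_tendsto[OF B \<sigma>'cont \<sigma>(6)] by (auto intro!: tendsto_diff simp: \<sigma>(7))
    qed
    \<comment> \<open>The steps act to the right of their base points, so the pointwise limit is the
      indicator of the interval open at x and closed at y; the end points are a null set.\<close>
    moreover have "(\<lambda>n. LINT z|lborel. A z * \<phi> n z) \<longlonglongrightarrow> (LINT z|lborel. A z * indicator {x<..y} z)"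
    proof (rule integral_dominated_convergence[where w = "\<lambda>z. indicator {x..y + 1} z *\<^sub>R \<bar>A z\<bar>"])
      show "integrable lborel (\<lambda>z. indicator {x..y + 1} z *\<^sub>R \<bar>A z\<bar>)"
        by (intro borel_integrable_compact) (auto intro!: continuous_intros continuous_on_subset[OF A])
      show "(\<lambda>z. A z * \<phi> n z) \<in> borel_measurable lborel" for n unfolding \<phi>_def by measurable
      show "AE z in lborel. norm (A z * \<phi> n z) \<le> indicator {x..y + 1} z *\<^sub>R \<bar>A z\<bar>" for n
      proof (rule AE_I2)
        fix z
        have "\<bar>\<phi> n z\<bar> \<le> 1"
          using \<sigma>(4,5)[of "N n * z + - N n * x"] \<sigma>(4,5)[of "N n * z + - N n * y"] by (simp add: \<phi>_def abs_le_iff)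
        then have "\<bar>A z\<bar> * \<bar>\<phi> n z\<bar> \<le> \<bar>A z\<bar>" by (intro mult_left_le) auto
        then show "norm (A z * \<phi> n z) \<le> indicator {x..y + 1} z *\<^sub>R \<bar>A z\<bar>"
          using outside[of z n] by (auto simp: indicator_def abs_mult)
      qed
      have lim: "(\<lambda>n. \<sigma> (N n * z + (- N n * c))) \<longlonglongrightarrow> (if c < z then 1 else 0)" for z c
      proof (cases "c < z")
        case True
        obtain m where m: "1 / (z - c) < real m" using reals_Archimedean2 by blast
        have "\<sigma> (N n * z + (- N n * c)) = 1" if "n \<ge> m" for n
        proof (rule \<sigma>(3))
          have "1 = 1 / (z - c) * (z - c)" using True by simp
          also have "\<dots> \<le> N n * (z - c)" using True m that by (intro mult_right_mono) (auto simp: N_def)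
          finally show "1 \<le> N n * z + - N n * c" by (simp add: algebra_simps)
        qed
        then have "eventually (\<lambda>n. \<sigma> (N n * z + (- N n * c)) = 1) sequentially"
          unfolding eventually_sequentially by blast
        then show ?thesis using True by (simp add: tendsto_eventually)
      next
        case False
        then have "N n * z + (- N n * c) \<le> 0" for n using N[of n] by (auto intro!: mult_left_mono)
        then show ?thesis using False by (simp add: \<sigma>(2))
      qed
      show "AE z in lborel. (\<lambda>n. A z * \<phi> n z) \<longlonglongrightarrow> A z * indicator {x<..y} z"
      proof (intro AE_I2 tendsto_mult tendsto_const)
        fix z
        have "(\<lambda>n. \<phi> n z) \<longlonglongrightarrow> (if x < z then 1 else 0) + (-1) * (if y < z then 1 else 0)"
          unfolding \<phi>_def by (intro tendsto_intros lim)
        moreover have "(if x < z then 1 else 0) + (-1) * (if y < z then 1 else 0) = (indicator {x<..y} z :: real)"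
          using xy by (auto simp: indicator_def)
        ultimately show "(\<lambda>n. \<phi> n z) \<longlonglongrightarrow> indicator {x<..y} z" by simp
      qed
    qed measurable
    moreover have "(LINT z|lborel. A z * \<phi> n z) = (LINT z|lborel. B z * deriv (\<phi> n) z)" for n
      by (rule weak[OF test])
    ultimately have "(LINT z|lborel. A z * indicator {x<..y} z) = B x - B y"
      using LIMSEQ_unique by force
    moreover have "(LINT z|lborel. A z * indicator {x<..y} z) = (LINT z:{x..y}|lborel. A z)"
      unfolding set_lebesgue_integral_def
    proof (rule integral_cong_AE)
      show "AE z in lborel. A z * indicator {x<..y} z = indicator {x..y} z *\<^sub>R A z"
        using AE_lborel_singleton[of x] by eventually_elim (auto simp: indicator_def)
    qed measurable
    moreover have "set_integrable lborel {x..y} A"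
      unfolding set_integrable_def by (intro borel_integrable_compact) (auto intro: continuous_on_subset[OF A])
    ultimately show ?thesis by (simp add: set_borel_integral_eq_integral)
  qed
  \<comment> \<open>Integrating from x - 1 makes x an interior point, so the derivative within the
    interval is a two-sided one.\<close>
  have "((\<lambda>y. B (x - 1) - integral {x - 1..y} A) has_real_derivative 0 - A x) (at x within {x - 1..x + 1})"
    by (intro DERIV_diff DERIV_const integral_has_real_derivative continuous_on_subset[OF A]) auto
  then have "(B has_real_derivative 0 - A x) (at x within {x - 1..x + 1})"
    by (rule has_field_derivative_transform_within[where d = 1]) (use key in \<open>auto simp: dist_real_def\<close>)
  moreover have "at x within {x - 1..x + 1} = at x" by (intro at_within_interior) auto
  ultimately show ?thesis by simp
qed

section \<open>Fourier inversion and uniqueness\<close>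

lemma test_fn_smooth: "test_fn \<phi> \<Longrightarrow> smooth \<phi>"
  by (simp add: test_fn_iff_smooth)

lemma test_fn_times_smooth:
  assumes "smooth f" "test_fn \<phi>"
  shows "test_fn (\<lambda>x. f x * \<phi> x)"
  using assms unfolding test_fn_iff_smooth by (auto intro: smooth_mult)

lemma test_fn_affine:
  assumes \<phi>: "test_fn \<phi>" and a: "a \<noteq> 0"
  shows "test_fn (\<lambda>x. \<phi> (a * x + b))"
proof -
  obtain R where R: "\<And>x. R < \<bar>x\<bar> \<Longrightarrow> \<phi> x = 0" using \<phi> by (auto simp: test_fn_iff_smooth)
  have "\<phi> (a * x + b) = 0" if x: "(R + \<bar>b\<bar>) / \<bar>a\<bar> < \<bar>x\<bar>" for x
  proof (rule R)
    have "R + \<bar>b\<bar> < \<bar>a * x\<bar>" using x a by (simp add: abs_mult field_simps)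
    then show "R < \<bar>a * x + b\<bar>" by linarith
  qed
  then show ?thesis using \<phi> unfolding test_fn_iff_smooth by (auto intro!: smooth_affine)
qed

lemma test_fn_deriv:
  assumes \<phi>: "test_fn \<phi>"
  shows "test_fn (deriv \<phi>)"
proof -
  obtain R where R: "\<And>x. R < \<bar>x\<bar> \<Longrightarrow> \<phi> x = 0" using \<phi> by (auto simp: test_fn_iff_smooth)
  have "deriv \<phi> x = 0" if x: "R < \<bar>x\<bar>" for x
  proof (rule DERIV_imp_deriv)
    have "open {y. R < \<bar>y\<bar>}" by (intro open_Collect_less continuous_intros)
    then show "(\<phi> has_real_derivative 0) (at x)"
      by (rule has_field_derivative_transform_within_open[where f = "\<lambda>x. 0", rotated]) (use x R in auto)
  qed
  then show ?thesis using \<phi> unfolding test_fn_iff_smooth by (auto intro: smooth_deriv)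
qed

lemma test_fn_support:
  assumes "test_fn \<phi>"
  obtains R where "R > 0" "\<And>x. x \<notin> {-R..R} \<Longrightarrow> \<phi> x = 0"
proof -
  obtain R where R: "\<And>x. R < \<bar>x\<bar> \<Longrightarrow> \<phi> x = 0" using assms by (auto simp: test_fn_iff_smooth)
  show ?thesis by (rule that[of "\<bar>R\<bar> + 1"]) (auto intro!: R)
qed

lemma test_fn_deriv_support:
  assumes "test_fn \<phi>"
  obtains R where "R > 0" "\<And>x. x \<notin> {-R..R} \<Longrightarrow> \<phi> x = 0" "\<And>x. x \<notin> {-R..R} \<Longrightarrow> deriv \<phi> x = 0"
proof -
  obtain R1 where R1: "R1 > 0" "\<And>x. x \<notin> {-R1..R1} \<Longrightarrow> \<phi> x = 0" using test_fn_support[OF assms] by blast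
  obtain R2 where R2: "\<And>x. x \<notin> {-R2..R2} \<Longrightarrow> deriv \<phi> x = 0"
    using test_fn_support[OF test_fn_deriv[OF assms]] by blast
  show ?thesis
  proof (rule that[of "max R1 R2"])
    fix x assume "x \<notin> {- max R1 R2..max R1 R2}"
    then have "x \<notin> {-R1..R1}" "x \<notin> {-R2..R2}" by auto
    then show "\<phi> x = 0" "deriv \<phi> x = 0" using R1(2) R2 by blast+
  qed (use R1(1) in simp)
qed

lemma test_fn_continuous_on: "test_fn \<phi> \<Longrightarrow> continuous_on A \<phi>"
  by (simp add: smooth_continuous_on test_fn_smooth)

lemma test_fn_measurable: "test_fn \<phi> \<Longrightarrow> \<phi> \<in> borel_measurable borel"
  by (simp add: smooth_borel_measurable test_fn_smooth)

lemma test_fn_integrable_mult: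
  fixes f :: "real \<Rightarrow> 'b::{banach, second_countable_topology, real_normed_algebra_1}"
  assumes "test_fn \<phi>" "continuous_on UNIV f"
  shows "integrable lborel (\<lambda>x. of_real (\<phi> x) * f x)"
proof -
  obtain R where "\<And>x. x \<notin> {-R..R} \<Longrightarrow> \<phi> x = 0" using test_fn_support[OF assms(1)] by blast
  then show ?thesis
    by (intro integrable_compact_support[of _ "-R" R])
      (use assms test_fn_continuous_on[OF assms(1)] in \<open>auto intro!: continuous_intros\<close>)
qed

lemma test_fn_integrable: "test_fn \<phi> \<Longrightarrow> integrable lborel \<phi>"
  using test_fn_integrable_mult[of \<phi> "\<lambda>x. 1 :: real"] by simp

section \<open>Fourier transforms of test functions\<close>

lemma fourier_cis: "fourier \<phi> \<xi> = (LINT x|lborel. complex_of_real (\<phi> x) * cis (- (2 * pi * \<xi> * x)))"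
  unfolding fourier_def by (simp add: cis_conv_exp mult_ac)

lemma integral_derivative_compact_support:
  fixes f :: "real \<Rightarrow> 'a::euclidean_space"
  assumes f: "\<And>x. (f has_vector_derivative f' x) (at x)" and f': "continuous_on UNIV f'"
    and z: "\<And>x. x \<notin> {-R..R} \<Longrightarrow> f x = 0" "\<And>x. x \<notin> {-R..R} \<Longrightarrow> f' x = 0" and R: "R > 0"
  shows "(LINT x|lborel. f' x) = 0"
proof -
  have "(LINT x|lborel. f' x) = (LINT x|lborel. indicator {-R - 1..R + 1} x *\<^sub>R f' x)"
    by (rule Bochner_Integration.integral_cong) (use z in \<open>auto simp: indicator_def\<close>)
  also have "\<dots> = f (R + 1) - f (-R - 1)"
    by (rule integral_FTC_Icc) (use R f in \<open>auto intro: has_vector_derivative_at_within continuous_on_subset[OF f']\<close>)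
  also have "\<dots> = 0" using z by simp
  finally show ?thesis .
qed

text \<open>Integration by parts: the total derivative of the test function times the character is
  compactly supported and integrates to 0.\<close>

lemma fourier_deriv:
  assumes \<phi>: "test_fn \<phi>"
  shows "fourier (deriv \<phi>) \<xi> = 2 * pi * \<xi> * \<i> * fourier \<phi> \<xi>"
proof -
  define c where "c = - (2 * pi * \<xi>)"
  obtain S where S: "S > 0" "\<And>x. x \<notin> {-S..S} \<Longrightarrow> \<phi> x = 0" "\<And>x. x \<notin> {-S..S} \<Longrightarrow> deriv \<phi> x = 0"
    using test_fn_deriv_support[OF \<phi>] by blast
  define E where "E = (\<lambda>x. cis (c * x))"
  have E: "(E has_vector_derivative \<i> * c * E x) (at x)" for x
    unfolding E_def has_vector_derivative_def
    by (rule derivative_eq_intros | simp)+ (simp add: fun_eq_iff scaleR_conv_of_real)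
  have contE: "continuous_on UNIV E" unfolding E_def by (intro continuous_intros)
  have \<phi>': "((\<lambda>x. complex_of_real (\<phi> x)) has_vector_derivative complex_of_real (deriv \<phi> x)) (at x)" for x
    using smooth_has_derivative[OF test_fn_smooth[OF \<phi>]]
    by (simp add: has_vector_derivative_of_real has_real_derivative_iff_has_vector_derivative)
  have D: "((\<lambda>x. complex_of_real (\<phi> x) * E x) has_vector_derivative
      complex_of_real (\<phi> x) * (\<i> * c * E x) + complex_of_real (deriv \<phi> x) * E x) (at x)" for x
    by (rule has_vector_derivative_mult[OF \<phi>' E])
  have "(LINT x|lborel. complex_of_real (\<phi> x) * (\<i> * c * E x) + complex_of_real (deriv \<phi> x) * E x) = 0"
    by (rule integral_derivative_compact_support[OF D _ _ _ S(1)])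
      (use S(2,3) contE test_fn_continuous_on[OF \<phi>] test_fn_continuous_on[OF test_fn_deriv[OF \<phi>]]
        in \<open>auto intro!: continuous_intros\<close>)
  also have "(LINT x|lborel. complex_of_real (\<phi> x) * (\<i> * c * E x) + complex_of_real (deriv \<phi> x) * E x)
    = (LINT x|lborel. complex_of_real (\<phi> x) * (\<i> * c * E x)) + (LINT x|lborel. complex_of_real (deriv \<phi> x) * E x)"
    by (intro Bochner_Integration.integral_add test_fn_integrable_mult \<phi> test_fn_deriv continuous_intros contE)
  also have "(LINT x|lborel. complex_of_real (\<phi> x) * (\<i> * c * E x)) = \<i> * c * (LINT x|lborel. complex_of_real (\<phi> x) * E x)"
    by (subst integral_mult_right_zero[symmetric]) (simp add: mult_ac)
  finally have "\<i> * c * (LINT x|lborel. complex_of_real (\<phi> x) * E x) + (LINT x|lborel. complex_of_real (deriv \<phi> x) * E x) = 0" .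
  moreover have "(LINT x|lborel. complex_of_real (f x) * E x) = fourier f \<xi>" for f
    by (simp add: fourier_cis E_def c_def)
  ultimately show ?thesis
    by (simp add: c_def add_eq_0_iff mult_ac)
qed

lemma norm_fourier_le: "test_fn \<phi> \<Longrightarrow> cmod (fourier \<phi> \<xi>) \<le> (LINT x|lborel. \<bar>\<phi> x\<bar>)"
  unfolding fourier_cis
  by (rule order_trans[OF integral_norm_bound]) (simp add: norm_mult)

text \<open>Two derivatives multiply the transform by a quadratic factor, while the transforms of
  the function and of its second derivative are bounded by L^1 norms. The majorant is integrable,
  which makes inversion integrals meaningful.\<close>

lemma fourier_decay:
  assumes \<phi>: "test_fn \<phi>"
  obtains C where "C > 0" "\<And>\<xi>. cmod (fourier \<phi> \<xi>) \<le> C * inverse (1 + \<xi>\<^sup>2)"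
proof -
  define A where "A = (LINT x|lborel. \<bar>\<phi> x\<bar>) + (LINT x|lborel. \<bar>deriv (deriv \<phi>) x\<bar>)"
  have A: "A \<ge> 0" unfolding A_def by (intro add_nonneg_nonneg) auto
  have "cmod (fourier \<phi> \<xi>) \<le> (A + 1) * inverse (1 + \<xi>\<^sup>2)" for \<xi>
  proof -
    have "fourier (deriv (deriv \<phi>)) \<xi> = 2 * pi * \<xi> * \<i> * (2 * pi * \<xi> * \<i> * fourier \<phi> \<xi>)"
      by (simp add: fourier_deriv \<phi> test_fn_deriv)
    also have "cmod \<dots> = (2 * pi)\<^sup>2 * \<xi>\<^sup>2 * cmod (fourier \<phi> \<xi>)"
      by (simp add: norm_mult power2_eq_square abs_mult)
    finally have "(2 * pi)\<^sup>2 * \<xi>\<^sup>2 * cmod (fourier \<phi> \<xi>) \<le> (LINT x|lborel. \<bar>deriv (deriv \<phi>) x\<bar>)"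
      using norm_fourier_le[OF test_fn_deriv[OF test_fn_deriv[OF \<phi>]], of \<xi>] by simp
    moreover have "1 * (\<xi>\<^sup>2 * cmod (fourier \<phi> \<xi>)) \<le> (2 * pi)\<^sup>2 * (\<xi>\<^sup>2 * cmod (fourier \<phi> \<xi>))"
    proof (rule mult_right_mono)
      have "1 \<le> 2 * pi" using pi_gt3 by simp
      then show "1 \<le> (2 * pi)\<^sup>2" by (rule one_le_power)
    qed simp
    ultimately have "(1 + \<xi>\<^sup>2) * cmod (fourier \<phi> \<xi>) \<le> A + 1"
      using norm_fourier_le[OF \<phi>, of \<xi>] by (simp add: A_def algebra_simps)
    moreover have "1 + \<xi>\<^sup>2 > 0" by (simp add: add_pos_nonneg)
    ultimately show ?thesis by (simp add: field_simps)
  qed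
  then show ?thesis using A by (intro that[of "A + 1"]) auto
qed

lemma lborel_integrable_inverse_1_plus_square: "integrable lborel (\<lambda>x::real. inverse (1 + x\<^sup>2))"
  using integrable_inverse_1_plus_square by (simp add: set_integrable_def einterval_def)

lemma measurable_cis_mult: "(\<lambda>x. cis (c * x)) \<in> borel_measurable lborel"
  by (auto intro!: borel_measurable_continuous_onI continuous_intros)

lemma integrable_mult_cis:
  fixes g :: "real \<Rightarrow> complex"
  assumes "integrable lborel g"
  shows "integrable lborel (\<lambda>x. g x * cis (c * x))"
  by (rule Bochner_Integration.integrable_bound[OF assms])
    (use assms measurable_cis_mult[of c] in \<open>auto simp: norm_mult intro!: borel_measurable_times\<close>)

lemma continuous_on_LINT_cis:
  assumes g: "integrable lborel (g :: real \<Rightarrow> complex)"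
  shows "continuous_on UNIV (\<lambda>y. LINT x|lborel. g x * cis (a * y * x))"
  unfolding continuous_on_sequentially comp_def
proof (intro allI ballI impI, elim conjE)
  fix X y assume X: "X \<longlonglongrightarrow> (y::real)"
  show "(\<lambda>n. LINT x|lborel. g x * cis (a * X n * x)) \<longlonglongrightarrow> (LINT x|lborel. g x * cis (a * y * x))"
  proof (rule integral_dominated_convergence[where w = "\<lambda>x. norm (g x)"])
    show "(\<lambda>x. g x * cis (a * y * x)) \<in> borel_measurable lborel"
      "\<And>n. (\<lambda>x. g x * cis (a * X n * x)) \<in> borel_measurable lborel"
      by (intro borel_measurable_integrable integrable_mult_cis g)+
    show "AE x in lborel. (\<lambda>n. g x * cis (a * X n * x)) \<longlonglongrightarrow> g x * cis (a * y * x)"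
      by (intro AE_I2 tendsto_intros X)
  qed (use g in \<open>auto simp: norm_mult\<close>)
qed

lemma fourier_continuous:
  assumes "test_fn \<phi>"
  shows "continuous_on UNIV (fourier \<phi>)"
proof -
  have "integrable lborel (\<lambda>x. complex_of_real (\<phi> x))" using test_fn_integrable[OF assms] by simp
  from continuous_on_LINT_cis[OF this, of "- (2 * pi)"] show ?thesis
    by (simp add: fourier_cis[abs_def])
qed

lemma fourier_integrable:
  assumes \<phi>: "test_fn \<phi>"
  shows "integrable lborel (fourier \<phi>)"
proof -
  obtain C where C: "C > 0" "\<And>\<xi>. cmod (fourier \<phi> \<xi>) \<le> C * inverse (1 + \<xi>\<^sup>2)" by (rule fourier_decay[OF \<phi>]) blast
  show ?thesis
  proof (rule Bochner_Integration.integrable_bound)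
    show "integrable lborel (\<lambda>\<xi>::real. C * inverse (1 + \<xi>\<^sup>2))"
      using lborel_integrable_inverse_1_plus_square by simp
    show "fourier \<phi> \<in> borel_measurable lborel"
      using fourier_continuous[OF \<phi>] by (simp add: borel_measurable_continuous_onI)
    show "AE x in lborel. norm (fourier \<phi> x) \<le> norm (C * inverse (1 + x\<^sup>2))"
      using C by (auto intro!: AE_I2 order_trans[OF C(2)])
  qed
qed

lemma fourier_square_integrable:
  assumes \<phi>: "test_fn \<phi>"
  shows "integrable lborel (\<lambda>\<xi>. (cmod (fourier \<phi> \<xi>))\<^sup>2)"
proof -
  obtain C where C: "C > 0" "\<And>\<xi>. cmod (fourier \<phi> \<xi>) \<le> C * inverse (1 + \<xi>\<^sup>2)" by (rule fourier_decay[OF \<phi>]) blast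
  show ?thesis
  proof (rule Bochner_Integration.integrable_bound)
    show "integrable lborel (\<lambda>\<xi>. C * cmod (fourier \<phi> \<xi>))"
      using fourier_integrable[OF \<phi>] by simp
    show "(\<lambda>\<xi>. (cmod (fourier \<phi> \<xi>))\<^sup>2) \<in> borel_measurable lborel"
      using borel_measurable_integrable[OF fourier_integrable[OF \<phi>]] by measurable
    have "cmod (fourier \<phi> x) \<le> C" for x
    proof -
      have "C * inverse (1 + x\<^sup>2) \<le> C * 1" using C by (intro mult_left_mono) (auto simp: inverse_le_1_iff)
      then show ?thesis using C(2)[of x] by simp
    qed
    then show "AE x in lborel. norm ((cmod (fourier \<phi> x))\<^sup>2) \<le> norm (C * cmod (fourier \<phi> x))"
      using C(1) by (auto intro!: AE_I2 mult_right_mono simp: power2_eq_square abs_mult)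
  qed
qed

text \<open>The multiplication formula: Fubini moves the transform from one integrable factor to the
  other, since the kernel has modulus 1 and is symmetric in x and y.\<close>

lemma integral_exchange_cis:
  fixes f g :: "real \<Rightarrow> complex"
  assumes f: "integrable lborel f" and g: "integrable lborel g"
  shows "(LINT x|lborel. f x * (LINT y|lborel. g y * cis (a * x * y))) =
    (LINT y|lborel. g y * (LINT x|lborel. f x * cis (a * y * x)))"
proof -
  have [measurable]: "f \<in> borel_measurable borel" "g \<in> borel_measurable borel" using f g by auto
  have cism: "(\<lambda>p. cis (a * fst p * snd p)) \<in> borel_measurable (lborel \<Otimes>\<^sub>M lborel)"
  proof -
    have "(\<lambda>p::real\<times>real. cis (a * fst p * snd p)) \<in> borel_measurable borel"
      by (intro borel_measurable_continuous_onI continuous_intros)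
    then show ?thesis by (simp add: lborel_prod)
  qed
  have "(\<lambda>p. f (fst p) * g (snd p) * cis (a * fst p * snd p)) \<in> borel_measurable (lborel \<Otimes>\<^sub>M lborel)"
    by (intro borel_measurable_times cism) measurable
  then have meas: "(\<lambda>(x, y). f x * g y * cis (a * x * y)) \<in> borel_measurable (lborel \<Otimes>\<^sub>M lborel)"
    by (simp add: case_prod_unfold)
  have int: "integrable (lborel \<Otimes>\<^sub>M lborel) (\<lambda>(x, y). f x * g y * cis (a * x * y))"
  proof (rule lborel_pair.Fubini_integrable[OF meas])
    show "integrable lborel (\<lambda>x. LINT y|lborel. norm (case (x, y) of (x, y) \<Rightarrow> f x * g y * cis (a * x * y)))"
      using f by (simp add: norm_mult)
    show "AE x in lborel. integrable lborel (\<lambda>y. case (x, y) of (x, y) \<Rightarrow> f x * g y * cis (a * x * y))"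
    proof (rule AE_I2)
      fix x
      show "integrable lborel (\<lambda>y. case (x, y) of (x, y) \<Rightarrow> f x * g y * cis (a * x * y))"
        using integrable_mult_right[OF integrable_mult_cis[OF g, of "a * x"], of "f x"] by (simp add: mult.assoc)
    qed
  qed
  have "(LINT x|lborel. f x * (LINT y|lborel. g y * cis (a * x * y))) = (LINT x|lborel. LINT y|lborel. f x * g y * cis (a * x * y))"
    by (simp add: mult.assoc)
  also have "\<dots> = (LINT y|lborel. LINT x|lborel. f x * g y * cis (a * x * y))"
    using lborel_pair.Fubini_integral[OF int] by simp
  also have "\<dots> = (LINT y|lborel. LINT x|lborel. g y * (f x * cis (a * y * x)))"
    by (simp add: mult_ac)
  finally show ?thesis by simp
qed

section \<open>Gaussian summation and pointwise inversion\<close>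

lemma fourier_std_normal:
  "(LINT x|lborel. complex_of_real (std_normal_density x) * cis (t * x)) = exp (- (t\<^sup>2 / 2))"
proof -
  have "exp (- (t\<^sup>2 / 2)) = char std_normal_distribution t"
    by (simp add: char_std_normal_distribution)
  also have "\<dots> = (LINT x|lborel. std_normal_density x *\<^sub>R iexp (t * x))"
    unfolding char_def by (subst integral_density) (auto intro!: normal_density_nonneg)
  finally show ?thesis by (simp add: cis_conv_exp scaleR_conv_of_real)
qed

text \<open>Wide Gaussian weights tend to 1, so the weighted integrals tend to the left-hand side.
  Moving the transform onto the weight turns it into a Gaussian concentrating at 0, so the same
  integrals tend to the value of the test function there.\<close>

lemma fourier_inversion_at_0:
  assumes \<phi>: "test_fn \<phi>"
  shows "(LINT \<xi>|lborel. fourier \<phi> \<xi>) = \<phi> 0"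
proof -
  define G where "G = (\<lambda>n \<xi>. complex_of_real (exp (- ((\<xi> / real (Suc n))\<^sup>2 / 2))))"
  have [measurable]: "\<phi> \<in> borel_measurable borel" "fourier \<phi> \<in> borel_measurable borel"
    using test_fn_measurable[OF \<phi>] borel_measurable_integrable[OF fourier_integrable[OF \<phi>]] by auto
  have dens: "sqrt (2 * pi) * std_normal_density x = exp (- (x\<^sup>2 / 2))" for x
    by (simp add: std_normal_density_def)
  have inner: "(LINT \<xi>|lborel. G n \<xi> * cis (c * \<xi>)) = sqrt (2 * pi) * real (Suc n) * exp (- ((real (Suc n) * c)\<^sup>2 / 2))" for n c
  proof -
    have "(LINT \<xi>|lborel. G n \<xi> * cis (c * \<xi>)) = \<bar>real (Suc n)\<bar> *\<^sub>R (LINT s|lborel. G n (0 + real (Suc n) * s) * cis (c * (0 + real (Suc n) * s)))"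
      by (rule lborel_integral_real_affine) simp
    also have "(LINT s|lborel. G n (0 + real (Suc n) * s) * cis (c * (0 + real (Suc n) * s)))
       = (LINT s|lborel. complex_of_real (sqrt (2 * pi)) * (complex_of_real (std_normal_density s) * cis (real (Suc n) * c * s)))"
    proof (rule Bochner_Integration.integral_cong)
      fix s
      have "G n (0 + real (Suc n) * s) = complex_of_real (sqrt (2 * pi) * std_normal_density s)"
        unfolding G_def dens by simp
      then show "G n (0 + real (Suc n) * s) * cis (c * (0 + real (Suc n) * s)) =
          complex_of_real (sqrt (2 * pi)) * (complex_of_real (std_normal_density s) * cis (real (Suc n) * c * s))"
        by (simp add: mult_ac del: of_nat_Suc)
    qed simp
    also have "\<dots> = complex_of_real (sqrt (2 * pi)) * exp (- ((real (Suc n) * c)\<^sup>2 / 2))"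
      by (subst integral_mult_right_zero) (simp add: fourier_std_normal)
    finally show ?thesis by (simp add: scaleR_conv_of_real mult_ac)
  qed
  \<comment> \<open>Integrability comes from the computed value: the Bochner integral of a
    non-integrable function is 0 by convention, but at frequency 0 it is positive.\<close>
  have G_int: "integrable lborel (G n)" for n
  proof (rule ccontr)
    assume "\<not> ?thesis"
    then have "(LINT \<xi>|lborel. G n \<xi>) = 0" by (rule not_integrable_integral_eq)
    moreover have "(LINT \<xi>|lborel. G n \<xi>) = sqrt (2 * pi) * real (Suc n)" using inner[of n 0] by simp
    ultimately show False by (simp del: of_nat_Suc)
  qed
  have eq: "(LINT \<xi>|lborel. G n \<xi> * fourier \<phi> \<xi>) = complex_of_real (LINT y|lborel. \<phi> (y / (2 * pi * real (Suc n))) * std_normal_density y)" for n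
  proof -
    define k where "k = 2 * pi * real (Suc n)"
    have k: "k > 0" by (simp add: k_def del: of_nat_Suc)
    have "(LINT \<xi>|lborel. G n \<xi> * fourier \<phi> \<xi>) = (LINT \<xi>|lborel. G n \<xi> * (LINT x|lborel. complex_of_real (\<phi> x) * cis ((- (2 * pi)) * \<xi> * x)))"
      by (simp add: fourier_cis)
    also have "\<dots> = (LINT x|lborel. complex_of_real (\<phi> x) * (LINT \<xi>|lborel. G n \<xi> * cis ((- (2 * pi)) * x * \<xi>)))"
      by (rule integral_exchange_cis[OF G_int]) (use test_fn_integrable[OF \<phi>] in simp)
    also have "\<dots> = (LINT x|lborel. complex_of_real (\<phi> x * (sqrt (2 * pi) * real (Suc n) * exp (- ((k * x)\<^sup>2 / 2)))))"
      unfolding inner by (simp add: k_def mult_ac power2_eq_square del: of_nat_Suc)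
    also have "\<dots> = complex_of_real (LINT x|lborel. \<phi> x * (sqrt (2 * pi) * real (Suc n) * exp (- ((k * x)\<^sup>2 / 2))))"
      by (rule integral_complex_of_real)
    \<comment> \<open>Rescaling by \<open>k\<close> produces the standard normal density; its
      normalisation absorbs all factors of 2 pi.\<close>
    also have "(LINT x|lborel. \<phi> x * (sqrt (2 * pi) * real (Suc n) * exp (- ((k * x)\<^sup>2 / 2))))
       = \<bar>inverse k\<bar> *\<^sub>R (LINT y|lborel. \<phi> (0 + inverse k * y) * (sqrt (2 * pi) * real (Suc n) * exp (- ((k * (0 + inverse k * y))\<^sup>2 / 2))))"
      by (rule lborel_integral_real_affine) (use k in simp)
    also have "\<dots> = (LINT y|lborel. inverse k * (\<phi> (0 + inverse k * y) * (sqrt (2 * pi) * real (Suc n) * exp (- ((k * (0 + inverse k * y))\<^sup>2 / 2)))))"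
      using k by simp
    also have "\<dots> = (LINT y|lborel. \<phi> (y / k) * std_normal_density y)"
    proof (rule Bochner_Integration.integral_cong)
      fix y
      have 1: "0 + inverse k * y = y / k" "k * (y / k) = y" using k by (auto simp: field_simps)
      have "inverse k * (sqrt (2 * pi) * real (Suc n)) * sqrt (2 * pi) = 1"
        unfolding k_def by (simp add: field_simps del: of_nat_Suc)
      then show "inverse k * (\<phi> (0 + inverse k * y) * (sqrt (2 * pi) * real (Suc n) * exp (- ((k * (0 + inverse k * y))\<^sup>2 / 2))))
          = \<phi> (y / k) * std_normal_density y"
        unfolding 1 dens[symmetric] by algebra
    qed simp
    finally show ?thesis by (simp add: k_def)
  qed
  have "(\<lambda>n. LINT \<xi>|lborel. G n \<xi> * fourier \<phi> \<xi>) \<longlonglongrightarrow> (LINT \<xi>|lborel. fourier \<phi> \<xi>)"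
  proof (rule integral_dominated_convergence[where w = "\<lambda>\<xi>. cmod (fourier \<phi> \<xi>)"])
    show "(\<lambda>\<xi>. G n \<xi> * fourier \<phi> \<xi>) \<in> borel_measurable lborel" for n
      unfolding G_def by measurable
    show "AE \<xi> in lborel. (\<lambda>n. G n \<xi> * fourier \<phi> \<xi>) \<longlonglongrightarrow> fourier \<phi> \<xi>"
    proof (rule AE_I2)
      fix \<xi>
      have "(\<lambda>n. \<xi> * inverse (real (Suc n))) \<longlonglongrightarrow> \<xi> * 0"
        by (intro tendsto_intros LIMSEQ_inverse_real_of_nat)
      then have *: "(\<lambda>n. \<xi> / real (Suc n)) \<longlonglongrightarrow> 0" by (simp add: divide_inverse)
      have "(\<lambda>n. complex_of_real (exp (- ((\<xi> / real (Suc n))\<^sup>2 / 2)))) \<longlonglongrightarrow> complex_of_real (exp (- (0\<^sup>2 / 2)))"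
        by (intro tendsto_intros *) simp
      then have "(\<lambda>n. G n \<xi> * fourier \<phi> \<xi>) \<longlonglongrightarrow> complex_of_real (exp (- (0\<^sup>2 / 2))) * fourier \<phi> \<xi>"
        unfolding G_def by (intro tendsto_mult tendsto_const)
      then show "(\<lambda>n. G n \<xi> * fourier \<phi> \<xi>) \<longlonglongrightarrow> fourier \<phi> \<xi>" by simp
    qed
    show "AE \<xi> in lborel. norm (G n \<xi> * fourier \<phi> \<xi>) \<le> cmod (fourier \<phi> \<xi>)" for n
    proof (rule AE_I2)
      fix \<xi>
      have "cmod (G n \<xi>) \<le> 1" unfolding G_def norm_of_real by simp
      then show "norm (G n \<xi> * fourier \<phi> \<xi>) \<le> cmod (fourier \<phi> \<xi>)"
        by (simp add: norm_mult mult_left_le_one_le)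
    qed
  qed (use fourier_integrable[OF \<phi>] in auto)
  moreover have "(\<lambda>n. complex_of_real (LINT y|lborel. \<phi> (y / (2 * pi * real (Suc n))) * std_normal_density y)) \<longlonglongrightarrow> complex_of_real (\<phi> 0)"
  proof -
    obtain R where R: "R > 0" "\<And>x. x \<notin> {-R..R} \<Longrightarrow> \<phi> x = 0" using test_fn_support[OF \<phi>] by blast
    have "bounded (\<phi> ` {-R..R})"
      by (intro compact_imp_bounded compact_continuous_image test_fn_continuous_on \<phi>) simp
    then obtain B where B: "\<forall>b\<in>\<phi> ` {-R..R}. norm b \<le> B" unfolding bounded_iff by blast
    have B': "\<bar>\<phi> x\<bar> \<le> \<bar>B\<bar>" for x
    proof (cases "x \<in> {-R..R}")
      case True
      then have "\<bar>\<phi> x\<bar> \<le> B" using B by simp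
      then show ?thesis by simp
    qed (simp add: R(2))
    have "(\<lambda>n. LINT y|lborel. \<phi> (y / (2 * pi * real (Suc n))) * std_normal_density y) \<longlonglongrightarrow> (LINT y|lborel. \<phi> 0 * std_normal_density y)"
    proof (rule integral_dominated_convergence[where w = "\<lambda>y. \<bar>B\<bar> * std_normal_density y"])
      show "AE y in lborel. (\<lambda>n. \<phi> (y / (2 * pi * real (Suc n))) * std_normal_density y) \<longlonglongrightarrow> \<phi> 0 * std_normal_density y"
      proof (intro AE_I2 tendsto_mult tendsto_const)
        fix y
        have "(\<lambda>n. y / (2 * pi) * inverse (real (Suc n))) \<longlonglongrightarrow> y / (2 * pi) * 0"
          by (intro tendsto_intros LIMSEQ_inverse_real_of_nat)
        moreover have "y / (2 * pi) * inverse (real (Suc n)) = y / (2 * pi * real (Suc n))" for n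
          by (simp only: divide_inverse inverse_mult_distrib mult.assoc)
        ultimately have "(\<lambda>n. y / (2 * pi * real (Suc n))) \<longlonglongrightarrow> 0" by (simp only: mult_zero_right)
        moreover have "isCont \<phi> 0" using test_fn_continuous_on[OF \<phi>, of UNIV] by (simp add: continuous_on_eq_continuous_at)
        ultimately show "(\<lambda>n. \<phi> (y / (2 * pi * real (Suc n)))) \<longlonglongrightarrow> \<phi> 0" by (rule isCont_tendsto_compose[rotated])
      qed
      show "AE y in lborel. norm (\<phi> (y / (2 * pi * real (Suc n))) * std_normal_density y) \<le> \<bar>B\<bar> * std_normal_density y" for n
        by (intro AE_I2) (auto simp: abs_mult normal_density_nonneg intro!: mult_right_mono B')
    qed (use integrable_normal_density[of 1 0] in auto)
    then have "(\<lambda>n. LINT y|lborel. \<phi> (y / (2 * pi * real (Suc n))) * std_normal_density y) \<longlonglongrightarrow> \<phi> 0"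
      by (simp add: integral_normal_density)
    then show ?thesis by (rule tendsto_of_real)
  qed
  ultimately show ?thesis unfolding eq by (rule LIMSEQ_unique)
qed

text \<open>Translations become modulations. The redundant factor 1 keeps the function in the form
  covered by \<open>test_fn_affine\<close>.\<close>

lemma fourier_translate:
  "fourier (\<lambda>y. \<phi> (1 * y + b)) \<xi> = cis (2 * pi * b * \<xi>) * fourier \<phi> \<xi>"
proof -
  have "fourier \<phi> \<xi> = (LINT y|lborel. complex_of_real (\<phi> (b + 1 * y)) * cis (- (2 * pi * \<xi> * (b + 1 * y))))"
    unfolding fourier_cis by (subst lborel_integral_real_affine[where t = b and c = 1]) auto
  also have "\<dots> = (LINT y|lborel. cis (- (2 * pi * b * \<xi>)) * (complex_of_real (\<phi> (1 * y + b)) * cis (- (2 * pi * \<xi> * y))))"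
    by (rule Bochner_Integration.integral_cong) (auto simp: algebra_simps cis_mult)
  also have "\<dots> = cis (- (2 * pi * b * \<xi>)) * fourier (\<lambda>y. \<phi> (1 * y + b)) \<xi>"
    by (simp add: fourier_cis)
  finally show ?thesis by (simp add: cis_mult flip: mult.assoc)
qed

lemma fourier_inversion:
  assumes \<phi>: "test_fn \<phi>"
  shows "(LINT \<xi>|lborel. fourier \<phi> \<xi> * cis (2 * pi * x * \<xi>)) = \<phi> x"
proof -
  have "test_fn (\<lambda>y. \<phi> (1 * y + x))" by (rule test_fn_affine[OF \<phi>]) simp
  from fourier_inversion_at_0[OF this] show ?thesis
    unfolding fourier_translate by (simp add: mult_ac)
qed

text \<open>Positive and negative parts have equal transforms, at t = 0 equal masses. After
  normalisation they are densities of probability measures with the same characteristic function,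
  and the uniqueness theorem of Levy identifies them.\<close>

lemma real_fourier_uniqueness:
  fixes G :: "real \<Rightarrow> real"
  assumes G: "integrable lborel G"
    and z: "\<And>t. (LINT x|lborel. complex_of_real (G x) * cis (t * x)) = 0"
  shows "AE x in lborel. G x = 0"
proof -
  define P where "P = (\<lambda>x. max (G x) 0)"
  define N where "N = (\<lambda>x. max (- G x) 0)"
  have int: "integrable lborel P" "integrable lborel N" using G unfolding P_def N_def by auto
  have [measurable]: "G \<in> borel_measurable borel" "P \<in> borel_measurable borel" "N \<in> borel_measurable borel"
    using G int by auto
  have nonneg: "P x \<ge> 0" "N x \<ge> 0" for x by (auto simp: P_def N_def)
  have GPN: "G x = P x - N x" for x by (auto simp: P_def N_def)
  have int_cis: "integrable lborel (\<lambda>x. complex_of_real (F x) * cis (t * x))" if "integrable lborel F" for F t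
    by (rule integrable_mult_cis) (use that in simp)
  have eq: "(LINT x|lborel. complex_of_real (P x) * cis (t * x)) = (LINT x|lborel. complex_of_real (N x) * cis (t * x))" for t
  proof -
    have "0 = (LINT x|lborel. complex_of_real (P x) * cis (t * x) - complex_of_real (N x) * cis (t * x))"
      using z[of t] by (simp add: GPN algebra_simps)
    also have "\<dots> = (LINT x|lborel. complex_of_real (P x) * cis (t * x)) - (LINT x|lborel. complex_of_real (N x) * cis (t * x))"
      by (intro Bochner_Integration.integral_diff int_cis int)
    finally show ?thesis by simp
  qed
  define c where "c = (LINT x|lborel. P x)"
  have cN: "(LINT x|lborel. N x) = c"
  proof -
    have "complex_of_real (LINT x|lborel. P x) = complex_of_real (LINT x|lborel. N x)"
      using eq[of 0] by simp
    then show ?thesis by (simp add: c_def)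
  qed
  have "c \<ge> 0" unfolding c_def using nonneg by simp
  then consider "c = 0" | "c > 0" by linarith
  then show ?thesis
  proof cases
    case 1
    have "AE x in lborel. P x = 0" "AE x in lborel. N x = 0"
      using integral_nonneg_eq_0_iff_AE[OF int(1)] integral_nonneg_eq_0_iff_AE[OF int(2)] nonneg cN 1
      by (auto simp: c_def)
    then show ?thesis by eventually_elim (simp add: GPN)
  next
    case 2
    define D where "D = (\<lambda>F::real \<Rightarrow> real. density lborel (\<lambda>x. ennreal (F x / c)))"
    have real_dist: "real_distribution (D F)"
      if F: "integrable lborel F" "\<And>x. F x \<ge> 0" "(LINT x|lborel. F x) = c" for F
    proof -
      have [measurable]: "F \<in> borel_measurable borel" using F(1) by auto
      have "emeasure (D F) (space (D F)) = (\<integral>\<^sup>+ x. ennreal (F x / c) \<partial>lborel)"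
        by (simp add: D_def emeasure_density)
      also have "\<dots> = ennreal (LINT x|lborel. F x / c)"
        by (rule nn_integral_eq_integral) (use F 2 in auto)
      also have "\<dots> = 1" using F(3) 2 by simp
      finally show ?thesis by (intro real_distribution.intro prob_spaceI) (auto simp: real_distribution_axioms_def D_def)
    qed
    have charD: "char (D F) t = (LINT x|lborel. complex_of_real (F x) * cis (t * x)) / c"
      if F: "integrable lborel F" "\<And>x. F x \<ge> 0" for F t
    proof -
      have [measurable]: "F \<in> borel_measurable borel" using F(1) by auto
      have "char (D F) t = (LINT x|lborel. (F x / c) *\<^sub>R iexp (t * x))"
        unfolding char_def D_def using F(2) 2 by (subst integral_density) auto
      also have "\<dots> = (LINT x|lborel. complex_of_real (F x) * cis (t * x) / c)"
        by (simp add: scaleR_conv_of_real cis_conv_exp)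
      finally show ?thesis by simp
    qed
    have "D P = D N"
      using Levy_uniqueness[OF real_dist real_dist] charD[OF int(1)] charD[OF int(2)] int nonneg cN eq
      by (auto simp: c_def fun_eq_iff)
    then have "AE x in lborel. ennreal (P x / c) = ennreal (N x / c)"
      unfolding D_def by (subst (asm) sigma_finite_measure.density_unique_iff[OF sigma_finite_lborel]) auto
    then show ?thesis
    proof eventually_elim
      case (elim x)
      then show ?case using 2 nonneg[of x] by (simp add: GPN)
    qed
  qed
qed

text \<open>Real and imaginary parts are combinations of G and its conjugate, whose transform is the
  conjugate of that of G at the opposite frequency and hence also vanishes.\<close>

lemma fourier_uniqueness:
  fixes G :: "real \<Rightarrow> complex"
  assumes G: "integrable lborel G"
    and z: "\<And>t. (LINT x|lborel. G x * cis (t * x)) = 0"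
  shows "AE x in lborel. G x = 0"
proof -
  note int = integrable_mult_cis[OF G]
  have int': "integrable lborel (\<lambda>x. cnj (G x) * cis (t * x))" for t
    by (intro integrable_mult_cis integrable_bounded_linear[OF bounded_linear_cnj G])
  have cz: "(LINT x|lborel. cnj (G x) * cis (t * x)) = 0" for t
  proof -
    have "(LINT x|lborel. cnj (G x) * cis (t * x)) = (LINT x|lborel. cnj (G x * cis ((- t) * x)))"
      by (simp add: cis_cnj)
    also have "\<dots> = cnj (LINT x|lborel. G x * cis ((- t) * x))" by (rule integral_bounded_linear[OF bounded_linear_cnj int])
    finally show ?thesis by (simp only: z complex_cnj_zero)
  qed
  have re: "complex_of_real (Re w) = (w + cnj w) / 2" and im: "complex_of_real (Im w) = (w - cnj w) / (2 * \<i>)" for w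
    by (simp_all add: complex_eq_iff)
  have "AE x in lborel. Re (G x) = 0"
  proof (rule real_fourier_uniqueness)
    fix t
    have "(LINT x|lborel. complex_of_real (Re (G x)) * cis (t * x))
       = (LINT x|lborel. (G x * cis (t * x) + cnj (G x) * cis (t * x)) / 2)"
      unfolding re by (simp add: algebra_simps)
    also have "\<dots> = 0" by (simp add: int int' z cz)
    finally show "(LINT x|lborel. complex_of_real (Re (G x)) * cis (t * x)) = 0" .
  qed (use G in simp)
  moreover have "AE x in lborel. Im (G x) = 0"
  proof (rule real_fourier_uniqueness)
    fix t
    have "(LINT x|lborel. complex_of_real (Im (G x)) * cis (t * x))
       = (LINT x|lborel. (G x * cis (t * x) - cnj (G x) * cis (t * x)) / (2 * \<i>))"
      unfolding im by (simp add: algebra_simps diff_divide_distrib)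
    also have "\<dots> = 0" by (simp add: int int' z cz)
    finally show "(LINT x|lborel. complex_of_real (Im (G x)) * cis (t * x)) = 0" .
  qed (use G in simp)
  ultimately show ?thesis by eventually_elim (simp add: complex_eq_iff)
qed

section \<open>Uniqueness and inversion for transforms defined by duality\<close>

lemma integrable_mult_square_integrable:
  fixes f g :: "real \<Rightarrow> complex"
  assumes f: "f \<in> borel_measurable lborel" "integrable lborel (\<lambda>x. (cmod (f x))\<^sup>2)"
    and g: "g \<in> borel_measurable lborel" "integrable lborel (\<lambda>x. (cmod (g x))\<^sup>2)"
  shows "integrable lborel (\<lambda>x. f x * g x)"
proof (rule Bochner_Integration.integrable_bound)
  show "integrable lborel (\<lambda>x. (cmod (f x))\<^sup>2 + (cmod (g x))\<^sup>2)" using f g by simp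
  show "(\<lambda>x. f x * g x) \<in> borel_measurable lborel" using f g by simp
  have "a * b \<le> a\<^sup>2 + b\<^sup>2" if "a \<ge> 0" "b \<ge> 0" for a b :: real
  proof -
    have "0 \<le> (a - b)\<^sup>2" by simp
    then have "2 * (a * b) \<le> a\<^sup>2 + b\<^sup>2" by (simp add: power2_diff)
    moreover have "a * b \<ge> 0" using that by simp
    ultimately show ?thesis by linarith
  qed
  then show "AE x in lborel. norm (f x * g x) \<le> norm ((cmod (f x))\<^sup>2 + (cmod (g x))\<^sup>2)"
    by (simp add: norm_mult)
qed

lemma test_fn_square_integrable:
  assumes \<phi>: "test_fn \<phi>"
  shows "integrable lborel (\<lambda>x. (cmod (complex_of_real (\<phi> x)))\<^sup>2)"
  using test_fn_integrable[OF test_fn_times_smooth[OF test_fn_smooth[OF \<phi>] \<phi>]]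
  by (simp add: power2_eq_square)

lemma obtain_cutoff:
  obtains \<kappa> where "test_fn \<kappa>" "\<And>x. \<bar>x\<bar> \<le> a \<Longrightarrow> \<kappa> x = 1"
proof -
  obtain \<sigma> where \<sigma>: "smooth \<sigma>" "\<And>x. x \<le> 0 \<Longrightarrow> \<sigma> x = 0" "\<And>x. x \<ge> 1 \<Longrightarrow> \<sigma> x = 1"
    by (rule obtain_smooth_step) blast
  define \<kappa> where "\<kappa> = (\<lambda>x. \<sigma> (1 * x + (a + 1)) * \<sigma> ((-1) * x + (a + 1)))"
  show ?thesis
  proof (rule that)
    have "smooth \<kappa>" unfolding \<kappa>_def by (intro smooth_mult smooth_affine \<sigma>(1))
    moreover have "\<kappa> x = 0" if "\<bar>a\<bar> + 1 < \<bar>x\<bar>" for x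
    proof -
      have "1 * x + (a + 1) \<le> 0 \<or> (-1) * x + (a + 1) \<le> 0" using that by linarith
      then show ?thesis unfolding \<kappa>_def using \<sigma>(2) by auto
    qed
    ultimately show "test_fn \<kappa>" unfolding test_fn_iff_smooth by blast
    show "\<kappa> x = 1" if "\<bar>x\<bar> \<le> a" for x
    proof -
      have "1 * x + (a + 1) \<ge> 1" "(-1) * x + (a + 1) \<ge> 1" using that by linarith+
      then show ?thesis unfolding \<kappa>_def using \<sigma>(3) by simp
    qed
  qed
qed

lemma AE_eq_0_if_cutoff_eq_0:
  assumes "\<And>\<kappa>. test_fn \<kappa> \<Longrightarrow> AE x in lborel. d x * complex_of_real (\<kappa> x) = 0"
  shows "AE x in lborel. d x = 0"
proof -
  have "AE x in lborel. \<bar>x\<bar> \<le> real n \<longrightarrow> d x = 0" for n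
  proof -
    obtain \<kappa> where \<kappa>: "test_fn \<kappa>" "\<And>x. \<bar>x\<bar> \<le> real n \<Longrightarrow> \<kappa> x = 1" using obtain_cutoff[of "real n"] by blast
    show ?thesis using assms[OF \<kappa>(1)] by eventually_elim (use \<kappa>(2) in auto)
  qed
  then have "AE x in lborel. \<forall>n. \<bar>x\<bar> \<le> real n \<longrightarrow> d x = 0" unfolding AE_all_countable by blast
  then show ?thesis by eventually_elim (meson real_arch_simple)
qed

text \<open>The difference is only square integrable, so uniqueness for integrable functions is
  applied after multiplication by a cutoff. Its transform is a pairing with a cutoff times a
  character.\<close>

lemma is_ft_unique:
  assumes "is_ft f g1" "is_ft f g2"
  shows "AE \<xi> in lborel. g1 \<xi> = g2 \<xi>"
proof -
  have [measurable]: "g1 \<in> borel_measurable borel" "g2 \<in> borel_measurable borel"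
    using assms by (auto simp: is_ft_def)
  have int: "integrable lborel (\<lambda>\<xi>. g \<xi> * of_real (\<phi> \<xi>))" if "is_ft f g" "test_fn \<phi>" for g \<phi>
    using that test_fn_square_integrable[OF that(2)] test_fn_measurable[OF that(2)]
    by (intro integrable_mult_square_integrable) (auto simp: is_ft_def)
  have zero: "(LINT \<xi>|lborel. (g1 \<xi> - g2 \<xi>) * of_real (\<phi> \<xi>)) = 0" if \<phi>: "test_fn \<phi>" for \<phi>
  proof -
    have "(LINT \<xi>|lborel. (g1 \<xi> - g2 \<xi>) * of_real (\<phi> \<xi>)) =
        (LINT \<xi>|lborel. g1 \<xi> * of_real (\<phi> \<xi>)) - (LINT \<xi>|lborel. g2 \<xi> * of_real (\<phi> \<xi>))"
      unfolding left_diff_distrib by (intro Bochner_Integration.integral_diff int assms \<phi>)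
    also have "\<dots> = 0" using assms \<phi> by (simp add: is_ft_def)
    finally show ?thesis .
  qed
  have "AE \<xi> in lborel. (g1 \<xi> - g2 \<xi>) * of_real (\<kappa> \<xi>) = 0" if \<kappa>: "test_fn \<kappa>" for \<kappa>
  proof (rule fourier_uniqueness)
    have int': "integrable lborel (\<lambda>\<xi>. (g1 \<xi> - g2 \<xi>) * of_real (\<phi> \<xi>))" if "test_fn \<phi>" for \<phi>
      unfolding left_diff_distrib by (intro Bochner_Integration.integrable_diff int assms that)
    then show "integrable lborel (\<lambda>\<xi>. (g1 \<xi> - g2 \<xi>) * of_real (\<kappa> \<xi>))" using \<kappa> .
    fix t
    \<comment> \<open>Test functions are real, so a character has to be split into its cosine and
      sine parts, each of which is admissible after the cutoff.\<close>
    have c: "test_fn (\<lambda>\<xi>. cos (t * \<xi> + 0) * \<kappa> \<xi>)" and s: "test_fn (\<lambda>\<xi>. sin (t * \<xi> + 0) * \<kappa> \<xi>)"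
      by (intro test_fn_times_smooth smooth_affine smooth_cos smooth_sin \<kappa>)+
    have cis: "cis a = of_real (cos a) + \<i> * of_real (sin a)" for a
      by (simp add: complex_eq_iff)
    have "(LINT \<xi>|lborel. (g1 \<xi> - g2 \<xi>) * of_real (\<kappa> \<xi>) * cis (t * \<xi>))
      = (LINT \<xi>|lborel. (g1 \<xi> - g2 \<xi>) * of_real (cos (t * \<xi> + 0) * \<kappa> \<xi>)
           + \<i> * ((g1 \<xi> - g2 \<xi>) * of_real (sin (t * \<xi> + 0) * \<kappa> \<xi>)))"
      by (rule Bochner_Integration.integral_cong) (auto simp: cis algebra_simps)
    also have "\<dots> = (LINT \<xi>|lborel. (g1 \<xi> - g2 \<xi>) * of_real (cos (t * \<xi> + 0) * \<kappa> \<xi>))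
        + \<i> * (LINT \<xi>|lborel. (g1 \<xi> - g2 \<xi>) * of_real (sin (t * \<xi> + 0) * \<kappa> \<xi>))"
      by (subst Bochner_Integration.integral_add) (use int'[OF c] int'[OF s] in \<open>auto intro: integrable_mult_right\<close>)
    also have "\<dots> = 0" by (simp only: zero[OF c] zero[OF s] mult_zero_right add_0)
    finally show "(LINT \<xi>|lborel. (g1 \<xi> - g2 \<xi>) * of_real (\<kappa> \<xi>) * cis (t * \<xi>)) = 0" by simp
  qed
  from AE_eq_0_if_cutoff_eq_0[of "\<lambda>\<xi>. g1 \<xi> - g2 \<xi>", OF this] show ?thesis by simp
qed

text \<open>The difference h between f and the inversion integral annihilates transforms of test
  functions. It need not be integrable, but its product with such a transform is. Translating the
  test function modulates its transform, so the product has zero Fourier transform and vanishes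
  almost everywhere; a suitable family of test functions then removes the factor.\<close>

lemma is_ft_inversion:
  assumes fg: "is_ft f g" and f: "f \<in> borel_measurable lborel" "integrable lborel (\<lambda>x. (f x)\<^sup>2)"
    and g: "integrable lborel g"
  shows "AE x in lborel. of_real (f x) = (LINT \<xi>|lborel. g \<xi> * cis (2 * pi * x * \<xi>))"
proof -
  define F where "F = (\<lambda>x. LINT \<xi>|lborel. g \<xi> * cis (2 * pi * x * \<xi>))"
  define h where "h = (\<lambda>x. of_real (f x) - F x)"
  have F: "continuous_on UNIV F" unfolding F_def by (rule continuous_on_LINT_cis[OF g])
  have [measurable]: "F \<in> borel_measurable borel" "f \<in> borel_measurable borel"
    using F f(1) by (auto intro: borel_measurable_continuous_onI)
  have Fb: "cmod (F x) \<le> (LINT \<xi>|lborel. cmod (g \<xi>))" for x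
    unfolding F_def by (rule order_trans[OF integral_norm_bound]) (simp add: norm_mult)
  have int1: "integrable lborel (\<lambda>x. of_real (f x) * fourier \<phi> x)" if "test_fn \<phi>" for \<phi>
    using f fourier_square_integrable[OF that] borel_measurable_integrable[OF fourier_integrable[OF that]]
    by (intro integrable_mult_square_integrable) auto
  have int2: "integrable lborel (\<lambda>x. F x * fourier \<phi> x)" if "test_fn \<phi>" for \<phi>
  proof (rule Bochner_Integration.integrable_bound)
    show "integrable lborel (\<lambda>x. (LINT \<xi>|lborel. cmod (g \<xi>)) * norm (fourier \<phi> x))"
      using fourier_integrable[OF that] by simp
    show "(\<lambda>x. F x * fourier \<phi> x) \<in> borel_measurable lborel"
      using borel_measurable_integrable[OF fourier_integrable[OF that]] by measurable
    show "AE x in lborel. norm (F x * fourier \<phi> x) \<le> norm ((LINT \<xi>|lborel. cmod (g \<xi>)) * norm (fourier \<phi> x))"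
      using Fb by (intro AE_I2) (auto simp: norm_mult intro!: mult_right_mono order_trans[OF Fb])
  qed
  have int3: "integrable lborel (\<lambda>x. h x * fourier \<phi> x)" if "test_fn \<phi>" for \<phi>
    unfolding h_def left_diff_distrib by (intro Bochner_Integration.integrable_diff int1 int2 that)
  have zero: "(LINT x|lborel. h x * fourier \<phi> x) = 0" if \<phi>: "test_fn \<phi>" for \<phi>
  proof -
    have "(LINT x|lborel. F x * fourier \<phi> x) = (LINT x|lborel. fourier \<phi> x * (LINT \<xi>|lborel. g \<xi> * cis (2 * pi * x * \<xi>)))"
      by (simp add: F_def mult_ac)
    also have "\<dots> = (LINT \<xi>|lborel. g \<xi> * (LINT x|lborel. fourier \<phi> x * cis (2 * pi * \<xi> * x)))"
      by (rule integral_exchange_cis[OF fourier_integrable[OF \<phi>] g])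
    also have "\<dots> = (LINT \<xi>|lborel. g \<xi> * of_real (\<phi> \<xi>))"
      by (simp only: fourier_inversion[OF \<phi>])
    also have "\<dots> = (LINT x|lborel. of_real (f x) * fourier \<phi> x)"
      using fg \<phi> by (simp add: is_ft_def)
    finally show ?thesis
      unfolding h_def left_diff_distrib
      by (subst Bochner_Integration.integral_diff[OF int1[OF \<phi>] int2[OF \<phi>]]) simp
  qed
  have ae: "AE x in lborel. h x * fourier \<phi> x = 0" if \<phi>: "test_fn \<phi>" for \<phi>
  proof (rule fourier_uniqueness[OF int3[OF \<phi>]])
    fix t
    have "test_fn (\<lambda>y. \<phi> (1 * y + t / (2 * pi)))" by (rule test_fn_affine[OF \<phi>]) simp
    from zero[OF this] show "(LINT x|lborel. h x * fourier \<phi> x * cis (t * x)) = 0"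
      unfolding fourier_translate by (simp add: mult_ac)
  qed
  obtain \<psi> where \<psi>: "smooth \<psi>" "\<And>x. \<psi> x \<ge> 0" "\<And>x. x \<notin> {0<..<1} \<Longrightarrow> \<psi> x = 0" "(LINT x|lborel. \<psi> x) = 1"
    by (rule obtain_bump) blast
  have t\<psi>: "test_fn \<psi>"
    unfolding test_fn_iff_smooth
  proof (intro conjI exI[of _ 1] allI impI \<psi>(1))
    show "\<psi> x = 0" if "1 < \<bar>x\<bar>" for x by (rule \<psi>(3)) (use that in auto)
  qed
  \<comment> \<open>Narrow bumps have wide transforms: at fixed x the rescaled values tend to
    \<open>fourier \<psi> 0 = 1\<close>, so some member of the family is non-zero at x. The family
    is countable, so the exceptional sets combine to a null set.\<close>
  have dil: "real (Suc n) * fourier (\<lambda>y. \<psi> (real (Suc n) * y + 0)) x = fourier \<psi> (x / real (Suc n))" for n x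
  proof -
    have "fourier \<psi> (x / real (Suc n)) = \<bar>real (Suc n)\<bar> *\<^sub>R
      (LINT y|lborel. of_real (\<psi> (0 + real (Suc n) * y)) * cis (- (2 * pi * (x / real (Suc n)) * (0 + real (Suc n) * y))))"
      unfolding fourier_cis by (rule lborel_integral_real_affine) simp
    also have "(LINT y|lborel. of_real (\<psi> (0 + real (Suc n) * y)) * cis (- (2 * pi * (x / real (Suc n)) * (0 + real (Suc n) * y))))
      = fourier (\<lambda>y. \<psi> (real (Suc n) * y + 0)) x"
      unfolding fourier_cis by (rule Bochner_Integration.integral_cong) (auto simp: mult.assoc simp del: of_nat_Suc)
    finally show ?thesis by (simp add: scaleR_conv_of_real)
  qed
  have "AE x in lborel. \<forall>n. h x * fourier (\<lambda>y. \<psi> (real (Suc n) * y + 0)) x = 0"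
    unfolding AE_all_countable
  proof
    fix n
    show "AE x in lborel. h x * fourier (\<lambda>y. \<psi> (real (Suc n) * y + 0)) x = 0"
      by (rule ae, rule test_fn_affine[OF t\<psi>]) simp
  qed
  then have "AE x in lborel. h x = 0"
  proof eventually_elim
    case (elim x)
    show ?case
    proof (rule ccontr)
      assume "h x \<noteq> 0"
      then have "fourier (\<lambda>y. \<psi> (real (Suc n) * y + 0)) x = 0" for n using elim by auto
      then have 0: "fourier \<psi> (x / real (Suc n)) = 0" for n using dil[of n x] by simp
      have "(\<lambda>n. x * inverse (real (Suc n))) \<longlonglongrightarrow> x * 0"
        by (intro tendsto_intros LIMSEQ_inverse_real_of_nat)
      then have "(\<lambda>n. x / real (Suc n)) \<longlonglongrightarrow> 0" by (simp add: divide_inverse)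
      moreover have "isCont (fourier \<psi>) 0"
        using fourier_continuous[OF t\<psi>] by (simp add: continuous_on_eq_continuous_at)
      ultimately have "(\<lambda>n. fourier \<psi> (x / real (Suc n))) \<longlonglongrightarrow> fourier \<psi> 0"
        by (rule isCont_tendsto_compose[rotated])
      then have "fourier \<psi> 0 = 0" unfolding 0 by (simp add: LIMSEQ_const_iff)
      moreover have "fourier \<psi> 0 = 1" using \<psi>(4) by (simp add: fourier_cis)
      ultimately show False by simp
    qed
  qed
  then show ?thesis by (simp add: h_def F_def)
qed

section \<open>Sobolev embedding\<close>

text \<open>The mean value theorem bounds the difference quotients by the majorant of the
  derivative, and dominated convergence passes to the limit.\<close>

lemma has_real_derivative_LINT:
  fixes q qx :: "real \<Rightarrow> real \<Rightarrow> real"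
  assumes q: "\<And>x. integrable lborel (q x)"
    and d: "\<And>x \<xi>. ((\<lambda>x. q x \<xi>) has_real_derivative qx x \<xi>) (at x)"
    and w: "integrable lborel w" "\<And>x \<xi>. \<bar>qx x \<xi>\<bar> \<le> w \<xi>"
    and meas: "\<And>x. qx x \<in> borel_measurable lborel"
  shows "((\<lambda>x. LINT \<xi>|lborel. q x \<xi>) has_real_derivative (LINT \<xi>|lborel. qx x \<xi>)) (at x)"
  unfolding has_field_derivative_iff tendsto_at_iff_sequentially comp_def
proof (intro allI impI)
  fix X :: "nat \<Rightarrow> real" assume X: "\<forall>i. X i \<in> UNIV - {x}" and lim: "X \<longlonglongrightarrow> x"
  then have ne: "X n \<noteq> x" for n by auto
  have eq: "((LINT \<xi>|lborel. q (X n) \<xi>) - (LINT \<xi>|lborel. q x \<xi>)) / (X n - x)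
      = (LINT \<xi>|lborel. (q (X n) \<xi> - q x \<xi>) / (X n - x))" for n
    using q by (simp add: Bochner_Integration.integral_diff)
  have "(\<lambda>n. LINT \<xi>|lborel. (q (X n) \<xi> - q x \<xi>) / (X n - x)) \<longlonglongrightarrow> (LINT \<xi>|lborel. qx x \<xi>)"
  proof (rule integral_dominated_convergence[where w = w])
    show "(\<lambda>\<xi>. (q (X n) \<xi> - q x \<xi>) / (X n - x)) \<in> borel_measurable lborel" for n
      using borel_measurable_integrable[OF q] by measurable
    show "AE \<xi> in lborel. (\<lambda>n. (q (X n) \<xi> - q x \<xi>) / (X n - x)) \<longlonglongrightarrow> qx x \<xi>"
    proof (rule AE_I2)
      fix \<xi>
      show "(\<lambda>n. (q (X n) \<xi> - q x \<xi>) / (X n - x)) \<longlonglongrightarrow> qx x \<xi>"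
        using d[where x = x and \<xi> = \<xi>, unfolded has_field_derivative_iff tendsto_at_iff_sequentially comp_def] X lim by blast
    qed
    show "AE \<xi> in lborel. norm ((q (X n) \<xi> - q x \<xi>) / (X n - x)) \<le> w \<xi>" for n
    proof (rule AE_I2)
      fix \<xi>
      have "norm (q (X n) \<xi> - q x \<xi>) \<le> w \<xi> * norm (X n - x)"
        by (rule field_differentiable_bound[where S = UNIV and f = "\<lambda>x. q x \<xi>" and f' = "\<lambda>x. qx x \<xi>"])
          (use d w(2) in auto)
      then show "norm ((q (X n) \<xi> - q x \<xi>) / (X n - x)) \<le> w \<xi>"
        using ne[of n] by (simp add: field_simps)
    qed
  qed (use w meas in auto)
  then show "(\<lambda>n. ((LINT \<xi>|lborel. q (X n) \<xi>) - (LINT \<xi>|lborel. q x \<xi>)) / (X n - x)) \<longlonglongrightarrow> (LINT \<xi>|lborel. qx x \<xi>)"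
    unfolding eq .
qed

text \<open>The choice is the one made inside \<open>hnorm\<close>, so the norm can be rewritten
  with it.\<close>

definition ft :: "(real \<Rightarrow> real) \<Rightarrow> real \<Rightarrow> complex" where
  "ft f = (SOME g. is_ft f g)"

text \<open>The continuous representative by Fourier inversion. Taking real parts keeps it
  real-valued even though \<open>ft f\<close> is an arbitrary choice.\<close>

definition rep :: "(real \<Rightarrow> real) \<Rightarrow> real \<Rightarrow> real" where
  "rep f x = (LINT \<xi>|lborel. Re (ft f \<xi> * cis (2 * pi * x * \<xi>)))"

definition rep_deriv :: "(real \<Rightarrow> real) \<Rightarrow> real \<Rightarrow> real" where
  "rep_deriv f x = (LINT \<xi>|lborel. Re (\<i> * complex_of_real (2 * pi * \<xi>) * ft f \<xi> * cis (2 * pi * x * \<xi>)))"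

lemma hnorm_ft: "hnorm m f = sqrt (LINT \<xi>|lborel. (1 + \<xi>\<^sup>2) powr m * (cmod (ft f \<xi>))\<^sup>2)"
  by (simp add: hnorm_def ft_def)

lemma square_sum_le: "(p + q)\<^sup>2 \<le> 2 * p\<^sup>2 + 2 * q\<^sup>2" for p q :: real
  using sum_squares_bound[of p q] by (simp add: power2_sum)

lemma norm_lincomb_square_le:
  fixes z w :: complex
  shows "(cmod (of_real a * z + of_real b * w))\<^sup>2 \<le> 2 * a\<^sup>2 * (cmod z)\<^sup>2 + 2 * b\<^sup>2 * (cmod w)\<^sup>2"
proof -
  have "cmod (of_real a * z + of_real b * w) \<le> \<bar>a\<bar> * cmod z + \<bar>b\<bar> * cmod w"
    by (rule order_trans[OF norm_triangle_ineq]) (simp add: norm_mult)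
  then have "(cmod (of_real a * z + of_real b * w))\<^sup>2 \<le> (\<bar>a\<bar> * cmod z + \<bar>b\<bar> * cmod w)\<^sup>2"
    by (intro power_mono) auto
  also have "\<dots> \<le> 2 * a\<^sup>2 * (cmod z)\<^sup>2 + 2 * b\<^sup>2 * (cmod w)\<^sup>2"
    using square_sum_le[of "\<bar>a\<bar> * cmod z" "\<bar>b\<bar> * cmod w"] by (simp add: power_mult_distrib)
  finally show ?thesis .
qed

lemma is_ft_lincomb:
  assumes f: "is_ft f1 g1" "is_ft f2 g2"
    and L2: "f1 \<in> borel_measurable lborel" "integrable lborel (\<lambda>x. (f1 x)\<^sup>2)"
       "f2 \<in> borel_measurable lborel" "integrable lborel (\<lambda>x. (f2 x)\<^sup>2)"
  shows "is_ft (\<lambda>x. a * f1 x + b * f2 x) (\<lambda>\<xi>. of_real a * g1 \<xi> + of_real b * g2 \<xi>)"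
proof -
  have [measurable]: "g1 \<in> borel_measurable borel" "g2 \<in> borel_measurable borel"
    and g: "integrable lborel (\<lambda>\<xi>. (cmod (g1 \<xi>))\<^sup>2)" "integrable lborel (\<lambda>\<xi>. (cmod (g2 \<xi>))\<^sup>2)"
    using f by (auto simp: is_ft_def)
  have 1: "integrable lborel (\<lambda>\<xi>. (cmod (of_real a * g1 \<xi> + of_real b * g2 \<xi>))\<^sup>2)"
  proof (rule Bochner_Integration.integrable_bound)
    show "integrable lborel (\<lambda>\<xi>. 2 * a\<^sup>2 * (cmod (g1 \<xi>))\<^sup>2 + 2 * b\<^sup>2 * (cmod (g2 \<xi>))\<^sup>2)" using g by simp
    show "AE \<xi> in lborel. norm ((cmod (of_real a * g1 \<xi> + of_real b * g2 \<xi>))\<^sup>2)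
        \<le> norm (2 * a\<^sup>2 * (cmod (g1 \<xi>))\<^sup>2 + 2 * b\<^sup>2 * (cmod (g2 \<xi>))\<^sup>2)"
      by (intro AE_I2) (simp add: norm_lincomb_square_le)
  qed measurable
  have 2: "(LINT \<xi>|lborel. (of_real a * g1 \<xi> + of_real b * g2 \<xi>) * of_real (\<phi> \<xi>)) =
      (LINT x|lborel. of_real (a * f1 x + b * f2 x) * fourier \<phi> x)" if \<phi>: "test_fn \<phi>" for \<phi>
  proof -
    have i1: "integrable lborel (\<lambda>\<xi>. g1 \<xi> * of_real (\<phi> \<xi>))" "integrable lborel (\<lambda>\<xi>. g2 \<xi> * of_real (\<phi> \<xi>))"
      using g test_fn_square_integrable[OF \<phi>] test_fn_measurable[OF \<phi>]
      by (auto intro!: integrable_mult_square_integrable)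
    have i2: "integrable lborel (\<lambda>x. of_real (f1 x) * fourier \<phi> x)" "integrable lborel (\<lambda>x. of_real (f2 x) * fourier \<phi> x)"
      using L2 fourier_square_integrable[OF \<phi>] borel_measurable_integrable[OF fourier_integrable[OF \<phi>]]
      by (auto intro!: integrable_mult_square_integrable)
    have "(LINT \<xi>|lborel. (of_real a * g1 \<xi> + of_real b * g2 \<xi>) * of_real (\<phi> \<xi>)) =
      (LINT \<xi>|lborel. of_real a * (g1 \<xi> * of_real (\<phi> \<xi>)) + of_real b * (g2 \<xi> * of_real (\<phi> \<xi>)))"
      by (simp add: algebra_simps)
    also have "\<dots> = of_real a * (LINT \<xi>|lborel. g1 \<xi> * of_real (\<phi> \<xi>)) + of_real b * (LINT \<xi>|lborel. g2 \<xi> * of_real (\<phi> \<xi>))"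
      using i1 by (subst Bochner_Integration.integral_add) auto
    also have "\<dots> = of_real a * (LINT x|lborel. of_real (f1 x) * fourier \<phi> x)
         + of_real b * (LINT x|lborel. of_real (f2 x) * fourier \<phi> x)"
      using f \<phi> by (simp add: is_ft_def)
    also have "\<dots> = (LINT x|lborel. of_real a * (of_real (f1 x) * fourier \<phi> x) + of_real b * (of_real (f2 x) * fourier \<phi> x))"
      using i2 by (subst Bochner_Integration.integral_add) auto
    finally show ?thesis by (simp add: algebra_simps)
  qed
  show ?thesis unfolding is_ft_def using 1 2 by auto
qed

text \<open>The transform that witnesses the finite weighted norm may differ from the chosen one;
  uniqueness up to null sets transfers the integrability.\<close>

lemma sobolev_ft:
  assumes "sobolev m f"
  shows "is_ft f (ft f)" "integrable lborel (\<lambda>\<xi>. (1 + \<xi>\<^sup>2) powr m * (cmod (ft f \<xi>))\<^sup>2)"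
proof -
  obtain g where g: "is_ft f g" "integrable lborel (\<lambda>\<xi>. (1 + \<xi>\<^sup>2) powr m * (cmod (g \<xi>))\<^sup>2)"
    using assms by (auto simp: sobolev_def)
  show ft: "is_ft f (ft f)" unfolding ft_def by (rule someI[where P = "is_ft f", OF g(1)])
  then have [measurable]: "ft f \<in> borel_measurable borel" by (simp add: is_ft_def)
  have "AE \<xi> in lborel. (1 + \<xi>\<^sup>2) powr m * (cmod (g \<xi>))\<^sup>2 = (1 + \<xi>\<^sup>2) powr m * (cmod (ft f \<xi>))\<^sup>2"
    using is_ft_unique[OF g(1) ft] by eventually_elim simp
  then show "integrable lborel (\<lambda>\<xi>. (1 + \<xi>\<^sup>2) powr m * (cmod (ft f \<xi>))\<^sup>2)"
    by (rule integrable_cong_AE_imp[OF g(2), rotated]) measurable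
qed

text \<open>The factor stems from (1 + 2 pi |xi|)^2 <= 8 pi^2 (1 + xi^2); dividing by the Sobolev
  weight leaves the integrable function below.\<close>

definition sobolev_const :: real where
  "sobolev_const = 8 * pi\<^sup>2 * (LINT \<xi>::real|lborel. inverse (1 + \<xi>\<^sup>2))"

lemma sobolev_const_nonneg: "sobolev_const \<ge> 0"
  unfolding sobolev_const_def by (intro mult_nonneg_nonneg Bochner_Integration.integral_nonneg) (auto simp: add_nonneg_nonneg)

text \<open>Young's inequality with a free parameter stands in for Cauchy--Schwarz.\<close>
lemma weighted_young:
  fixes a s \<xi> m :: real
  assumes s: "s > 0" and a: "a \<ge> 0" and m: "m > 2"
  shows "(1 + 2 * pi * \<bar>\<xi>\<bar>) * a \<le> s / 2 * ((1 + \<xi>\<^sup>2) powr m * a\<^sup>2) + 4 * pi\<^sup>2 / s * inverse (1 + \<xi>\<^sup>2)"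
proof -
  define w where "w = 1 + \<xi>\<^sup>2"
  define b where "b = 1 + 2 * pi * \<bar>\<xi>\<bar>"
  define p where "p = w powr (m / 2)"
  have w: "w \<ge> 1" by (simp add: w_def)
  have p: "p > 0" using w by (simp add: p_def)
  have p2: "p\<^sup>2 = w powr m" using w by (simp add: p_def power2_eq_square flip: powr_add)
  have b2: "b\<^sup>2 \<le> 8 * pi\<^sup>2 * w"
  proof -
    have "b\<^sup>2 \<le> 2 * 1\<^sup>2 + 2 * (2 * pi * \<bar>\<xi>\<bar>)\<^sup>2"
      using sum_squares_bound[of 1 "2 * pi * \<bar>\<xi>\<bar>"] by (simp add: b_def power2_sum)
    moreover have "(1::real) \<le> 4 * pi\<^sup>2"
    proof -
      have "1 \<le> pi" using pi_gt3 by simp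
      then have "1 \<le> pi\<^sup>2" by (rule one_le_power)
      then show ?thesis by simp
    qed
    ultimately show ?thesis by (simp add: w_def power_mult_distrib algebra_simps)
  qed
  have "w powr 2 \<le> w powr m" using w m by (intro powr_mono) auto
  then have w2: "w\<^sup>2 \<le> p\<^sup>2" using w by (simp add: p2)
  have "b\<^sup>2 / p\<^sup>2 \<le> 8 * pi\<^sup>2 * w / p\<^sup>2" using b2 p by (intro divide_right_mono) auto
  also have "\<dots> \<le> 8 * pi\<^sup>2 * w / w\<^sup>2" using w w2 p by (intro divide_left_mono) auto
  also have "\<dots> = 8 * pi\<^sup>2 * inverse w" using w by (simp add: power2_eq_square divide_inverse)
  finally have bp: "b\<^sup>2 / p\<^sup>2 \<le> 8 * pi\<^sup>2 * inverse w" .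
  define q where "q = b / p"
  have q: "p * q = b" "q\<^sup>2 = b\<^sup>2 / p\<^sup>2" using p by (simp_all add: q_def power_divide)
  \<comment> \<open>This square is Young's inequality for the product of \<open>p * a\<close>, which
    is controlled by the Sobolev norm, and \<open>q = b / p\<close>, whose square is integrable in
    the frequency.\<close>
  have "0 \<le> (s * (p * a) - q)\<^sup>2" by simp
  also have "\<dots> = s * (s * (p\<^sup>2 * a\<^sup>2) + q\<^sup>2 / s - 2 * ((p * q) * a))"
    using s by (simp add: power2_eq_square field_simps)
  also have "\<dots> = s * (s * (p\<^sup>2 * a\<^sup>2) + (b\<^sup>2 / p\<^sup>2) / s - 2 * (b * a))" by (simp only: q)
  finally have "2 * (b * a) \<le> s * (p\<^sup>2 * a\<^sup>2) + (b\<^sup>2 / p\<^sup>2) / s"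
    using s by (simp add: zero_le_mult_iff)
  moreover have "(b\<^sup>2 / p\<^sup>2) / s \<le> 8 * pi\<^sup>2 * inverse w / s" using bp s by (intro divide_right_mono) auto
  ultimately show ?thesis unfolding w_def[symmetric] b_def[symmetric] p2[symmetric] by simp
qed

lemma sobolev_embedding:
  assumes m: "m > 2" and f: "sobolev m f"
  shows "integrable lborel (\<lambda>\<xi>. (1 + 2 * pi * \<bar>\<xi>\<bar>) * cmod (ft f \<xi>))"
    and "(LINT \<xi>|lborel. (1 + 2 * pi * \<bar>\<xi>\<bar>) * cmod (ft f \<xi>)) \<le> (1 + sobolev_const) / 2 * hnorm m f"
proof -
  note ft = sobolev_ft[OF f]
  have [measurable]: "ft f \<in> borel_measurable borel" using ft(1) by (simp add: is_ft_def)
  define H where "H = (LINT \<xi>|lborel. (1 + \<xi>\<^sup>2) powr m * (cmod (ft f \<xi>))\<^sup>2)"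
  define J where "J = (LINT \<xi>|lborel. (1 + 2 * pi * \<bar>\<xi>\<bar>) * cmod (ft f \<xi>))"
  have H: "H \<ge> 0" unfolding H_def by (intro Bochner_Integration.integral_nonneg) auto
  have h: "hnorm m f = sqrt H" by (simp add: hnorm_ft H_def)
  have int: "integrable lborel (\<lambda>\<xi>. s / 2 * ((1 + \<xi>\<^sup>2) powr m * (cmod (ft f \<xi>))\<^sup>2) + 4 * pi\<^sup>2 / s * inverse (1 + \<xi>\<^sup>2))" for s
    by (intro Bochner_Integration.integrable_add integrable_mult_right ft(2) lborel_integrable_inverse_1_plus_square)
  show intJ: "integrable lborel (\<lambda>\<xi>. (1 + 2 * pi * \<bar>\<xi>\<bar>) * cmod (ft f \<xi>))"
  proof (rule Bochner_Integration.integrable_bound[OF int[of 1]])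
    show "AE \<xi> in lborel. norm ((1 + 2 * pi * \<bar>\<xi>\<bar>) * cmod (ft f \<xi>))
        \<le> norm (1 / 2 * ((1 + \<xi>\<^sup>2) powr m * (cmod (ft f \<xi>))\<^sup>2) + 4 * pi\<^sup>2 / 1 * inverse (1 + \<xi>\<^sup>2))"
      using order_trans[OF weighted_young[OF zero_less_one norm_ge_zero m] abs_ge_self]
      by (intro AE_I2) (simp add: abs_mult)
  qed measurable
  have young: "J \<le> s / 2 * H + sobolev_const / (2 * s)" if s: "s > 0" for s
  proof -
    have "J \<le> (LINT \<xi>|lborel. s / 2 * ((1 + \<xi>\<^sup>2) powr m * (cmod (ft f \<xi>))\<^sup>2) + 4 * pi\<^sup>2 / s * inverse (1 + \<xi>\<^sup>2))"
      unfolding J_def by (intro integral_mono intJ int weighted_young s m norm_ge_zero)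
    also have "\<dots> = s / 2 * H + 4 * pi\<^sup>2 / s * (LINT \<xi>::real|lborel. inverse (1 + \<xi>\<^sup>2))"
      unfolding H_def using ft(2) lborel_integrable_inverse_1_plus_square
      by (subst Bochner_Integration.integral_add) auto
    finally show ?thesis by (simp add: sobolev_const_def)
  qed
  show "J \<le> (1 + sobolev_const) / 2 * hnorm m f"
  proof (cases "H = 0")
    case True
    have "J \<le> 0"
    proof (rule ccontr)
      assume "\<not> J \<le> 0"
      then have J: "J > 0" by simp
      \<comment> \<open>For H = 0 the bound improves as \<open>s\<close> grows; this value already
        pushes it below J / 2.\<close>
      have "J \<le> sobolev_const / (2 * ((sobolev_const + 1) / J))"
        using young[of "(sobolev_const + 1) / J"] True J sobolev_const_nonneg by simp
      also have "\<dots> = J * (sobolev_const / (2 * (sobolev_const + 1)))" by simp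
      also have "\<dots> < J * 1"
        using J sobolev_const_nonneg by (intro mult_strict_left_mono) (auto simp: field_simps)
      finally show False by simp
    qed
    then show ?thesis using True by (simp add: h)
  next
    case False
    then have "sqrt H > 0" using H by simp
    \<comment> \<open>With \<open>s = 1 / sqrt H\<close> both terms become multiples of
      \<open>sqrt H\<close>, so the bound is linear in the norm.\<close>
    then have "J \<le> 1 / sqrt H / 2 * H + sobolev_const / (2 * (1 / sqrt H))" by (intro young) simp
    also have "1 / sqrt H / 2 * H = sqrt H / 2"
      using H \<open>sqrt H > 0\<close> by (metis (no_types, lifting) divide_divide_eq_left divide_divide_eq_right mult.commute real_div_sqrt times_divide_eq_left mult_1)
    finally show ?thesis by (simp add: h algebra_simps)
  qed
qed

lemma sobolev_ft_integrable:
  assumes m: "m > 2" and f: "sobolev m f"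
  shows "integrable lborel (ft f)" "integrable lborel (\<lambda>\<xi>. \<i> * complex_of_real (2 * pi * \<xi>) * ft f \<xi>)"
proof -
  have [measurable]: "ft f \<in> borel_measurable borel" using sobolev_ft(1)[OF f] by (simp add: is_ft_def)
  note int = sobolev_embedding(1)[OF m f]
  have le: "cmod (ft f \<xi>) \<le> (1 + 2 * pi * \<bar>\<xi>\<bar>) * cmod (ft f \<xi>)"
    "2 * pi * \<bar>\<xi>\<bar> * cmod (ft f \<xi>) \<le> (1 + 2 * pi * \<bar>\<xi>\<bar>) * cmod (ft f \<xi>)" for \<xi>
    by (simp_all add: algebra_simps)
  show "integrable lborel (ft f)"
    by (rule Bochner_Integration.integrable_bound[OF int]) (use le(1) in \<open>auto simp: abs_mult\<close>)
  show "integrable lborel (\<lambda>\<xi>. \<i> * complex_of_real (2 * pi * \<xi>) * ft f \<xi>)"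
    by (rule Bochner_Integration.integrable_bound[OF int]) (use le(2) in \<open>auto simp: abs_mult norm_mult\<close>)
qed

text \<open>The single weight 1 + 2 pi |xi| dominates the integrands of the representative and of
  its derivative, so one estimate bounds both uniformly in x.\<close>

lemma rep_bound:
  assumes m: "m > 2" and f: "sobolev m f"
  shows "\<bar>rep f x\<bar> \<le> (1 + sobolev_const) / 2 * hnorm m f" "\<bar>rep_deriv f x\<bar> \<le> (1 + sobolev_const) / 2 * hnorm m f"
proof -
  note int = sobolev_embedding(1)[OF m f]
  have "\<bar>LINT \<xi>|lborel. g \<xi>\<bar> \<le> (1 + sobolev_const) / 2 * hnorm m f"
    if g: "integrable lborel g" "\<And>\<xi>. \<bar>g \<xi>\<bar> \<le> (1 + 2 * pi * \<bar>\<xi>\<bar>) * cmod (ft f \<xi>)" for g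
  proof -
    have "\<bar>LINT \<xi>|lborel. g \<xi>\<bar> \<le> (LINT \<xi>|lborel. \<bar>g \<xi>\<bar>)" by (rule integral_abs_bound)
    also have "\<dots> \<le> (LINT \<xi>|lborel. (1 + 2 * pi * \<bar>\<xi>\<bar>) * cmod (ft f \<xi>))"
      by (intro integral_mono int g integrable_abs)
    also have "\<dots> \<le> (1 + sobolev_const) / 2 * hnorm m f" by (rule sobolev_embedding(2)[OF m f])
    finally show ?thesis .
  qed
  note bd = this
  note int_cis = integrable_Re[OF integrable_mult_cis]
  have Re_le: "\<bar>Re (z * cis y)\<bar> \<le> cmod z" for z y
    using abs_Re_le_cmod[of "z * cis y"] by (simp add: norm_mult)
  show "\<bar>rep f x\<bar> \<le> (1 + sobolev_const) / 2 * hnorm m f"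
    unfolding rep_def
    by (intro bd int_cis sobolev_ft_integrable[OF m f] order_trans[OF Re_le]) (simp add: algebra_simps)
  show "\<bar>rep_deriv f x\<bar> \<le> (1 + sobolev_const) / 2 * hnorm m f"
    unfolding rep_deriv_def
    by (intro bd int_cis sobolev_ft_integrable[OF m f] order_trans[OF Re_le]) (simp add: algebra_simps norm_mult abs_mult)
qed

lemma rep_eq_Re_integral:
  assumes m: "m > 2" and f: "sobolev m f"
  shows "rep f x = Re (LINT \<xi>|lborel. ft f \<xi> * cis (2 * pi * x * \<xi>))"
    "rep_deriv f x = Re (LINT \<xi>|lborel. \<i> * complex_of_real (2 * pi * \<xi>) * ft f \<xi> * cis (2 * pi * x * \<xi>))"
proof -
  note int_cis = integrable_mult_cis
  show "rep f x = Re (LINT \<xi>|lborel. ft f \<xi> * cis (2 * pi * x * \<xi>))"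
    unfolding rep_def by (intro integral_Re int_cis sobolev_ft_integrable[OF m f])
  show "rep_deriv f x = Re (LINT \<xi>|lborel. \<i> * complex_of_real (2 * pi * \<xi>) * ft f \<xi> * cis (2 * pi * x * \<xi>))"
    unfolding rep_deriv_def by (intro integral_Re int_cis sobolev_ft_integrable[OF m f])
qed

lemma rep_AE:
  assumes m: "m > 2" and f: "sobolev m f"
  shows "AE x in lborel. f x = rep f x"
proof -
  have "AE x in lborel. complex_of_real (f x) = (LINT \<xi>|lborel. ft f \<xi> * cis (2 * pi * x * \<xi>))"
    by (rule is_ft_inversion[OF sobolev_ft(1)[OF f] _ _ sobolev_ft_integrable(1)[OF m f]])
      (use f in \<open>auto simp: sobolev_def\<close>)
  then show ?thesis
  proof eventually_elim
    case (elim x)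
    then have "Re (complex_of_real (f x)) = rep f x" using rep_eq_Re_integral(1)[OF m f] by simp
    then show ?case by simp
  qed
qed

lemma rep_deriv_continuous:
  assumes m: "m > 2" and f: "sobolev m f"
  shows "continuous_on UNIV (rep_deriv f)"
proof -
  have "continuous_on UNIV (\<lambda>x. Re (LINT \<xi>|lborel. (\<i> * complex_of_real (2 * pi * \<xi>) * ft f \<xi>) * cis (2 * pi * x * \<xi>)))"
    by (intro continuous_on_Re continuous_on_LINT_cis sobolev_ft_integrable[OF m f])
  then show ?thesis by (simp add: rep_eq_Re_integral(2)[OF m f, abs_def])
qed

lemma rep_has_derivative:
  assumes m: "m > 2" and f: "sobolev m f"
  shows "(rep f has_real_derivative rep_deriv f x) (at x)"
  unfolding rep_def[abs_def] rep_deriv_def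
proof (rule has_real_derivative_LINT[where w = "\<lambda>\<xi>. cmod (\<i> * complex_of_real (2 * pi * \<xi>) * ft f \<xi>)"])
  have [measurable]: "ft f \<in> borel_measurable borel" using sobolev_ft(1)[OF f] by (simp add: is_ft_def)
  note int_cis = integrable_Re[OF integrable_mult_cis]
  show "integrable lborel (\<lambda>\<xi>. Re (ft f \<xi> * cis (2 * pi * x * \<xi>)))" for x
    by (rule int_cis[OF sobolev_ft_integrable(1)[OF m f]])
  show "(\<lambda>\<xi>. Re (\<i> * complex_of_real (2 * pi * \<xi>) * ft f \<xi> * cis (2 * pi * x * \<xi>))) \<in> borel_measurable lborel" for x
    by (rule borel_measurable_integrable[OF int_cis[OF sobolev_ft_integrable(2)[OF m f]]])
  show "integrable lborel (\<lambda>\<xi>. cmod (\<i> * complex_of_real (2 * pi * \<xi>) * ft f \<xi>))"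
    by (intro integrable_norm sobolev_ft_integrable[OF m f])
  show "\<bar>Re (\<i> * complex_of_real (2 * pi * \<xi>) * ft f \<xi> * cis (2 * pi * x * \<xi>))\<bar> \<le> cmod (\<i> * complex_of_real (2 * pi * \<xi>) * ft f \<xi>)" for x \<xi>
    using abs_Re_le_cmod[of "\<i> * complex_of_real (2 * pi * \<xi>) * ft f \<xi> * cis (2 * pi * x * \<xi>)"] by (simp add: norm_mult)
  show "((\<lambda>x. Re (ft f \<xi> * cis (2 * pi * x * \<xi>))) has_real_derivative
      Re (\<i> * complex_of_real (2 * pi * \<xi>) * ft f \<xi> * cis (2 * pi * x * \<xi>))) (at x)" for x \<xi>
    unfolding cis.code
    by (auto intro!: derivative_eq_intros simp: algebra_simps)
qed

text \<open>The chosen transforms are linear only up to null sets, but integrals ignore these, so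
  the representatives and their derivatives are linear at every point.\<close>

lemma sobolev_lincomb:
  fixes a b :: real
  assumes m: "m > 2" and f: "sobolev m f1" "sobolev m f2"
  defines "f \<equiv> \<lambda>x. a * f1 x + b * f2 x"
  shows "sobolev m f" "rep f x = a * rep f1 x + b * rep f2 x" "rep_deriv f x = a * rep_deriv f1 x + b * rep_deriv f2 x"
proof -
  have L2: "f1 \<in> borel_measurable lborel" "integrable lborel (\<lambda>x. (f1 x)\<^sup>2)"
     "f2 \<in> borel_measurable lborel" "integrable lborel (\<lambda>x. (f2 x)\<^sup>2)"
    using f by (auto simp: sobolev_def)
  note [measurable] = L2(1,3)
  define g where "g = (\<lambda>\<xi>. of_real a * ft f1 \<xi> + of_real b * ft f2 \<xi>)"
  have g: "is_ft f g" unfolding f_def g_def by (rule is_ft_lincomb[OF sobolev_ft(1)[OF f(1)] sobolev_ft(1)[OF f(2)] L2])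
  have [measurable]: "ft f1 \<in> borel_measurable borel" "ft f2 \<in> borel_measurable borel"
    using sobolev_ft(1)[OF f(1)] sobolev_ft(1)[OF f(2)] by (auto simp: is_ft_def)
  have "integrable lborel (\<lambda>x. (f x)\<^sup>2)"
  proof (rule Bochner_Integration.integrable_bound)
    show "integrable lborel (\<lambda>x. 2 * a\<^sup>2 * (f1 x)\<^sup>2 + 2 * b\<^sup>2 * (f2 x)\<^sup>2)" using L2 by simp
    show "AE x in lborel. norm ((f x)\<^sup>2) \<le> norm (2 * a\<^sup>2 * (f1 x)\<^sup>2 + 2 * b\<^sup>2 * (f2 x)\<^sup>2)"
      using square_sum_le[of "a * f1 x" "b * f2 x" for x] by (intro AE_I2) (simp add: f_def power_mult_distrib mult.assoc)
  qed (simp add: f_def)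
  moreover have "integrable lborel (\<lambda>\<xi>. (1 + \<xi>\<^sup>2) powr m * (cmod (g \<xi>))\<^sup>2)"
  proof (rule Bochner_Integration.integrable_bound)
    show "integrable lborel (\<lambda>\<xi>. 2 * a\<^sup>2 * ((1 + \<xi>\<^sup>2) powr m * (cmod (ft f1 \<xi>))\<^sup>2) + 2 * b\<^sup>2 * ((1 + \<xi>\<^sup>2) powr m * (cmod (ft f2 \<xi>))\<^sup>2))"
      by (intro Bochner_Integration.integrable_add integrable_mult_right sobolev_ft(2) f)
    show "AE \<xi> in lborel. norm ((1 + \<xi>\<^sup>2) powr m * (cmod (g \<xi>))\<^sup>2) \<le>
        norm (2 * a\<^sup>2 * ((1 + \<xi>\<^sup>2) powr m * (cmod (ft f1 \<xi>))\<^sup>2) + 2 * b\<^sup>2 * ((1 + \<xi>\<^sup>2) powr m * (cmod (ft f2 \<xi>))\<^sup>2))"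
      (is "AE \<xi> in lborel. ?P \<xi>")
    proof (rule AE_I2)
      fix \<xi>
      from mult_left_mono[OF norm_lincomb_square_le[of a "ft f1 \<xi>" b "ft f2 \<xi>"], of "(1 + \<xi>\<^sup>2) powr m"]
      show "?P \<xi>" by (simp add: g_def distrib_left mult.left_commute[of "_ powr m"] mult.assoc)
    qed
  qed (simp add: g_def)
  ultimately show sob: "sobolev m f" unfolding sobolev_def using g by (auto simp: f_def)
  have ae: "AE \<xi> in lborel. ft f \<xi> = of_real a * ft f1 \<xi> + of_real b * ft f2 \<xi>"
    using is_ft_unique[OF sobolev_ft(1)[OF sob] g] by (simp add: g_def)
  note int_cis = integrable_Re[OF integrable_mult_cis]
  note i0 = int_cis[OF sobolev_ft_integrable(1)[OF m f(1)]] int_cis[OF sobolev_ft_integrable(1)[OF m f(2)]]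
    int_cis[OF sobolev_ft_integrable(1)[OF m sob]]
  note i1 = int_cis[OF sobolev_ft_integrable(2)[OF m f(1)]] int_cis[OF sobolev_ft_integrable(2)[OF m f(2)]]
    int_cis[OF sobolev_ft_integrable(2)[OF m sob]]
  have "rep f x = (LINT \<xi>|lborel. a * Re (ft f1 \<xi> * cis (2 * pi * x * \<xi>)) + b * Re (ft f2 \<xi> * cis (2 * pi * x * \<xi>)))"
    unfolding rep_def
  proof (rule integral_cong_AE)
    show "AE \<xi> in lborel. Re (ft f \<xi> * cis (2 * pi * x * \<xi>)) = a * Re (ft f1 \<xi> * cis (2 * pi * x * \<xi>)) + b * Re (ft f2 \<xi> * cis (2 * pi * x * \<xi>))"
      using ae by eventually_elim (simp add: algebra_simps)
  qed (use i0 in auto)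
  also have "\<dots> = a * rep f1 x + b * rep f2 x"
    unfolding rep_def using i0 by (subst Bochner_Integration.integral_add) auto
  finally show "rep f x = a * rep f1 x + b * rep f2 x" .
  have "rep_deriv f x = (LINT \<xi>|lborel. a * Re (\<i> * of_real (2 * pi * \<xi>) * ft f1 \<xi> * cis (2 * pi * x * \<xi>))
     + b * Re (\<i> * of_real (2 * pi * \<xi>) * ft f2 \<xi> * cis (2 * pi * x * \<xi>)))"
    unfolding rep_deriv_def
  proof (rule integral_cong_AE)
    show "AE \<xi> in lborel. Re (\<i> * of_real (2 * pi * \<xi>) * ft f \<xi> * cis (2 * pi * x * \<xi>)) =
       a * Re (\<i> * of_real (2 * pi * \<xi>) * ft f1 \<xi> * cis (2 * pi * x * \<xi>)) + b * Re (\<i> * of_real (2 * pi * \<xi>) * ft f2 \<xi> * cis (2 * pi * x * \<xi>))"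
      using ae by eventually_elim (simp add: algebra_simps)
  qed (use i1 in auto)
  also have "\<dots> = a * rep_deriv f1 x + b * rep_deriv f2 x"
    unfolding rep_deriv_def using i1 by (subst Bochner_Integration.integral_add) auto
  finally show "rep_deriv f x = a * rep_deriv f1 x + b * rep_deriv f2 x" .
qed

section \<open>From weak to classical solutions\<close>

text \<open>A modulus in time that is uniform in x combines with continuity in x at the central
  time. It is required for \<open>s \<noteq> t\<close>, so that it may be derived from difference
  quotients.\<close>

lemma jointly_continuous_if_locally_uniform:
  fixes R :: "real \<Rightarrow> real \<Rightarrow> real"
  assumes x: "\<And>t. t \<in> S \<Longrightarrow> continuous_on UNIV (R t)"
    and t: "\<And>t. t \<in> S \<Longrightarrow> (\<eta> t \<longlongrightarrow> 0) (at t within S)"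
    and \<eta>: "\<And>t s x. t \<in> S \<Longrightarrow> s \<in> S \<Longrightarrow> s \<noteq> t \<Longrightarrow> \<bar>R s x - R t x\<bar> \<le> \<eta> t s"
  shows "continuous_on (S \<times> UNIV) (\<lambda>(t, x). R t x)"
  unfolding continuous_on_iff
proof (intro ballI allI impI)
  fix p :: "real \<times> real" and e :: real assume p: "p \<in> S \<times> UNIV" and e: "e > 0"
  obtain t0 x0 where p': "p = (t0, x0)" "t0 \<in> S" using p by auto
  have "eventually (\<lambda>s. \<eta> t0 s < e / 2) (at t0 within S)"
    using order_tendstoD(2)[OF t[OF p'(2)], of "e / 2"] e by simp
  then obtain d1 where d1: "d1 > 0" "\<And>s. s \<in> S \<Longrightarrow> s \<noteq> t0 \<Longrightarrow> dist s t0 < d1 \<Longrightarrow> \<eta> t0 s < e / 2"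
    unfolding eventually_at by auto
  obtain d2 where d2: "d2 > 0" "\<And>y. dist y x0 < d2 \<Longrightarrow> dist (R t0 y) (R t0 x0) < e / 2"
    using x[OF p'(2), unfolded continuous_on_iff, rule_format, of x0 "e / 2"] e by auto
  show "\<exists>d>0. \<forall>q\<in>S \<times> UNIV. dist q p < d \<longrightarrow> dist (case q of (t, x) \<Rightarrow> R t x) (case p of (t, x) \<Rightarrow> R t x) < e"
  proof (intro exI[of _ "min d1 d2"] conjI ballI impI)
    fix q assume q: "q \<in> S \<times> (UNIV :: real set)" "dist q p < min d1 d2"
    obtain s y where q': "q = (s, y)" "s \<in> S" using q by auto
    have ds: "dist s t0 < d1" "dist y x0 < d2"
      using q(2) dist_fst_le[of q p] dist_snd_le[of q p] by (auto simp: q' p')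
    have "\<bar>R s y - R t0 y\<bar> < e / 2"
      using \<eta>[OF p'(2) q'(2), of y] d1(2)[OF q'(2) _ ds(1)] e by (cases "s = t0") auto
    moreover have "\<bar>R t0 y - R t0 x0\<bar> < e / 2" using d2(2)[OF ds(2)] by (simp add: dist_real_def)
    ultimately show "dist (case q of (t, x) \<Rightarrow> R t x) (case p of (t, x) \<Rightarrow> R t x) < e"
      unfolding q' p' dist_real_def prod.case by linarith
  qed (use d1 d2 in auto)
qed

section \<open>Curves in the Sobolev space as functions of time and space\<close>

locale C1_Hm_curve =
  fixes m T :: real and U V :: "real \<Rightarrow> real \<Rightarrow> real"
  assumes m: "m > 2" and T: "T > 0" and C1: "C1_Hm m T U V"
begin

definition K :: real where "K = (1 + sobolev_const) / 2"

lemma sobolev_U: "t \<in> {0..T} \<Longrightarrow> sobolev m (U t)" and sobolev_V: "t \<in> {0..T} \<Longrightarrow> sobolev m (V t)"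
  using C1 by (auto simp: C1_Hm_def)

lemma difference:
  assumes "sobolev m f" "sobolev m g"
  shows "\<bar>rep f x - rep g x\<bar> \<le> K * hnorm m (\<lambda>x. f x - g x)"
    "\<bar>rep_deriv f x - rep_deriv g x\<bar> \<le> K * hnorm m (\<lambda>x. f x - g x)"
  using rep_bound[OF m sobolev_lincomb(1)[OF m assms, of 1 "-1"], of x]
    sobolev_lincomb(2,3)[OF m assms, of 1 "-1" x]
  by (simp_all add: K_def)

definition quotient_error :: "real \<Rightarrow> real \<Rightarrow> real" where
  "quotient_error t s = K * hnorm m (\<lambda>x. (U s x - U t x) / (s - t) - V t x)"

lemma difference_quotient:
  assumes "s \<in> {0..T}" "t \<in> {0..T}"
  shows "\<bar>(rep (U s) x - rep (U t) x) / (s - t) - rep (V t) x\<bar> \<le> quotient_error t s"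
    "\<bar>(rep_deriv (U s) x - rep_deriv (U t) x) / (s - t) - rep_deriv (V t) x\<bar> \<le> quotient_error t s"
proof -
  define c where "c = 1 / (s - t)"
  note sU = sobolev_U[OF assms(1)] sobolev_U[OF assms(2)]
  have q: "sobolev m (\<lambda>x. (U s x - U t x) / (s - t))"
    "rep (\<lambda>x. (U s x - U t x) / (s - t)) x = (rep (U s) x - rep (U t) x) / (s - t)"
    "rep_deriv (\<lambda>x. (U s x - U t x) / (s - t)) x = (rep_deriv (U s) x - rep_deriv (U t) x) / (s - t)"
    using sobolev_lincomb[OF m sU, of c "- c"] by (simp_all add: c_def diff_divide_distrib)
  show "\<bar>(rep (U s) x - rep (U t) x) / (s - t) - rep (V t) x\<bar> \<le> quotient_error t s"
    "\<bar>(rep_deriv (U s) x - rep_deriv (U t) x) / (s - t) - rep_deriv (V t) x\<bar> \<le> quotient_error t s"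
    using difference[OF q(1) sobolev_V[OF assms(2)], of x] by (simp_all only: q quotient_error_def)
qed

lemma K_hnorm_tendsto:
  assumes "t \<in> {0..T}"
  shows "(quotient_error t \<longlongrightarrow> 0) (at t within {0..T})"
    "((\<lambda>s. K * hnorm m (\<lambda>x. V s x - V t x)) \<longlongrightarrow> 0) (at t within {0..T})"
  using C1 assms by (auto simp: C1_Hm_def quotient_error_def[abs_def] intro!: tendsto_mult_right_zero)

text \<open>The norm of the quotient error bounds it uniformly in x, for values and for space
  derivatives. So the derivative in H^m is a pointwise one, and the same \<open>V\<close> supplies
  the mixed derivative.\<close>

lemma time_derivative:
  assumes t: "t \<in> {0..T}"
  shows "((\<lambda>s. rep (U s) x) has_real_derivative rep (V t) x) (at t within {0..T})"
    and "((\<lambda>s. rep_deriv (U s) x) has_real_derivative rep_deriv (V t) x) (at t within {0..T})"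
proof -
  have ev: "eventually (\<lambda>s. s \<in> {0..T}) (at t within {0..T})"
    by (auto simp: eventually_at_filter)
  have "(f has_real_derivative g) (at t within {0..T})"
    if le: "\<And>s. s \<in> {0..T} \<Longrightarrow> \<bar>(f s - f t) / (s - t) - g\<bar> \<le> quotient_error t s" for f g
  proof -
    have "((\<lambda>s. (f s - f t) / (s - t) - g) \<longlongrightarrow> 0) (at t within {0..T})"
    proof (rule Lim_null_comparison[OF _ K_hnorm_tendsto(1)[OF t]])
      show "eventually (\<lambda>s. norm ((f s - f t) / (s - t) - g) \<le> quotient_error t s) (at t within {0..T})"
        using ev by eventually_elim (use le in simp)
    qed
    then show ?thesis unfolding has_field_derivative_iff by (rule LIM_zero_cancel)
  qed
  note * = this
  show "((\<lambda>s. rep (U s) x) has_real_derivative rep (V t) x) (at t within {0..T})"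
    "((\<lambda>s. rep_deriv (U s) x) has_real_derivative rep_deriv (V t) x) (at t within {0..T})"
    by (intro * difference_quotient t; assumption)+
qed

lemma continuous_rep: "sobolev m f \<Longrightarrow> continuous_on UNIV (rep f)"
  using rep_has_derivative[OF m] by (meson DERIV_isCont continuous_at_imp_continuous_on)

text \<open>The difference quotient is at most the uniform bound for \<open>V t\<close> plus the
  error; multiplying by the time step gives a modulus uniform in x.\<close>

definition modulus :: "real \<Rightarrow> real \<Rightarrow> real" where
  "modulus t s = \<bar>s - t\<bar> * (K * hnorm m (V t) + quotient_error t s)"

lemma modulus_tendsto:
  assumes "t \<in> {0..T}"
  shows "(modulus t \<longlongrightarrow> 0) (at t within {0..T})"
proof -
  have "((\<lambda>s. \<bar>s - t\<bar> * (K * hnorm m (V t) + quotient_error t s)) \<longlongrightarrow>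
      \<bar>t - t\<bar> * (K * hnorm m (V t) + 0)) (at t within {0..T})"
    by (intro tendsto_intros K_hnorm_tendsto[OF assms])
  then show ?thesis by (simp add: modulus_def[abs_def])
qed

lemma modulus_bound:
  assumes t: "t \<in> {0..T}" and s: "s \<in> {0..T}" "s \<noteq> t"
  shows "\<bar>rep (U s) x - rep (U t) x\<bar> \<le> modulus t s" "\<bar>rep_deriv (U s) x - rep_deriv (U t) x\<bar> \<le> modulus t s"
proof -
  have *: "\<bar>a\<bar> \<le> \<bar>s - t\<bar> * (B + C)" if "\<bar>a / (s - t) - b\<bar> \<le> C" "\<bar>b\<bar> \<le> B" for a b B C :: real
  proof -
    have "\<bar>a / (s - t)\<bar> \<le> B + C" using that by linarith
    then have "\<bar>s - t\<bar> * \<bar>a / (s - t)\<bar> \<le> \<bar>s - t\<bar> * (B + C)" by (rule mult_left_mono) simp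
    then show ?thesis using s(2) by simp
  qed
  show "\<bar>rep (U s) x - rep (U t) x\<bar> \<le> modulus t s" "\<bar>rep_deriv (U s) x - rep_deriv (U t) x\<bar> \<le> modulus t s"
    unfolding modulus_def
    using difference_quotient[OF s(1) t, of x] rep_bound[OF m sobolev_V[OF t], of x]
    by (auto intro!: * simp: K_def)
qed

lemma joint_continuity:
  "continuous_on ({0..T} \<times> UNIV) (\<lambda>(t, x). rep (U t) x)"
  "continuous_on ({0..T} \<times> UNIV) (\<lambda>(t, x). rep_deriv (U t) x)"
  "continuous_on ({0..T} \<times> UNIV) (\<lambda>(t, x). rep (V t) x)"
proof -
  show "continuous_on ({0..T} \<times> UNIV) (\<lambda>(t, x). rep (U t) x)"
    by (rule jointly_continuous_if_locally_uniform[OF continuous_rep[OF sobolev_U] modulus_tendsto modulus_bound(1)])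
  show "continuous_on ({0..T} \<times> UNIV) (\<lambda>(t, x). rep_deriv (U t) x)"
    by (rule jointly_continuous_if_locally_uniform[OF rep_deriv_continuous[OF m sobolev_U] modulus_tendsto modulus_bound(2)])
  show "continuous_on ({0..T} \<times> UNIV) (\<lambda>(t, x). rep (V t) x)"
    by (rule jointly_continuous_if_locally_uniform[OF continuous_rep[OF sobolev_V] K_hnorm_tendsto(2)
          difference(1)[OF sobolev_V sobolev_V]])
qed

text \<open>The supremum over x is finite at each time and depends continuously on time, so it is
  bounded on the compact time interval.\<close>

lemma bounded_rep:
  obtains M where "\<And>t x. t \<in> {0..T} \<Longrightarrow> \<bar>rep (U t) x\<bar> \<le> M"
proof -
  define B where "B = (\<lambda>t. SUP x. \<bar>rep (U t) x\<bar>)"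
  have bdd: "bdd_above (range (\<lambda>x. \<bar>rep (U t) x\<bar>))" if "t \<in> {0..T}" for t
    using rep_bound(1)[OF m sobolev_U[OF that]] by (intro bdd_aboveI2)
  have le: "\<bar>rep (U t) x\<bar> \<le> B t" if "t \<in> {0..T}" for t x
    unfolding B_def by (rule cSUP_upper[OF _ bdd[OF that]]) simp
  have B_le: "B s \<le> B t + e" if "t \<in> {0..T}" "\<And>x. \<bar>rep (U s) x - rep (U t) x\<bar> \<le> e" for s t e
  proof -
    have "(SUP x. \<bar>rep (U s) x\<bar>) \<le> B t + e"
    proof (rule cSUP_least)
      show "\<bar>rep (U s) x\<bar> \<le> B t + e" for x using le[OF that(1), of x] that(2)[of x] by linarith
    qed simp
    then show ?thesis by (simp add: B_def)
  qed
  have "continuous_on {0..T} B"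
    unfolding continuous_on_def
  proof
    fix t assume t: "t \<in> {0..T}"
    have "((\<lambda>s. B s - B t) \<longlongrightarrow> 0) (at t within {0..T})"
    proof (rule Lim_null_comparison[OF _ modulus_tendsto[OF t]])
      have "eventually (\<lambda>s. s \<in> {0..T} \<and> s \<noteq> t) (at t within {0..T})"
        by (auto simp: eventually_at_filter)
      then show "eventually (\<lambda>s. norm (B s - B t) \<le> modulus t s) (at t within {0..T})"
      proof eventually_elim
        case (elim s)
        then have "\<bar>rep (U s) x - rep (U t) x\<bar> \<le> modulus t s" for x using modulus_bound(1)[OF t] by blast
        moreover from this have "\<bar>rep (U t) x - rep (U s) x\<bar> \<le> modulus t s" for x by (simp add: abs_minus_commute)
        ultimately have "B s \<le> B t + modulus t s" "B t \<le> B s + modulus t s"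
          using B_le t elim by blast+
        then show ?case by simp
      qed
    qed
    then show "(B \<longlongrightarrow> B t) (at t within {0..T})" by (rule LIM_zero_cancel)
  qed
  then have "bounded (B ` {0..T})" by (intro compact_imp_bounded compact_continuous_image compact_Icc)
  then obtain M where "\<forall>b \<in> B ` {0..T}. norm b \<le> M" unfolding bounded_iff by blast
  then have "norm (B t) \<le> M" if "t \<in> {0..T}" for t using that by blast
  then have "B t \<le> M" if "t \<in> {0..T}" for t using that by (metis abs_le_D1 real_norm_def)
  then show ?thesis using le by (intro that[of M]) (meson order_trans)
qed

end

section \<open>The equations in pointwise form\<close>

lemma continuous_AE_eq_imp_eq:
  fixes f g :: "real \<Rightarrow> real"
  assumes f: "continuous_on UNIV f" and g: "continuous_on UNIV g" and ae: "AE x in lborel. f x = g x"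
  shows "f x = g x"
proof (rule ccontr)
  assume "f x \<noteq> g x"
  have "\<forall>y\<in>{x. f x \<noteq> g x}. \<exists>e>0. cball y e \<subseteq> {x. f x \<noteq> g x}"
    using open_Collect_neq[OF f g] by (simp only: open_contains_cball)
  then obtain e where e: "e > 0" "cball x e \<subseteq> {x. f x \<noteq> g x}"
    using \<open>f x \<noteq> g x\<close> by blast
  have "AE y in lborel. y \<notin> {x - e..x + e}"
    using ae
  proof eventually_elim
    case (elim y)
    then show ?case using e(2) by (auto simp: cball_eq_atLeastAtMost)
  qed
  then have "{x - e..x + e} \<in> null_sets lborel" by (subst (asm) AE_iff_null_sets[symmetric]) auto
  then show False using e(1) by (auto simp: null_sets_def)
qed

text \<open>The delicate case is a zero of f, which is a minimum, so \<open>f' = 0\<close>.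
  Splitting off one factor f leaves \<open>f powr (\<gamma> - 1)\<close>, which tends to 0 as
  \<open>\<gamma> > 1\<close>.\<close>

lemma has_real_derivative_powr_nonneg:
  fixes f :: "real \<Rightarrow> real"
  assumes f: "(f has_real_derivative f') (at x)" and nonneg: "\<And>y. f y \<ge> 0" and \<gamma>: "\<gamma> > 1"
  shows "((\<lambda>y. f y powr \<gamma>) has_real_derivative \<gamma> * f x powr (\<gamma> - 1) * f') (at x)"
proof (cases "f x = 0")
  case False
  then have "f x > 0" using nonneg[of x] by simp
  then show ?thesis using f by (auto intro!: derivative_eq_intros simp: powr_diff)
next
  case True
  have f'0: "f' = 0" using DERIV_local_min[OF f, of 1] True nonneg by auto
  have "isCont f x" using f by (rule DERIV_isCont)
  then have "(f \<longlongrightarrow> 0) (at x)" using True by (simp add: isCont_def)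
  then have "((\<lambda>y. f y powr (\<gamma> - 1)) \<longlongrightarrow> 0 powr (\<gamma> - 1)) (at x)"
    by (rule tendsto_powr') (use \<gamma> nonneg in auto)
  then have 1: "((\<lambda>y. f y powr (\<gamma> - 1)) \<longlongrightarrow> 0) (at x)" by simp
  have 2: "((\<lambda>y. (f y - f x) / (y - x)) \<longlongrightarrow> 0) (at x)" using f f'0 by (simp add: has_field_derivative_iff)
  have eq: "(f y powr \<gamma> - f x powr \<gamma>) / (y - x) = (f y - f x) / (y - x) * f y powr (\<gamma> - 1)" for y
  proof -
    have "f y powr \<gamma> = f y * f y powr (\<gamma> - 1)"
      using nonneg[of y] by (cases "f y = 0") (auto simp: powr_diff)
    then show ?thesis using True by simp
  qed
  have "((\<lambda>y. f y powr \<gamma>) has_real_derivative 0) (at x)"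
    unfolding has_field_derivative_iff eq using tendsto_mult[OF 2 1] by (simp only: mult_zero_left)
  then show ?thesis by (simp add: f'0)
qed

lemma integral_by_parts_test_fn:
  fixes v :: "real \<Rightarrow> real"
  assumes v: "\<And>x. (v has_real_derivative vx x) (at x)" and vx: "continuous_on UNIV vx" and \<phi>: "test_fn \<phi>"
  shows "(LINT x|lborel. v x * deriv \<phi> x) = - (LINT x|lborel. vx x * \<phi> x)"
proof -
  have vc: "continuous_on UNIV v" using v by (meson DERIV_isCont continuous_at_imp_continuous_on)
  note \<phi>' = test_fn_deriv[OF \<phi>]
  obtain S where S: "S > 0" "\<And>x. x \<notin> {-S..S} \<Longrightarrow> \<phi> x = 0" "\<And>x. x \<notin> {-S..S} \<Longrightarrow> deriv \<phi> x = 0"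
    using test_fn_deriv_support[OF \<phi>] by blast
  have "(LINT x|lborel. v x * deriv \<phi> x + vx x * \<phi> x) = 0"
  proof (rule integral_derivative_compact_support[where f = "\<lambda>x. v x * \<phi> x" and R = S])
    show "((\<lambda>x. v x * \<phi> x) has_vector_derivative v x * deriv \<phi> x + vx x * \<phi> x) (at x)" for x
      using DERIV_mult[OF v smooth_has_derivative[OF test_fn_smooth[OF \<phi>]], of x]
      by (simp add: has_real_derivative_iff_has_vector_derivative algebra_simps)
    show "continuous_on UNIV (\<lambda>x. v x * deriv \<phi> x + vx x * \<phi> x)"
      by (intro continuous_intros vc vx test_fn_continuous_on \<phi> \<phi>')
    show "v x * deriv \<phi> x + vx x * \<phi> x = 0" "v x * \<phi> x = 0" if "x \<notin> {-S..S}" for x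
      using S(2,3)[OF that] by simp_all
    show "S > 0" by (rule S(1))
  qed
  also have "(LINT x|lborel. v x * deriv \<phi> x + vx x * \<phi> x) = (LINT x|lborel. v x * deriv \<phi> x) + (LINT x|lborel. vx x * \<phi> x)"
    using test_fn_integrable_mult[OF \<phi>' vc] test_fn_integrable_mult[OF \<phi> vx]
    by (intro Bochner_Integration.integral_add) (simp_all add: mult.commute)
  finally show ?thesis by simp
qed

text \<open>In the distributional equations the functions are replaced by their representatives. The
  mass equation then says that rho u has derivative -rho_t. In the momentum equation one integration
  by parts in the viscous term makes the momentum flux minus \<open>\<nu>\<close> times u_x
  continuously differentiable; since the flux itself is differentiable, so is u_x.\<close>

lemma NS_solution_classical:
  assumes \<nu>: "\<nu> > 0" and \<gamma>: "\<gamma> > 1" and m: "m > 2" and T: "T > 0"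
    and \<rho>0: "continuous_on UNIV \<rho>0" "\<And>x. \<rho>0 x \<ge> 0" "\<And>x. x \<le> 0 \<Longrightarrow> \<rho>0 x = 0" and u0: "continuous_on UNIV u0"
    and NS: "NS_solution \<nu> \<gamma> m T \<rho>0 u0 \<rho> u"
  obtains r rx rt v vx M rxt vt vxx where
    "compressible_flow T r rx rt v vx \<nu> \<gamma> M rxt vt vxx" "r 0 = \<rho>0" "v 0 = u0"
proof -
  obtain \<rho>' u' where C1\<rho>: "C1_Hm m T \<rho> \<rho>'" and C1u: "C1_Hm m T u u'"
    and init: "AE x in lborel. \<rho> 0 x = \<rho>0 x" "AE x in lborel. u 0 x = u0 x"
    and weak_mass: "\<And>t \<phi>. t \<in> {0<..T} \<Longrightarrow> test_fn \<phi> \<Longrightarrow>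
       (LINT x|lborel. \<rho>' t x * \<phi> x - \<rho> t x * u t x * deriv \<phi> x) = 0"
    and weak_mom: "\<And>t \<phi>. t \<in> {0<..T} \<Longrightarrow> test_fn \<phi> \<Longrightarrow>
       (LINT x|lborel. (\<rho>' t x * u t x + \<rho> t x * u' t x) * \<phi> x
               - (\<rho> t x * (u t x)\<^sup>2 + \<rho> t x powr \<gamma>) * deriv \<phi> x)
           = \<nu> * (LINT x|lborel. u t x * deriv (deriv \<phi>) x)"
    using NS unfolding NS_solution_def by blast
  interpret R: C1_Hm_curve m T \<rho> \<rho>' using m T C1\<rho> by unfold_locales
  interpret V: C1_Hm_curve m T u u' using m T C1u by unfold_locales
  define r where "r = (\<lambda>t. rep (\<rho> t))"
  define rx where "rx = (\<lambda>t. rep_deriv (\<rho> t))"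
  define rt where "rt = (\<lambda>t. rep (\<rho>' t))"
  define rxt where "rxt = (\<lambda>t. rep_deriv (\<rho>' t))"
  define v where "v = (\<lambda>t. rep (u t))"
  define vx where "vx = (\<lambda>t. rep_deriv (u t))"
  define vt where "vt = (\<lambda>t. rep (u' t))"
  have cont: "continuous_on ({0..T} \<times> UNIV) (\<lambda>(t, x). r t x)" "continuous_on ({0..T} \<times> UNIV) (\<lambda>(t, x). rx t x)"
     "continuous_on ({0..T} \<times> UNIV) (\<lambda>(t, x). v t x)" "continuous_on ({0..T} \<times> UNIV) (\<lambda>(t, x). vx t x)"
     "continuous_on ({0..T} \<times> UNIV) (\<lambda>(t, x). vt t x)"
    unfolding r_def rx_def v_def vx_def vt_def by (rule R.joint_continuity V.joint_continuity)+
  have dx: "(r t has_real_derivative rx t x) (at x)" "(rt t has_real_derivative rxt t x) (at x)"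
      "(v t has_real_derivative vx t x) (at x)" if "t \<in> {0..T}" for t x
    unfolding r_def rx_def rt_def rxt_def v_def vx_def
    by (rule rep_has_derivative[OF m] R.sobolev_U R.sobolev_V V.sobolev_U that)+
  have dt: "((\<lambda>s. r s x) has_real_derivative rt t x) (at t within {0..T})"
      "((\<lambda>s. rx s x) has_real_derivative rxt t x) (at t within {0..T})"
      "((\<lambda>s. v s x) has_real_derivative vt t x) (at t within {0..T})" if "t \<in> {0..T}" for t x
    unfolding r_def rx_def rt_def rxt_def v_def vt_def
    by (rule R.time_derivative V.time_derivative that)+
  have contx: "continuous_on UNIV (r t)" "continuous_on UNIV (rx t)" "continuous_on UNIV (rt t)"
      "continuous_on UNIV (v t)" "continuous_on UNIV (vx t)" "continuous_on UNIV (vt t)" if "t \<in> {0..T}" for t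
    unfolding r_def rx_def rt_def v_def vx_def vt_def
    by (rule R.continuous_rep rep_deriv_continuous[OF m] R.sobolev_U R.sobolev_V V.sobolev_U V.sobolev_V that)+
  have ae: "AE x in lborel. \<rho> t x = r t x" "AE x in lborel. \<rho>' t x = rt t x"
      "AE x in lborel. u t x = v t x" "AE x in lborel. u' t x = vt t x" if "t \<in> {0..T}" for t
    unfolding r_def rt_def v_def vt_def
    by (rule rep_AE[OF m] R.sobolev_U R.sobolev_V V.sobolev_U V.sobolev_V that)+
  have meas: "\<rho> t \<in> borel_measurable borel" "\<rho>' t \<in> borel_measurable borel" "u t \<in> borel_measurable borel" "u' t \<in> borel_measurable borel"
    if "t \<in> {0..T}" for t
    using R.sobolev_U[OF that] R.sobolev_V[OF that] V.sobolev_U[OF that] V.sobolev_V[OF that] by (auto simp: sobolev_def)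
  have measr: "r t \<in> borel_measurable borel" "rt t \<in> borel_measurable borel" "v t \<in> borel_measurable borel" "vt t \<in> borel_measurable borel"
    if "t \<in> {0..T}" for t
    using contx[OF that] by (auto intro: borel_measurable_continuous_onI)
  have int: "integrable lborel (\<lambda>x. f x * \<phi> x)" if "continuous_on UNIV f" "test_fn \<phi>" for f \<phi> :: "real \<Rightarrow> real"
    using test_fn_integrable_mult[OF that(2,1)] by (simp add: mult.commute)
  have flux: "((\<lambda>x. r t x * v t x) has_real_derivative - rt t x) (at x)" if t: "t \<in> {0<..T}" for t x
  proof (rule weak_derivative_is_derivative)
    have t': "t \<in> {0..T}" using t by auto
    show "continuous_on UNIV (rt t)" "continuous_on UNIV (\<lambda>x. r t x * v t x)"
      by (intro continuous_intros contx[OF t'])+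
    fix \<phi> assume \<phi>: "test_fn \<phi>"
    note \<phi>' = test_fn_deriv[OF \<phi>]
    note [measurable] = test_fn_measurable[OF \<phi>] test_fn_measurable[OF \<phi>'] meas[OF t'] measr[OF t']
    have "(LINT x|lborel. rt t x * \<phi> x) - (LINT x|lborel. (r t x * v t x) * deriv \<phi> x)
        = (LINT x|lborel. rt t x * \<phi> x - (r t x * v t x) * deriv \<phi> x)"
      by (intro Bochner_Integration.integral_diff[symmetric] int \<phi> \<phi>' continuous_intros contx[OF t'])
    also have "\<dots> = (LINT x|lborel. \<rho>' t x * \<phi> x - \<rho> t x * u t x * deriv \<phi> x)"
    proof (rule integral_cong_AE)
      show "AE x in lborel. rt t x * \<phi> x - (r t x * v t x) * deriv \<phi> x = \<rho>' t x * \<phi> x - \<rho> t x * u t x * deriv \<phi> x"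
        using ae(1)[OF t'] ae(2)[OF t'] ae(3)[OF t'] by eventually_elim simp
    qed measurable
    also have "\<dots> = 0" by (rule weak_mass[OF t \<phi>])
    finally show "(LINT x|lborel. rt t x * \<phi> x) = (LINT x|lborel. (r t x * v t x) * deriv \<phi> x)" by simp
  qed
  have mass: "rt t x + v t x * rx t x + vx t x * r t x = 0" if t: "t \<in> {0<..T}" for t x
  proof -
    have t': "t \<in> {0..T}" using t by auto
    have "((\<lambda>x. r t x * v t x) has_real_derivative rx t x * v t x + vx t x * r t x) (at x)"
      by (rule DERIV_mult[OF dx(1,3)[OF t']])
    then have "rx t x * v t x + vx t x * r t x = - rt t x" using flux[OF t] by (rule DERIV_unique)
    then show ?thesis by (simp add: mult.commute)
  qed
  obtain M where M: "\<And>t x. t \<in> {0..T} \<Longrightarrow> \<bar>v t x\<bar> \<le> M" using V.bounded_rep unfolding v_def by blast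
  have T0: "0 \<in> {0..T}" using T by simp
  have r0: "r 0 = \<rho>0"
  proof
    fix x
    \<comment> \<open>The initial data are attained almost everywhere, and continuity of both sides
      upgrades this to every point.\<close>
    have "AE x in lborel. r 0 x = \<rho>0 x" using ae(1)[OF T0] init(1) by eventually_elim simp
    then show "r 0 x = \<rho>0 x" by (rule continuous_AE_eq_imp_eq[OF contx(1)[OF T0] \<rho>0(1)])
  qed
  have v0: "v 0 = u0"
  proof
    fix x
    have "AE x in lborel. v 0 x = u0 x" using ae(3)[OF T0] init(2) by eventually_elim simp
    then show "v 0 x = u0 x" by (rule continuous_AE_eq_imp_eq[OF contx(4)[OF T0] u0])
  qed
  \<comment> \<open>Nonnegativity follows from the mass equation alone and is needed before the
    pressure can be differentiated.\<close>
  interpret tr: transport T r rx rt v vx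
    by unfold_locales (use cont dx dt mass in auto)
  have nonneg: "r t x \<ge> 0" if "t \<in> {0..T}" for t x
    by (rule tr.nonneg_if_bounded_velocity[OF M _ that]) (use \<rho>0 r0 in auto)
  \<comment> \<open>Solving the momentum equation for the second derivative defines a function
    continuous up to t = 0; that it is the derivative of \<open>vx\<close> is shown below for t >
    0.\<close>
  define vxx where "vxx = (\<lambda>t x. (r t x * (vt t x + v t x * vx t x) + \<gamma> * r t x powr (\<gamma> - 1) * rx t x) / \<nu>)"
  have cont_vxx: "continuous_on ({0..T} \<times> UNIV) (\<lambda>(t, x). vxx t x)"
  proof -
    have "continuous_on ({0..T} \<times> UNIV) (\<lambda>p. r (fst p) (snd p) powr (\<gamma> - 1))"
      using cont(1) nonneg \<gamma> unfolding case_prod_unfold by (intro continuous_on_powr') (auto intro: continuous_intros)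
    then show ?thesis
      using cont \<nu> unfolding vxx_def case_prod_unfold
      by (intro continuous_on_divide continuous_on_add continuous_on_mult continuous_on_const) auto
  qed
  have dvx: "(vx t has_real_derivative vxx t x) (at x)" if t: "t \<in> {0<..T}" for t x
  proof -
    have t': "t \<in> {0..T}" using t by auto
    define A where "A = (\<lambda>x. rt t x * v t x + r t x * vt t x)"
    define P where "P = (\<lambda>x. r t x * (v t x)\<^sup>2 + r t x powr \<gamma>)"
    have powrc: "continuous_on UNIV (\<lambda>x. r t x powr \<gamma>)"
      using contx(1)[OF t'] nonneg[OF t'] \<gamma> by (intro continuous_on_powr') (auto intro: continuous_intros)
    have contA: "continuous_on UNIV A" unfolding A_def by (intro continuous_intros contx[OF t'])
    have contP: "continuous_on UNIV P" unfolding P_def by (intro continuous_intros contx[OF t'] powrc)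
    have "((\<lambda>x. P x - \<nu> * vx t x) has_real_derivative - A x) (at x)"
    proof (rule weak_derivative_is_derivative[OF contA])
      show "continuous_on UNIV (\<lambda>x. P x - \<nu> * vx t x)" by (intro continuous_intros contP contx[OF t'])
      fix \<phi> assume \<phi>: "test_fn \<phi>"
      note \<phi>' = test_fn_deriv[OF \<phi>]
      note \<phi>'' = test_fn_deriv[OF \<phi>']
      note [measurable] = test_fn_measurable[OF \<phi>] test_fn_measurable[OF \<phi>'] test_fn_measurable[OF \<phi>''] meas[OF t'] measr[OF t']
      have "(LINT x|lborel. A x * \<phi> x) - (LINT x|lborel. P x * deriv \<phi> x) = (LINT x|lborel. A x * \<phi> x - P x * deriv \<phi> x)"
        by (intro Bochner_Integration.integral_diff[symmetric] int \<phi> \<phi>' contA contP)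
      also have "\<dots> = (LINT x|lborel. (\<rho>' t x * u t x + \<rho> t x * u' t x) * \<phi> x
               - (\<rho> t x * (u t x)\<^sup>2 + \<rho> t x powr \<gamma>) * deriv \<phi> x)"
      proof (rule integral_cong_AE)
        show "AE x in lborel. A x * \<phi> x - P x * deriv \<phi> x = (\<rho>' t x * u t x + \<rho> t x * u' t x) * \<phi> x
               - (\<rho> t x * (u t x)\<^sup>2 + \<rho> t x powr \<gamma>) * deriv \<phi> x"
          using ae(1)[OF t'] ae(2)[OF t'] ae(3)[OF t'] ae(4)[OF t'] by eventually_elim (simp add: A_def P_def)
      qed (auto simp: A_def P_def)
      also have "\<dots> = \<nu> * (LINT x|lborel. u t x * deriv (deriv \<phi>) x)" by (rule weak_mom[OF t \<phi>])
      also have "(LINT x|lborel. u t x * deriv (deriv \<phi>) x) = (LINT x|lborel. v t x * deriv (deriv \<phi>) x)"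
      proof (rule integral_cong_AE)
        show "AE x in lborel. u t x * deriv (deriv \<phi>) x = v t x * deriv (deriv \<phi>) x"
          using ae(3)[OF t'] by eventually_elim simp
      qed measurable
      also have "\<dots> = - (LINT x|lborel. vx t x * deriv \<phi> x)"
        by (rule integral_by_parts_test_fn[OF dx(3)[OF t'] contx(5)[OF t'] \<phi>'])
      finally have "(LINT x|lborel. A x * \<phi> x) = (LINT x|lborel. P x * deriv \<phi> x) - \<nu> * (LINT x|lborel. vx t x * deriv \<phi> x)"
        by simp
      also have "\<dots> = (LINT x|lborel. P x * deriv \<phi> x) - (LINT x|lborel. \<nu> * (vx t x * deriv \<phi> x))" by simp
      also have "\<dots> = (LINT x|lborel. P x * deriv \<phi> x - \<nu> * (vx t x * deriv \<phi> x))"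
        by (intro Bochner_Integration.integral_diff[symmetric] integrable_mult_right int \<phi>' contP contx[OF t'])
      finally show "(LINT x|lborel. A x * \<phi> x) = (LINT x|lborel. (P x - \<nu> * vx t x) * deriv \<phi> x)"
        by (simp add: algebra_simps)
    qed
    note dB = this
    have dp: "((\<lambda>x. r t x powr \<gamma>) has_real_derivative \<gamma> * r t x powr (\<gamma> - 1) * rx t x) (at x)"
      by (rule has_real_derivative_powr_nonneg[OF dx(1)[OF t'] nonneg[OF t'] \<gamma>])
    have "(P has_real_derivative rx t x * (v t x)\<^sup>2 + 2 * v t x * vx t x * r t x + \<gamma> * r t x powr (\<gamma> - 1) * rx t x) (at x)"
      unfolding P_def by (rule derivative_eq_intros dp dx(1)[OF t'] dx(3)[OF t'] refl)+ simp
    from DERIV_diff[OF this dB]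
    \<comment> \<open>The quotient is \<open>vx t x\<close>, written through the two functions whose
      derivatives are known.\<close>
    have "((\<lambda>x. (P x - (P x - \<nu> * vx t x)) / \<nu>) has_real_derivative
       (rx t x * (v t x)\<^sup>2 + 2 * v t x * vx t x * r t x + \<gamma> * r t x powr (\<gamma> - 1) * rx t x - - A x) / \<nu>) (at x)"
      by (rule DERIV_cdivide)
    moreover have "rx t x * (v t x)\<^sup>2 + 2 * v t x * vx t x * r t x + \<gamma> * r t x powr (\<gamma> - 1) * rx t x - - A x
       = \<nu> * vxx t x"
    proof -
      have rt: "rt t x = - (v t x * rx t x + vx t x * r t x)" using mass[OF t, of x] by simp
      have "\<nu> * vxx t x = r t x * (vt t x + v t x * vx t x) + \<gamma> * r t x powr (\<gamma> - 1) * rx t x"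
        using \<nu> by (simp add: vxx_def)
      then show ?thesis unfolding A_def rt by (simp add: algebra_simps power2_eq_square)
    qed
    ultimately show ?thesis using \<nu> by simp
  qed
  have "compressible_flow T r rx rt v vx \<nu> \<gamma> M rxt vt vxx"
  proof
    show "integrable lborel (\<lambda>x. (v t x)\<^sup>2)" if t: "t \<in> {0..T}" for t
    proof (rule integrable_cong_AE_imp)
      show "integrable lborel (\<lambda>x. (u t x)\<^sup>2)" using V.sobolev_U[OF t] by (simp add: sobolev_def)
      show "(\<lambda>x. (v t x)\<^sup>2) \<in> borel_measurable lborel" using measr(3)[OF t] by simp
      show "AE x in lborel. (u t x)\<^sup>2 = (v t x)\<^sup>2" using ae(3)[OF t] by eventually_elim simp
    qed
    show "\<nu> * vxx t x = r t x * (vt t x + v t x * vx t x) + \<gamma> * r t x powr (\<gamma> - 1) * rx t x" for t x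
      using \<nu> by (simp add: vxx_def)
    show "r 0 x \<ge> 0" for x using \<rho>0(2) by (simp add: r0)
    show "r 0 x = 0" if "x \<le> 0" for x using \<rho>0(3)[OF that] by (simp add: r0)
  qed (fact T \<nu> \<gamma> M cont_vxx dx dt dvx)+
  then show ?thesis using r0 v0 by (rule that)
qed

theorem theorem1p1:
  fixes \<mu> lam \<gamma> :: real and \<rho>0 u0 :: "real \<Rightarrow> real"
  assumes "\<mu> > 0" and "2 * \<mu> + lam > 0" and "\<gamma> > 1"
    and "continuous_on UNIV \<rho>0" and "continuous_on UNIV u0"
    and "closure {x. \<rho>0 x \<noteq> 0} = {0..1}"
    and "\<forall>x\<in>{0<..<1}. \<rho>0 x > 0"
    and "\<exists>l1 l2 l3 l4 :: real. l1 > 0 \<and> l2 > 0 \<and> 0 < l3 \<and> l3 < 1 \<and> 0 < l4 \<and> l4 < 1 \<and>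
       ( ((\<forall>x\<in>{0<..<l3}. \<exists>d. (\<rho>0 has_real_derivative d) (at x) \<and> d / \<rho>0 x \<ge> l1)
           \<and> u0 l3 < 0 \<and> (\<forall>x\<in>{0<..<l3}. u0 x \<le> 0))
       \<or> ((\<forall>x\<in>{l4<..<1}. \<exists>d. (\<rho>0 has_real_derivative d) (at x) \<and> d / \<rho>0 x \<le> - l2)
           \<and> u0 l4 > 0 \<and> (\<forall>x\<in>{l4<..<1}. u0 x \<ge> 0)) )"
  shows "\<forall>T m. T > 0 \<longrightarrow> m > 2 \<longrightarrow>
           \<not> (\<exists>\<rho> u. NS_solution (2 * \<mu> + lam) \<gamma> m T \<rho>0 u0 \<rho> u)"
proof (intro allI impI notI, elim exE)
  fix T m \<rho> u assume T: "T > 0" and m: "m > 2" and NS: "NS_solution (2 * \<mu> + lam) \<gamma> m T \<rho>0 u0 \<rho> u"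
  note pos = assms(7)
  have out: "\<rho>0 x = 0" if "x \<notin> {0..1}" for x
    using that closure_subset[of "{x. \<rho>0 x \<noteq> 0}"] assms(6) by blast
  have cont: "isCont \<rho>0 a" for a using assms(4) by (simp add: continuous_on_eq_continuous_at)
  \<comment> \<open>The support condition is about a closure, so at the two end points the density
    is 0 only by continuity from outside.\<close>
  have z0: "\<rho>0 0 = 0" by (rule zero_by_left_continuity[OF cont]) (simp add: out)
  have z1: "\<rho>0 1 = 0"
  proof -
    have "isCont (\<lambda>x. \<rho>0 (- x)) (- 1)" by (rule isCont_o2[OF _ cont]) simp
    from zero_by_left_continuity[OF this] show ?thesis by (simp add: out)
  qed
  have left: "\<rho>0 x = 0" if "x \<le> 0" for x using out[of x] z0 that by (cases "x = 0") auto
  have right: "\<rho>0 x = 0" if "x \<ge> 1" for x using out[of x] z1 that by (cases "x = 1") auto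
  have nonneg: "\<rho>0 x \<ge> 0" for x
    using left[of x] right[of x] pos by (cases "x \<in> {0<..<1}") (auto simp: less_imp_le)
  obtain r rx rt v vx M rxt vt vxx where
    flow: "compressible_flow T r rx rt v vx (2 * \<mu> + lam) \<gamma> M rxt vt vxx" and r0: "r 0 = \<rho>0" and v0: "v 0 = u0"
    by (rule NS_solution_classical[OF assms(2,3) m T assms(4) nonneg left assms(5) NS])
  interpret L: compressible_flow T r rx rt v vx "2 * \<mu> + lam" \<gamma> M rxt vt vxx by (rule flow)
  have T0: "0 \<in> {0..T}" using T by simp
  \<comment> \<open>The derivative of the data in the gradient condition agrees with the
    representative's by uniqueness of derivatives.\<close>
  have rx0: "rx 0 x = d" if "(\<rho>0 has_real_derivative d) (at x)" for x d
    using DERIV_unique[OF L.deriv_\<rho>x[OF T0, of x, unfolded r0] that] .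
  obtain l1 l2 l3 l4 where l: "l1 > 0" "l2 > 0" "0 < l3" "l3 < 1" "0 < l4" "l4 < 1"
    and alt: "((\<forall>x\<in>{0<..<l3}. \<exists>d. (\<rho>0 has_real_derivative d) (at x) \<and> d / \<rho>0 x \<ge> l1)
           \<and> u0 l3 < 0 \<and> (\<forall>x\<in>{0<..<l3}. u0 x \<le> 0))
       \<or> ((\<forall>x\<in>{l4<..<1}. \<exists>d. (\<rho>0 has_real_derivative d) (at x) \<and> d / \<rho>0 x \<le> - l2)
           \<and> u0 l4 > 0 \<and> (\<forall>x\<in>{l4<..<1}. u0 x \<ge> 0))"
    using assms(8) by metis
  from alt show False
  proof
    assume H: "(\<forall>x\<in>{0<..<l3}. \<exists>d. (\<rho>0 has_real_derivative d) (at x) \<and> d / \<rho>0 x \<ge> l1)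
           \<and> u0 l3 < 0 \<and> (\<forall>x\<in>{0<..<l3}. u0 x \<le> 0)"
    show False
    proof (rule L.inward_velocity_impossible[OF l(3) l(1)])
      fix x assume x: "x \<in> {0<..<l3}"
      then have p: "\<rho>0 x > 0" using pos l by auto
      then show "0 < r 0 x" by (simp add: r0)
      obtain d where d: "(\<rho>0 has_real_derivative d) (at x)" "d / \<rho>0 x \<ge> l1" using H x by blast
      then show "l1 * r 0 x \<le> rx 0 x" using p by (simp add: rx0[OF d(1)] r0 field_simps)
      show "v 0 x \<le> 0" using H x by (simp add: v0)
    qed (use H v0 in auto)
  next
    assume H: "(\<forall>x\<in>{l4<..<1}. \<exists>d. (\<rho>0 has_real_derivative d) (at x) \<and> d / \<rho>0 x \<le> - l2)
           \<and> u0 l4 > 0 \<and> (\<forall>x\<in>{l4<..<1}. u0 x \<ge> 0)"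
    have "r 0 x = 0" if "x \<ge> 1" for x using right[OF that] by (simp add: r0)
    note refl_flow = L.reflected_flow[OF this]
    show False
    \<comment> \<open>Reflection maps the interval from \<open>l4\<close> to 1 onto the one from 0
      to \<open>1 - l4\<close>; the density gradient and the velocity change sign, which turns this
      alternative into the first.\<close>
    proof (rule compressible_flow.inward_velocity_impossible[OF refl_flow _ l(2), of "1 - l4"])
      fix x assume "x \<in> {0<..<1 - l4}"
      then have x: "1 - x \<in> {l4<..<1}" by auto
      then have p: "\<rho>0 (1 - x) > 0" using pos l by auto
      then show "0 < r 0 (1 - x)" by (simp add: r0)
      obtain d where d: "(\<rho>0 has_real_derivative d) (at (1 - x))" "d / \<rho>0 (1 - x) \<le> - l2" using H x by blast
      then show "l2 * r 0 (1 - x) \<le> - rx 0 (1 - x)" using p by (simp add: rx0[OF d(1)] r0 field_simps)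
      show "- v 0 (1 - x) \<le> 0" using H x by (simp add: v0)
    qed (use H v0 l in auto)
  qed
qed

end
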